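(* Let $\Omega\subset\mathbb{R}^n$ be a bounded $C^1$ domain, let $p>1$, and let $q:=\frac{p}{p-1}$. For $\alpha>0$ define $$\Lambda(\alpha):=\inf_{u\in W^{1,p}(\Omega),\,u\not\equiv 0}\frac{\int_\Omega|\nabla u|^p\,\mathrm{d}x-\alpha\int_{\partial\Omega}|u|^p\,\mathrm{d}s}{\int_\Omega|u|^p\,\mathrm{d}x}.$$ Then, as $\alpha\to+\infty$, $$\Lambda(\alpha)=(1-p)\alpha^q+o(\alpha^q).$$ In addition, if $\Omega$ is of class $C^{1,\lambda}$ with some $\lambda\in(0,1)$, then $$\Lambda(\alpha)=(1-p)\alpha^q+O(\alpha^k)\quad\text{as }\alpha\to+\infty,\qquad k:=\frac{q+\lambda}{1+\lambda}\in\Big(\frac{q+1}{2},q\Big).$$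
   Context: Here $\mathrm{d}s$ is the hypersurface measure on $\partial\Omega$, and in the integral over $\partial\Omega$ the function $u\in W^{1,p}(\Omega)$ is understood in the sense of its boundary trace. A bounded domain $\Omega\subset\mathbb{R}^n$ is of class $C^1$ (respectively $C^{1,\lambda}$) if each point of $\partial\Omega$ has an open neighborhood $V$ such that, in suitable orthogonal coordinates $y=(y',y_n)$, $y'=(y_1,\dots,y_{n-1})$, one has $V=\{y:\ y'\in V',\ y_n\in(-a_n,a_n)\}$ with $V'=(-a_1,a_1)\times\dots\times(-a_{n-1},a_{n-1})$ and some $a_1,\dots,a_n>0$, and there is a function $\varphi:V'\to\mathbb{R}$ of class $C^1$ (respectively $C^{1,\lambda}$, i.e. $C^1$ with $\lambda$-Hölder continuous first derivatives) with $|\varphi(y')|\le\frac12 a_n$ for all $y'\in V'$, $\Omega\cap V=\{y\in V:\ y_n<\varphi(y')\}$ and $\partial\Omega\cap V=\{y\in V:\ y_n=\varphi(y')\}$. *)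

theory Defs
  imports "HOL-Analysis.Analysis" "HOL-Library.Landau_Symbols"
begin

primrec C_k :: "nat \<Rightarrow> ('a::euclidean_space \<Rightarrow> real) \<Rightarrow> bool" where
  "C_k 0 f \<longleftrightarrow> continuous_on UNIV f"
| "C_k (Suc m) f \<longleftrightarrow> (\<forall>x. f differentiable (at x)) \<and>
      (\<forall>b\<in>Basis. C_k m (\<lambda>x. frechet_derivative f (at x) b))"

definition gradient :: "('a::euclidean_space \<Rightarrow> real) \<Rightarrow> 'a \<Rightarrow> 'a" where
  "gradient f x = (\<Sum>b\<in>Basis. frechet_derivative f (at x) b *\<^sub>R b)"

definition test_functions :: "'a::euclidean_space set \<Rightarrow> ('a \<Rightarrow> real) set" where
  "test_functions \<Omega> = {\<psi>. (\<forall>m. C_k m \<psi>) \<and>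
      compact (closure {x. \<psi> x \<noteq> 0}) \<and> closure {x. \<psi> x \<noteq> 0} \<subseteq> \<Omega>}"

definition in_Lp :: "real \<Rightarrow> 'a measure \<Rightarrow> ('a \<Rightarrow> 'b::real_normed_vector) \<Rightarrow> bool" where
  "in_Lp p M f \<longleftrightarrow> f \<in> borel_measurable M \<and> integrable M (\<lambda>x. norm (f x) powr p)"

definition weak_gradient ::
    "'a::euclidean_space set \<Rightarrow> ('a \<Rightarrow> real) \<Rightarrow> ('a \<Rightarrow> 'a) \<Rightarrow> bool" where
  "weak_gradient \<Omega> u G \<longleftrightarrow>
     (\<forall>\<psi>\<in>test_functions \<Omega>. \<forall>b\<in>Basis.
        (LINT x|lebesgue_on \<Omega>. u x * (gradient \<psi> x \<bullet> b)) =
      - (LINT x|lebesgue_on \<Omega>. (G x \<bullet> b) * \<psi> x))"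

text \<open>\<open>W1p_with_gradient p \<Omega> u G\<close>: \<open>u\<close> belongs to \<open>W\<^sup>1\<^sup>,\<^sup>p(\<Omega>)\<close> and \<open>\<nabla>u = G\<close> (which determines
  \<open>G\<close> almost everywhere).\<close>

definition W1p_with_gradient ::
    "real \<Rightarrow> 'a::euclidean_space set \<Rightarrow> ('a \<Rightarrow> real) \<Rightarrow> ('a \<Rightarrow> 'a) \<Rightarrow> bool" where
  "W1p_with_gradient p \<Omega> u G \<longleftrightarrow>
     in_Lp p (lebesgue_on \<Omega>) u \<and> in_Lp p (lebesgue_on \<Omega>) G \<and> weak_gradient \<Omega> u G"

text \<open>Local coordinates \<open>y\<close> are given by \<open>x = Q y + c\<close> with \<open>Q\<close> orthogonal. The last coordinate
  \<open>y\<^sub>n\<close> is the one along a chosen basis vector \<open>e\<close>, and \<open>y'\<close> is identified with the point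
  \<open>y - (y \<bullet> e) e\<close> of the hyperplane \<open>y \<bullet> e = 0\<close>. The half side lengths of the box are the
  components of the vector \<open>a\<close>.\<close>

definition coord_box :: "'a::euclidean_space \<Rightarrow> 'a set" where
  "coord_box a = {y. \<forall>b\<in>Basis. \<bar>y \<bullet> b\<bar> < a \<bullet> b}"

definition coord_base :: "'a::euclidean_space \<Rightarrow> 'a \<Rightarrow> 'a set" where
  "coord_base e a = {y. y \<bullet> e = 0 \<and> (\<forall>b\<in>Basis - {e}. \<bar>y \<bullet> b\<bar> < a \<bullet> b)}"

text \<open>\<open>g\<close> is the gradient of \<open>\<phi>\<close> as a function on the hyperplane; the condition \<open>g y \<bullet> e = 0\<close>
  makes it unique.\<close>

definition C1_chart ::
    "'a::euclidean_space set \<Rightarrow> ('a \<Rightarrow> 'a) \<Rightarrow> 'a \<Rightarrow> 'a \<Rightarrow> 'a \<Rightarrow> ('a \<Rightarrow> real) \<Rightarrow> ('a \<Rightarrow> 'a) \<Rightarrow> bool"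
where
  "C1_chart \<Omega> Q c e a \<phi> g \<longleftrightarrow>
     orthogonal_transformation Q \<and> e \<in> Basis \<and> (\<forall>b\<in>Basis. 0 < a \<bullet> b) \<and>
     (\<forall>y\<in>coord_base e a.
        (\<phi> has_derivative (\<lambda>h. g y \<bullet> h)) (at y within {z. z \<bullet> e = 0}) \<and> g y \<bullet> e = 0) \<and>
     continuous_on (coord_base e a) g \<and>
     (\<forall>y\<in>coord_base e a. \<bar>\<phi> y\<bar> \<le> (a \<bullet> e) / 2) \<and>
     (\<forall>y\<in>coord_box a.
        (Q y + c \<in> \<Omega> \<longleftrightarrow> y \<bullet> e < \<phi> (y - (y \<bullet> e) *\<^sub>R e)) \<and>
        (Q y + c \<in> frontier \<Omega> \<longleftrightarrow> y \<bullet> e = \<phi> (y - (y \<bullet> e) *\<^sub>R e)))"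

definition chart_domain :: "('a::euclidean_space \<Rightarrow> 'a) \<Rightarrow> 'a \<Rightarrow> 'a \<Rightarrow> 'a set" where
  "chart_domain Q c a = (\<lambda>y. Q y + c) ` coord_box a"

definition bounded_domain :: "'a::euclidean_space set \<Rightarrow> bool" where
  "bounded_domain \<Omega> \<longleftrightarrow> open \<Omega> \<and> connected \<Omega> \<and> bounded \<Omega> \<and> \<Omega> \<noteq> {}"

definition C1_domain :: "'a::euclidean_space set \<Rightarrow> bool" where
  "C1_domain \<Omega> \<longleftrightarrow> bounded_domain \<Omega> \<and>
     (\<forall>x\<in>frontier \<Omega>. \<exists>Q c e a \<phi> g. C1_chart \<Omega> Q c e a \<phi> g \<and> x \<in> chart_domain Q c a)"

definition C1_holder_domain :: "real \<Rightarrow> 'a::euclidean_space set \<Rightarrow> bool" where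
  "C1_holder_domain \<theta> \<Omega> \<longleftrightarrow> bounded_domain \<Omega> \<and>
     (\<forall>x\<in>frontier \<Omega>. \<exists>Q c e a \<phi> g. C1_chart \<Omega> Q c e a \<phi> g \<and> x \<in> chart_domain Q c a \<and>
        (\<exists>C. \<forall>y\<in>coord_base e a. \<forall>z\<in>coord_base e a. norm (g y - g z) \<le> C * norm (y - z) powr \<theta>))"

text \<open>Lebesgue measure of dimension \<open>n - 1\<close> on the hyperplane \<open>y \<bullet> e = 0\<close>, for \<open>e \<in> Basis\<close>
  (the point mass at \<open>0\<close> if \<open>n = 1\<close>).\<close>

definition hyperplane_lborel :: "'a::euclidean_space \<Rightarrow> 'a measure" where
  "hyperplane_lborel e =
     distr (\<Pi>\<^sub>M b\<in>Basis - {e}. (lborel :: real measure)) borel (\<lambda>f. \<Sum>b\<in>Basis - {e}. f b *\<^sub>R b)"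

text \<open>The Borel measure \<open>ds\<close> on the boundary (extended by zero), characterised by the area element
  \<open>sqrt (1 + |\<nabla>\<phi>|\<^sup>2) dy'\<close> in every chart. For a bounded \<open>C\<^sup>1\<close> domain it exists and is unique.\<close>

definition hypersurface_measure :: "'a::euclidean_space set \<Rightarrow> 'a measure \<Rightarrow> bool" where
  "hypersurface_measure \<Omega> \<sigma> \<longleftrightarrow>
     sets \<sigma> = sets borel \<and> emeasure \<sigma> (- frontier \<Omega>) = 0 \<and>
     (\<forall>Q c e a \<phi> g. C1_chart \<Omega> Q c e a \<phi> g \<longrightarrow>
        (\<forall>A\<in>sets borel. A \<subseteq> chart_domain Q c a \<longrightarrow>
           emeasure \<sigma> A =
             (\<integral>\<^sup>+y\<in>coord_base e a.
                ennreal (sqrt (1 + (norm (g y))\<^sup>2)) * indicator A (Q (y + \<phi> y *\<^sub>R e) + c)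
              \<partial>hyperplane_lborel e)))"

text \<open>\<open>w\<close> is the trace of \<open>u\<close> (with weak gradient \<open>G\<close>): the image of \<open>u\<close> under the continuous
  extension to \<open>W\<^sup>1\<^sup>,\<^sup>p(\<Omega>)\<close> of the restriction to the boundary of functions that are \<open>C\<^sup>1\<close> up to
  the boundary, i.e. have a \<open>C\<^sup>1\<close> extension to the whole space. By the trace theorem, for a bounded \<open>C\<^sup>1\<close> domain every \<open>u\<close> in \<open>W\<^sup>1\<^sup>,\<^sup>p(\<Omega>)\<close> has
  such a \<open>w\<close>, and it is unique up to \<open>\<sigma>\<close>-null sets.\<close>

definition boundary_trace ::
    "real \<Rightarrow> 'a::euclidean_space set \<Rightarrow> 'a measure \<Rightarrow> ('a \<Rightarrow> real) \<Rightarrow> ('a \<Rightarrow> 'a) \<Rightarrow> ('a \<Rightarrow> real) \<Rightarrow> bool"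
where
  "boundary_trace p \<Omega> \<sigma> u G w \<longleftrightarrow> in_Lp p \<sigma> w \<and>
     (\<exists>v :: nat \<Rightarrow> 'a \<Rightarrow> real. (\<forall>j. C_k 1 (v j)) \<and>
        (\<lambda>j. LINT x|lebesgue_on \<Omega>. \<bar>v j x - u x\<bar> powr p) \<longlonglongrightarrow> 0 \<and>
        (\<lambda>j. LINT x|lebesgue_on \<Omega>. norm (gradient (v j) x - G x) powr p) \<longlonglongrightarrow> 0 \<and>
        (\<lambda>j. LINT x|\<sigma>. \<bar>v j x - w x\<bar> powr p) \<longlonglongrightarrow> 0)"

definition robin_Lambda ::
    "real \<Rightarrow> 'a::euclidean_space set \<Rightarrow> 'a measure \<Rightarrow> real \<Rightarrow> real" where
  "robin_Lambda p \<Omega> \<sigma> \<alpha> =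
     Inf {((LINT x|lebesgue_on \<Omega>. norm (G x) powr p) - \<alpha> * (LINT x|\<sigma>. \<bar>w x\<bar> powr p)) /
          (LINT x|lebesgue_on \<Omega>. \<bar>u x\<bar> powr p) | u G w.
            W1p_with_gradient p \<Omega> u G \<and> boundary_trace p \<Omega> \<sigma> u G w \<and>
            \<not> (AE x in lebesgue_on \<Omega>. u x = 0)}"

end

theory Submission
  imports Defs
begin

text \<open>
  For the upper bound, fix a unit vector \<open>\<nu>\<close> and put \<open>\<beta> = \<alpha>\<^sup>q\<^sup>-\<^sup>1\<close>. The function
  \<open>u x = exp (\<beta> (x \<bullet> \<nu>))\<close> satisfies \<open>|\<nabla>u| = \<beta> u\<close>, and the divergence theorem for the field \<open>u\<^sup>p \<nu>\<close>
  shows that \<open>p \<beta>\<close> times the integral of \<open>u\<^sup>p\<close> over \<open>\<Omega>\<close> equals the boundary integral of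
  \<open>u\<^sup>p (\<nu> \<bullet> n)\<close>, where \<open>n\<close> is the outer unit normal; so it is at most the boundary integral of
  \<open>u\<^sup>p\<close>. As \<open>\<beta>\<^sup>p = \<alpha> \<beta> = \<alpha>\<^sup>q\<close>, the Rayleigh quotient of \<open>u\<close> is at most \<open>(1 - p) \<alpha>\<^sup>q\<close>, without
  any error term (\<open>robin_exponential_test_function\<close>).

  For the lower bound, let \<open>Z\<close> be a vector field with \<open>|Z| \<le> 1\<close> and \<open>|div Z| \<le> C / \<delta>\<close> in \<open>\<Omega>\<close>, and
  \<open>Z \<bullet> n \<ge> 1 - 2 \<epsilon>\<close> on the boundary. The divergence theorem for \<open>|v|\<^sup>p Z\<close> bounds \<open>1 - 2 \<epsilon>\<close> times
  the boundary integral of \<open>|v|\<^sup>p\<close> by the integral of \<open>p |v|\<^sup>p\<^sup>-\<^sup>1 |\<nabla>v| + (C / \<delta>) |v|\<^sup>p\<close> over \<open>\<Omega>\<close>,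
  and Young's inequality turns this into
  \<open>\<Lambda>(\<alpha>) \<ge> - (p - 1) (\<alpha> / (1 - 2 \<epsilon>))\<^sup>q - (C / \<delta>) \<alpha> / (1 - 2 \<epsilon>)\<close>.
  The field is glued from constant vectors: \<open>Z\<close> is the sum of \<open>\<zeta>\<^sub>k \<nu>\<^sub>k\<close>, where the \<open>\<zeta>\<^sub>k\<close> are bumps on a
  lattice of scale \<open>\<delta>\<close> that add up to \<open>1\<close>, and \<open>\<nu>\<^sub>k\<close> is normal to the boundary, up to an error of order
  \<open>\<epsilon>\<close>, near the support of \<open>\<zeta>\<^sub>k\<close> (\<open>surface_le_bulk\<close>). Boundedly many bumps overlap at each point, so \<open>C\<close> depends on the
  dimension only, and \<open>\<epsilon>\<close> is the oscillation of the chart gradients at scale \<open>\<delta>\<close> (\<open>nearly_flat\<close>).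
  For a \<open>C\<^sup>1\<close> boundary every \<open>\<epsilon> > 0\<close> is reached at some scale, which gives the \<open>o\<close>-statement. For a
  boundary of class \<open>C\<^sup>1\<^sup>,\<^sup>\<theta>\<close> one has \<open>\<epsilon> = L \<delta>\<^sup>\<theta>\<close>, and \<open>\<delta> = \<alpha>\<^sup>-\<^sup>s\<close> with \<open>s = (q - 1) / (1 + \<theta>)\<close> makes the
  two errors \<open>\<epsilon> \<alpha>\<^sup>q\<close> and \<open>\<alpha> / \<delta>\<close> both of size \<open>\<alpha>\<^sup>k\<close>.

  Each summand of a field split in this way is a constant vector times a function that is supported
  in one chart or away from the boundary. The divergence theorem in a chart (\<open>chart_divergence\<close>) comes from differentiating the integral of
  \<open>f x\<close> over the translated domain \<open>\<Omega> + t \<nu>\<close> at \<open>t = 0\<close> in two ways: shifting the translation to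
  \<open>f\<close> produces the integral of \<open>\<nabla>f \<bullet> \<nu>\<close> over \<open>\<Omega>\<close>, and integrating first along the graph direction
  produces the flux through the graph. The estimates, proved for \<open>C\<^sup>1\<close> functions, pass to
  Sobolev functions because all three integrals of the quotient are continuous along the approximating
  sequence that defines the trace (\<open>robin_form_lower_bound\<close>).
\<close>

section \<open>Integration over hyperplanes and orthogonal maps\<close>

lemma sum_Basis_fun_upd:
  fixes e :: "'a::euclidean_space"
  assumes e: "e \<in> Basis"
  shows "(\<Sum>b\<in>Basis. (x(e := s)) b *\<^sub>R b) = (\<Sum>b\<in>Basis-{e}. x b *\<^sub>R b) + s *\<^sub>R e"
proof -
  have "(\<Sum>b\<in>Basis. (x(e := s)) b *\<^sub>R b) = s *\<^sub>R e + (\<Sum>b\<in>Basis-{e}. (x(e := s)) b *\<^sub>R b)"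
    by (subst sum.remove[OF _ e]) auto
  also have "(\<Sum>b\<in>Basis-{e}. (x(e := s)) b *\<^sub>R b) = (\<Sum>b\<in>Basis-{e}. x b *\<^sub>R b)"
    by (rule sum.cong) auto
  finally show ?thesis by simp
qed

text \<open>Lebesgue measure is a product over the basis; the factor of \<open>e\<close> is split off.\<close>
lemma nn_integral_lborel_hyperplane:
  fixes f :: "'a::euclidean_space \<Rightarrow> ennreal"
  assumes e: "e \<in> Basis" and [measurable]: "f \<in> borel_measurable borel"
  shows "(\<integral>\<^sup>+x. f x \<partial>lborel) = (\<integral>\<^sup>+y. (\<integral>\<^sup>+s. f (y + s *\<^sub>R e) \<partial>lborel) \<partial>hyperplane_lborel e)"
proof -
  interpret product_sigma_finite "\<lambda>b::'a. lborel :: real measure"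
    by standard
  have ins: "insert e (Basis - {e}) = Basis" using e by auto
  have "(\<integral>\<^sup>+x. f x \<partial>lborel) =
      (\<integral>\<^sup>+x. f (\<Sum>b\<in>Basis. x b *\<^sub>R b) \<partial>(\<Pi>\<^sub>M b\<in>insert e (Basis - {e}). lborel))"
    unfolding ins by (subst lborel_eq, subst nn_integral_distr) simp_all
  also have "\<dots> = (\<integral>\<^sup>+x. \<integral>\<^sup>+s. f (\<Sum>b\<in>Basis. (x(e := s)) b *\<^sub>R b) \<partial>lborel \<partial>(\<Pi>\<^sub>M b\<in>Basis - {e}. lborel))"
    by (subst product_nn_integral_insert) (auto simp: ins)
  also have "\<dots> = (\<integral>\<^sup>+y. (\<integral>\<^sup>+s. f (y + s *\<^sub>R e) \<partial>lborel) \<partial>hyperplane_lborel e)"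
    unfolding hyperplane_lborel_def sum_Basis_fun_upd[OF e] by (subst nn_integral_distr) simp_all
  finally show ?thesis .
qed

lemma integral_lborel_hyperplane:
  fixes f :: "'a::euclidean_space \<Rightarrow> real"
  assumes e: "e \<in> Basis" and int: "integrable lborel f" and [measurable]: "f \<in> borel_measurable borel"
  shows "(LINT x|lborel. f x) = (LINT y|hyperplane_lborel e. (LINT s|lborel. f (y + s *\<^sub>R e)))"
proof -
  interpret product_sigma_finite "\<lambda>b::'a. lborel :: real measure"
    by standard
  have ins: "insert e (Basis - {e}) = Basis" using e by auto
  have int': "integrable (\<Pi>\<^sub>M b\<in>insert e (Basis - {e}). lborel) (\<lambda>x. f (\<Sum>b\<in>Basis. x b *\<^sub>R b))"
    using int unfolding ins by (subst (asm) lborel_eq, subst (asm) integrable_distr_eq) simp_all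
  have "(LINT x|lborel. f x) =
      (\<integral>x. f (\<Sum>b\<in>Basis. x b *\<^sub>R b) \<partial>(\<Pi>\<^sub>M b\<in>insert e (Basis - {e}). lborel))"
    unfolding ins by (subst lborel_eq, subst integral_distr) simp_all
  also have "\<dots> = (\<integral>x. \<integral>s. f (\<Sum>b\<in>Basis. (x(e := s)) b *\<^sub>R b) \<partial>lborel \<partial>(\<Pi>\<^sub>M b\<in>Basis - {e}. lborel))"
    by (subst product_integral_insert) (use int' in \<open>auto simp: ins\<close>)
  also have "\<dots> = (LINT y|hyperplane_lborel e. (LINT s|lborel. f (y + s *\<^sub>R e)))"
    unfolding hyperplane_lborel_def sum_Basis_fun_upd[OF e] by (subst integral_distr) simp_all
  finally show ?thesis .
qed

lemma sets_hyperplane_lborel [simp, measurable_cong]: "sets (hyperplane_lborel e) = sets borel"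
  and space_hyperplane_lborel [simp]: "space (hyperplane_lborel e) = UNIV"
  by (simp_all add: hyperplane_lborel_def)

lemma AE_hyperplane_lborel:
  assumes "e \<in> Basis"
  shows "AE y in hyperplane_lborel e. y \<bullet> e = 0"
  unfolding hyperplane_lborel_def using assms
  by (subst AE_distr_iff) (auto simp: inner_sum_left inner_Basis intro!: AE_I2 sum.neutral)

text \<open>Thickening \<open>S\<close> by a unit segment in direction \<open>e\<close> gives a bounded set, whose finite Lebesgue
  measure dominates the measure of \<open>S\<close>.\<close>
lemma hyperplane_lborel_bounded_finite:
  fixes S :: "'a::euclidean_space set"
  assumes e: "e \<in> Basis" and [measurable]: "S \<in> sets borel" and S: "bounded S"
  shows "emeasure (hyperplane_lborel e) S < \<infinity>"
proof -
  obtain R where R: "\<And>x. x \<in> S \<Longrightarrow> norm x \<le> R" using S by (auto simp: bounded_iff)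
  define B where "B = cball (0::'a) (R + 1)"
  have [measurable]: "B \<in> sets borel" by (simp add: B_def)
  have "emeasure (hyperplane_lborel e) S = (\<integral>\<^sup>+y. indicator S y \<partial>hyperplane_lborel e)"
    by (simp add: nn_integral_indicator)
  also have "\<dots> \<le> (\<integral>\<^sup>+y. (\<integral>\<^sup>+s. indicator B (y + s *\<^sub>R e) \<partial>lborel) \<partial>hyperplane_lborel e)"
  proof (rule nn_integral_mono)
    fix y :: 'a
    show "indicator S y \<le> (\<integral>\<^sup>+s. indicator B (y + s *\<^sub>R e) \<partial>lborel)"
    proof (cases "y \<in> S")
      case True
      have "(\<integral>\<^sup>+s. indicator {0..1::real} s \<partial>lborel) \<le> (\<integral>\<^sup>+s. indicator B (y + s *\<^sub>R e) \<partial>lborel)"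
      proof (rule nn_integral_mono)
        fix s :: real
        show "indicator {0..1::real} s \<le> (indicator B (y + s *\<^sub>R e) :: ennreal)"
        proof (cases "s \<in> {0..1}")
          case s: True
          have "norm (y + s *\<^sub>R e) \<le> norm y + norm (s *\<^sub>R e)" by (rule norm_triangle_ineq)
          also have "\<dots> \<le> R + 1" using R[OF True] s e by auto
          finally show ?thesis by (auto simp: B_def indicator_def)
        qed auto
      qed
      then show ?thesis using True by (simp add: nn_integral_indicator)
    qed auto
  qed
  also have "\<dots> = (\<integral>\<^sup>+x. indicator B x \<partial>lborel)"
    by (rule nn_integral_lborel_hyperplane[OF e, symmetric]) simp
  also have "\<dots> = emeasure lborel B" by (simp add: nn_integral_indicator)
  also have "\<dots> < \<infinity>" using emeasure_lborel_cball_finite[of "0::'a" "R + 1"] by (simp add: B_def less_top)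
  finally show ?thesis .
qed

text \<open>The image measure \<open>M\<close> is invariant under translations. For two such measures \<open>M\<close> and \<open>N\<close>,
  Fubini and the substitutions \<open>y \<mapsto> y - x\<close> and \<open>x \<mapsto> x + y\<close> yield \<open>M(A) N(B) = N(A) M(-B)\<close>. With \<open>B\<close> the
  unit ball, which \<open>Q\<close> maps to itself, the constant of proportionality is \<open>1\<close>.\<close>
lemma lborel_distr_orthogonal:
  fixes Q :: "'a::euclidean_space \<Rightarrow> 'a"
  assumes Q: "orthogonal_transformation Q"
  shows "distr lborel borel Q = lborel"
proof -
  define M where "M = distr lborel borel Q"
  have lin: "linear Q" using Q by (simp add: orthogonal_transformation_def)
  have contQ: "continuous_on UNIV Q" using lin by (simp add: linear_continuous_on linear_linear)
  then have [measurable]: "Q \<in> borel_measurable borel" by (rule borel_measurable_continuous_onI)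
  define Q' where "Q' = inv Q"
  have Q': "orthogonal_transformation Q'" using Q by (simp add: Q'_def orthogonal_transformation_inv)
  have QQ': "Q (Q' x) = x" "Q' (Q x) = x" for x
    unfolding Q'_def using orthogonal_transformation_bij[OF Q] by (simp_all add: bij_is_surj surj_f_inv_f bij_is_inj)
  have [simp]: "sets M = sets borel" "space M = UNIV" by (simp_all add: M_def)
  have [measurable_cong]: "sets M = sets borel" by simp
  have transl: "(\<integral>\<^sup>+x. f (x + y) \<partial>M) = (\<integral>\<^sup>+x. f x \<partial>M)" if [measurable]: "f \<in> borel_measurable borel" for f :: "'a \<Rightarrow> ennreal" and y
  proof -
    have "(\<integral>\<^sup>+x. f (x + y) \<partial>M) = (\<integral>\<^sup>+x. f (Q x + y) \<partial>lborel)"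
      unfolding M_def by (subst nn_integral_distr) simp_all
    also have "\<dots> = (\<integral>\<^sup>+x. f (Q (Q' y + x)) \<partial>lborel)"
      using lin by (simp add: linear_add QQ' add.commute)
    also have "\<dots> = (\<integral>\<^sup>+x. f (Q x) \<partial>distr lborel borel ((+) (Q' y)))"
      by (subst nn_integral_distr) simp_all
    also have "\<dots> = (\<integral>\<^sup>+x. f x \<partial>M)"
      unfolding lborel_distr_plus M_def by (subst nn_integral_distr) simp_all
    finally show ?thesis .
  qed
  have transl': "(\<integral>\<^sup>+x. f (x + y) \<partial>lborel) = (\<integral>\<^sup>+x. f x \<partial>lborel)" if [measurable]: "f \<in> borel_measurable borel" for f :: "'a \<Rightarrow> ennreal" and y
  proof -
    have "(\<integral>\<^sup>+x. f x \<partial>distr lborel borel ((+) y)) = (\<integral>\<^sup>+x. f (x + y) \<partial>lborel)"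
      by (subst nn_integral_distr) (simp_all add: add.commute)
    then show ?thesis by (simp add: lborel_distr_plus)
  qed
  define B where "B = ball (0::'a) 1"
  have [measurable]: "B \<in> sets borel" by (simp add: B_def)
  have MB: "emeasure M B = emeasure lborel B"
  proof -
    have "Q -` B = B" using Q by (auto simp: B_def orthogonal_transformation_norm)
    then show ?thesis unfolding M_def by (subst emeasure_distr) auto
  qed
  interpret M: sigma_finite_measure M
  proof (unfold_locales, intro exI[of _ "range (\<lambda>n. ball 0 (real n))"] conjI)
    show "\<Union> (range (\<lambda>n. ball (0::'a) (real n))) = space M"
      using reals_Archimedean2 by auto
    show "\<forall>a\<in>range (\<lambda>n. ball (0::'a) (real n)). emeasure M a \<noteq> \<infinity>"
    proof safe
      fix n assume *: "emeasure M (ball (0::'a) (real n)) = \<infinity>"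
      have "Q -` ball (0::'a) (real n) = ball 0 (real n)" using Q by (auto simp: orthogonal_transformation_norm)
      then have "emeasure M (ball (0::'a) (real n)) = emeasure lborel (ball (0::'a) (real n))"
        unfolding M_def by (subst emeasure_distr) auto
      then show False using * emeasure_lborel_ball_finite[of "0::'a" "real n"] by simp
    qed
  qed auto
  interpret P: pair_sigma_finite M "lborel :: 'a measure" ..
  have "emeasure M A = emeasure lborel A" if [measurable]: "A \<in> sets borel" for A
  proof -
    \<comment> \<open>first \<open>y \<mapsto> y - x\<close> in the inner integral, then \<open>x \<mapsto> x + y\<close> after exchanging the integrals\<close>
    have "emeasure M A * emeasure lborel B = (\<integral>\<^sup>+x. \<integral>\<^sup>+y. indicator A x * indicator B y \<partial>lborel \<partial>M)"
      by (simp add: nn_integral_cmult nn_integral_multc nn_integral_indicator)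
    also have "\<dots> = (\<integral>\<^sup>+x. \<integral>\<^sup>+y. indicator A x * indicator B (y + - x) \<partial>lborel \<partial>M)"
      by (subst transl') simp_all
    also have "\<dots> = (\<integral>\<^sup>+y. \<integral>\<^sup>+x. indicator A x * indicator B (y + - x) \<partial>M \<partial>lborel)"
      by (rule P.Fubini'[symmetric]) simp
    also have "\<dots> = (\<integral>\<^sup>+y. \<integral>\<^sup>+x. indicator A (x + y) * indicator B (y + - (x + y)) \<partial>M \<partial>lborel)"
    proof (rule nn_integral_cong)
      fix y
      show "(\<integral>\<^sup>+x. indicator A x * indicator B (y + - x) \<partial>M) =
          (\<integral>\<^sup>+x. indicator A (x + y) * indicator B (y + - (x + y)) \<partial>M)"
        by (rule transl[symmetric, where f="\<lambda>x. indicator A x * indicator B (y + - x)"]) simp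
    qed
    also have "\<dots> = (\<integral>\<^sup>+y. \<integral>\<^sup>+x. indicator A (x + y) * indicator B x \<partial>M \<partial>lborel)"
      by (intro nn_integral_cong) (auto simp: B_def indicator_def)
    also have "\<dots> = (\<integral>\<^sup>+x. \<integral>\<^sup>+y. indicator A (y + x) * indicator B x \<partial>lborel \<partial>M)"
      by (subst P.Fubini') (simp_all add: add.commute)
    also have "\<dots> = (\<integral>\<^sup>+x. \<integral>\<^sup>+y. indicator A y * indicator B x \<partial>lborel \<partial>M)"
    proof (rule nn_integral_cong)
      fix x
      show "(\<integral>\<^sup>+y. indicator A (y + x) * indicator B x \<partial>lborel) = (\<integral>\<^sup>+y. indicator A y * indicator B x \<partial>lborel)"
        by (rule transl'[where f="\<lambda>y. indicator A y * indicator B x"]) simp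
    qed
    also have "\<dots> = emeasure lborel A * emeasure M B"
      by (simp add: nn_integral_cmult nn_integral_multc nn_integral_indicator)
    finally have eq: "emeasure M A * emeasure lborel B = emeasure lborel A * emeasure lborel B" by (simp add: MB)
    have "emeasure lborel B \<noteq> \<infinity>" using emeasure_lborel_ball_finite[of "0::'a" 1] by (simp add: B_def)
    moreover have "emeasure lborel B \<noteq> 0"
      using open_not_negligible[of B] by (auto simp: B_def negligible_iff_null_sets null_sets_def emeasure_completion main_part_sets)
    ultimately show ?thesis using eq ennreal_mult_divide_eq infinity_ennreal_def by metis
  qed
  then have "M = lborel" by (intro measure_eqI) auto
  then show ?thesis by (simp add: M_def)
qed

section \<open>Continuously differentiable functions\<close>

text \<open>Carrying the gradient as a parameter makes products and compositions explicit; \<open>C1_gradient_gradient\<close>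
  and \<open>C_k_1_C1_gradient\<close> translate from and to \<open>C_k 1\<close>.\<close>
definition C1_gradient :: "('a::euclidean_space \<Rightarrow> real) \<Rightarrow> ('a \<Rightarrow> 'a) \<Rightarrow> bool" where
  "C1_gradient f F \<longleftrightarrow> (\<forall>x. (f has_derivative (\<lambda>h. F x \<bullet> h)) (at x)) \<and> continuous_on UNIV F"

lemma C1_gradientD:
  assumes "C1_gradient f F"
  shows "(f has_derivative (\<lambda>h. F x \<bullet> h)) (at x within S)" "continuous_on S F" "continuous_on S f"
proof -
  show D: "(f has_derivative (\<lambda>h. F x \<bullet> h)) (at x within S)" for x S
    using assms by (auto simp: C1_gradient_def intro: has_derivative_at_withinI)
  show "continuous_on S F"
    using assms by (auto simp: C1_gradient_def intro: continuous_on_subset)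
  show "continuous_on S f"
    using D by (rule has_derivative_continuous_on)
qed

lemma C1_gradient_gradient:
  assumes "C1_gradient f F"
  shows "C_k 1 f" "gradient f = F"
proof -
  have fd: "frechet_derivative f (at x) = (\<lambda>h. F x \<bullet> h)" for x
    using C1_gradientD(1)[OF assms, of x UNIV] by (rule frechet_derivative_at[symmetric])
  show "gradient f = F"
    by (rule ext) (simp add: gradient_def fd euclidean_representation)
  show "C_k 1 f"
    using C1_gradientD(1)[OF assms, of _ UNIV] C1_gradientD(2)[OF assms, of UNIV]
    by (auto simp: fd differentiable_def intro!: continuous_intros)
qed

lemma C_k_1_C1_gradient:
  assumes "C_k 1 f"
  shows "C1_gradient f (gradient f)"
proof -
  have d: "f differentiable (at x)" and c: "b \<in> Basis \<Longrightarrow> continuous_on UNIV (\<lambda>x. frechet_derivative f (at x) b)" for x b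
    using assms by auto
  have "(f has_derivative frechet_derivative f (at x)) (at x)" for x
    using d frechet_derivative_works by blast
  moreover have "frechet_derivative f (at x) = (\<lambda>h. gradient f x \<bullet> h)" for x
  proof
    fix h
    have lin: "linear (frechet_derivative f (at x))"
      using d by (rule linear_frechet_derivative)
    have "frechet_derivative f (at x) h = frechet_derivative f (at x) (\<Sum>b\<in>Basis. (h \<bullet> b) *\<^sub>R b)"
      by (simp add: euclidean_representation)
    also have "\<dots> = (\<Sum>b\<in>Basis. (h \<bullet> b) * frechet_derivative f (at x) b)"
      using lin by (simp add: linear_sum linear_scale)
    also have "\<dots> = gradient f x \<bullet> h"
      unfolding gradient_def inner_sum_left inner_scaleR_left
      by (intro sum.cong refl) (simp only: inner_commute[of h] mult.commute)
    finally show "frechet_derivative f (at x) h = gradient f x \<bullet> h" .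
  qed
  moreover have "continuous_on UNIV (gradient f)"
    unfolding gradient_def using c by (intro continuous_intros) auto
  ultimately show ?thesis by (simp add: C1_gradient_def)
qed

lemma C1_gradient_mult:
  assumes "C1_gradient f F" "C1_gradient g G"
  shows "C1_gradient (\<lambda>x. f x * g x) (\<lambda>x. g x *\<^sub>R F x + f x *\<^sub>R G x)"
  unfolding C1_gradient_def
proof (intro conjI allI)
  fix x
  show "((\<lambda>x. f x * g x) has_derivative (\<lambda>h. (g x *\<^sub>R F x + f x *\<^sub>R G x) \<bullet> h)) (at x)"
    by (rule derivative_eq_intros C1_gradientD(1)[OF assms(1)] C1_gradientD(1)[OF assms(2)] refl)+
       (simp add: fun_eq_iff inner_add_left)
  show "continuous_on UNIV (\<lambda>x. g x *\<^sub>R F x + f x *\<^sub>R G x)"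
    by (intro continuous_intros C1_gradientD[OF assms(1)] C1_gradientD[OF assms(2)])
qed

lemma C1_gradient_compose:
  assumes "C1_gradient f F" and d: "\<And>t. (\<phi> has_real_derivative \<phi>' t) (at t)" and c: "continuous_on UNIV \<phi>'"
  shows "C1_gradient (\<lambda>x. \<phi> (f x)) (\<lambda>x. \<phi>' (f x) *\<^sub>R F x)"
  unfolding C1_gradient_def
proof (intro conjI allI)
  fix x
  have "(\<phi> has_derivative (\<lambda>h. \<phi>' (f x) * h)) (at (f x))"
    using d by (simp add: has_field_derivative_def)
  from has_derivative_compose[OF C1_gradientD(1)[OF assms(1)] this]
  show "((\<lambda>x. \<phi> (f x)) has_derivative (\<lambda>h. (\<phi>' (f x) *\<^sub>R F x) \<bullet> h)) (at x)"
    by (simp add: o_def)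
  show "continuous_on UNIV (\<lambda>x. \<phi>' (f x) *\<^sub>R F x)"
    by (intro continuous_intros C1_gradientD[OF assms(1)] continuous_on_compose2[OF c]) auto
qed

lemma C1_gradient_inner: "C1_gradient (\<lambda>x. x \<bullet> \<nu>) (\<lambda>x. \<nu>)"
  unfolding C1_gradient_def
  by (auto intro!: derivative_eq_intros simp: inner_commute)

lemma C1_gradient_sum:
  assumes "finite A" "\<And>k. k \<in> A \<Longrightarrow> C1_gradient (f k) (F k)"
  shows "C1_gradient (\<lambda>x. \<Sum>k\<in>A. f k x) (\<lambda>x. \<Sum>k\<in>A. F k x)"
  unfolding C1_gradient_def
proof (intro conjI allI)
  fix x
  show "((\<lambda>x. \<Sum>k\<in>A. f k x) has_derivative (\<lambda>h. (\<Sum>k\<in>A. F k x) \<bullet> h)) (at x)"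
    using assms by (simp add: inner_sum_left) (intro has_derivative_sum C1_gradientD(1))
  show "continuous_on UNIV (\<lambda>x. \<Sum>k\<in>A. F k x)"
    using assms by (intro continuous_intros C1_gradientD(2))
qed

lemma C1_gradient_vanishing:
  assumes f: "C1_gradient f F" and S: "open S" "x \<in> S" "\<And>y. y \<in> S \<Longrightarrow> f y = 0"
  shows "F x = 0"
proof -
  have "((\<lambda>x. 0) has_derivative (\<lambda>h. F x \<bullet> h)) (at x)"
    by (rule has_derivative_transform_within_open[OF C1_gradientD(1)[OF f] S(1,2)]) (simp add: S(3))
  then have "(\<lambda>h. F x \<bullet> h) = (\<lambda>h. 0)"
    using has_derivative_unique has_derivative_const by blast
  then have "F x \<bullet> F x = 0" by meson
  then show ?thesis by simp
qed

lemma C1_gradient_lipschitz: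
  assumes f: "C1_gradient f F" and M: "\<And>x. norm (F x) \<le> M"
  shows "\<bar>f y - f x\<bar> \<le> M * norm (y - x)"
proof -
  have "norm (f y - f x) \<le> M * norm (y - x)"
  proof (rule differentiable_bound[OF convex_UNIV])
    show "(f has_derivative (\<lambda>h. F x \<bullet> h)) (at x within UNIV)" for x by (rule C1_gradientD(1)[OF f])
    show "onorm ((\<bullet>) (F x)) \<le> M" for x
    proof (rule onorm_bound)
      show "0 \<le> M" using M[of x] norm_ge_zero order_trans by blast
      show "norm (F x \<bullet> h) \<le> M * norm h" for h
        using Cauchy_Schwarz_ineq2[of "F x" h] mult_right_mono[OF M[of x] norm_ge_zero[of h]] by simp
    qed
  qed auto
  then show ?thesis by simp
qed

lemma C1_gradient_bounded:
  assumes f: "C1_gradient f F" and R: "\<And>x. norm x > R \<Longrightarrow> f x = 0"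
  obtains M where "M > 0" "\<And>x. \<bar>f x\<bar> \<le> M" "\<And>x. norm (F x) \<le> M"
proof -
  have "compact (f ` cball 0 R)" "compact (F ` cball 0 R)"
    by (intro compact_continuous_image C1_gradientD[OF f] compact_cball)+
  then have "bounded (f ` cball 0 R)" "bounded (F ` cball 0 R)" by (auto dest: compact_imp_bounded)
  then obtain a b where ab: "\<And>x. norm x \<le> R \<Longrightarrow> \<bar>f x\<bar> \<le> a" "\<And>x. norm x \<le> R \<Longrightarrow> norm (F x) \<le> b"
    unfolding bounded_iff by (force simp: Ball_def)
  have F0: "F x = 0" if "norm x > R" for x
    by (rule C1_gradient_vanishing[OF f, where S="- cball 0 R"]) (use that R in auto)
  show ?thesis
  proof (rule that[of "max 1 (max a b)"])
    show "\<bar>f x\<bar> \<le> max 1 (max a b)" for x using ab(1)[of x] R[of x] by (cases "norm x \<le> R") auto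
    show "norm (F x) \<le> max 1 (max a b)" for x using ab(2)[of x] F0[of x] by (cases "norm x \<le> R") auto
  qed auto
qed

lemma integral_lborel_translate:
  fixes f :: "'a::euclidean_space \<Rightarrow> real"
  assumes [measurable]: "f \<in> borel_measurable borel"
  shows "(LINT x|lborel. f (x + c)) = (LINT x|lborel. f x)"
proof -
  have "(LINT x|distr lborel borel ((+) c). f x) = (LINT x|lborel. f (c + x))"
    by (subst integral_distr) simp_all
  then show ?thesis by (simp add: lborel_distr_plus add.commute)
qed

lemma integrable_lborel_bounded_support:
  fixes f :: "'a::euclidean_space \<Rightarrow> 'b::{banach,second_countable_topology}"
  assumes [measurable]: "f \<in> borel_measurable borel" and M: "\<And>x. norm (f x) \<le> M" and R: "\<And>x. norm x > R \<Longrightarrow> f x = 0"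
  shows "integrable lborel f"
proof (rule Bochner_Integration.integrable_bound)
  show "integrable lborel (\<lambda>x. M * indicator (cball (0::'a) R) x)"
    using emeasure_lborel_cball_finite[of "0::'a" R]
    by (intro integrable_mult_right integrable_real_indicator) (auto simp: less_top)
  show "AE x in lborel. norm (f x) \<le> norm (M * indicator (cball (0::'a) R) x)"
  proof (rule AE_I2)
    fix x show "norm (f x) \<le> norm (M * indicator (cball (0::'a) R) x)"
      using M[of x] R[of x] by (cases "norm x \<le> R") (auto simp: indicator_def)
  qed
qed simp

text \<open>Substituting \<open>x + t \<nu>\<close> moves the translation from the indicator to \<open>f\<close>, whose difference quotients
  are dominated by its Lipschitz constant on a bounded set.\<close>
lemma translation_difference_quotient:
  fixes f :: "'a::euclidean_space \<Rightarrow> real"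
  assumes f: "C1_gradient f F" and R: "\<And>x. norm x > R \<Longrightarrow> f x = 0" and [measurable]: "\<Omega> \<in> sets borel"
    and t: "t \<longlonglongrightarrow> 0" "\<And>n. t n \<noteq> 0" "\<And>n. \<bar>t n\<bar> \<le> 1"
  shows "(\<lambda>n. ((LINT x|lborel. f x * indicator \<Omega> (x - t n *\<^sub>R \<nu>)) - (LINT x|lborel. f x * indicator \<Omega> x)) / t n)
    \<longlonglongrightarrow> (LINT x|lborel. (F x \<bullet> \<nu>) * indicator \<Omega> x)"
proof -
  obtain M where M: "M > 0" "\<And>x. \<bar>f x\<bar> \<le> M" "\<And>x. norm (F x) \<le> M"
    using C1_gradient_bounded[OF f R] by blast
  have [measurable]: "f \<in> borel_measurable borel" "F \<in> borel_measurable borel"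
    by (intro borel_measurable_continuous_onI C1_gradientD[OF f])+
  define R' where "R' = R + norm \<nu>"
  have f0: "f (x + s *\<^sub>R \<nu>) = 0" if "norm x > R'" "\<bar>s\<bar> \<le> 1" for x s
  proof (rule R)
    have "norm (s *\<^sub>R \<nu>) \<le> norm \<nu>" using that(2) by (simp add: mult_left_le_one_le)
    then show "R < norm (x + s *\<^sub>R \<nu>)" using that(1) norm_triangle_ineq4[of "x + s *\<^sub>R \<nu>" "s *\<^sub>R \<nu>"] by (simp add: R'_def)
  qed
  define q where "q n x = (f (x + t n *\<^sub>R \<nu>) - f x) / t n * indicator \<Omega> x" for n x
  have qmeas [measurable]: "q n \<in> borel_measurable borel" for n unfolding q_def by simp
  have quot: "((LINT x|lborel. f x * indicator \<Omega> (x - t n *\<^sub>R \<nu>)) - (LINT x|lborel. f x * indicator \<Omega> x)) / t n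
      = (LINT x|lborel. q n x)" for n
  proof -
    have "(LINT x|lborel. f x * indicator \<Omega> (x - t n *\<^sub>R \<nu>)) = (LINT x|lborel. f (x + t n *\<^sub>R \<nu>) * indicator \<Omega> x)"
      using integral_lborel_translate[of "\<lambda>x. f x * indicator \<Omega> (x - t n *\<^sub>R \<nu>)" "t n *\<^sub>R \<nu>"] by simp
    moreover have "integrable lborel (\<lambda>x. f (x + t n *\<^sub>R \<nu>) * indicator \<Omega> x)"
      by (rule integrable_lborel_bounded_support[where M=M and R=R'])
         (use M(1,2) f0[OF _ t(3)] in \<open>auto simp: indicator_def less_imp_le\<close>)
    moreover have "integrable lborel (\<lambda>x. f x * indicator \<Omega> x)"
      by (rule integrable_lborel_bounded_support[where M=M and R=R])
         (use M(1,2) R in \<open>auto simp: indicator_def less_imp_le\<close>)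
    ultimately show ?thesis
      unfolding q_def
      by (simp add: left_diff_distrib Bochner_Integration.integral_diff)
  qed
  have "(\<lambda>n. LINT x|lborel. q n x) \<longlonglongrightarrow> (LINT x|lborel. (F x \<bullet> \<nu>) * indicator \<Omega> x)"
  proof (rule integral_dominated_convergence)
    show "integrable lborel (\<lambda>x::'a. M * norm \<nu> * indicator (cball 0 R') x)"
      by (rule integrable_lborel_bounded_support[where M="M * norm \<nu>" and R=R'])
        (use M(1) in \<open>auto simp: indicator_def\<close>)
    show "AE x in lborel. (\<lambda>n. q n x) \<longlonglongrightarrow> (F x \<bullet> \<nu>) * indicator \<Omega> x"
    proof (rule AE_I2)
      fix x
      have "((\<lambda>s. f (x + s *\<^sub>R \<nu>)) has_real_derivative (F x \<bullet> \<nu>)) (at 0)"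
        unfolding has_field_derivative_def
        by (rule has_derivative_eq_rhs, rule has_derivative_compose[OF _ C1_gradientD(1)[OF f]])
           (auto intro!: derivative_eq_intros simp: mult.commute)
      then have "((\<lambda>h. (f (x + h *\<^sub>R \<nu>) - f x) / h) \<longlongrightarrow> F x \<bullet> \<nu>) (at 0)"
        by (simp add: DERIV_def)
      then have "(\<lambda>n. (f (x + t n *\<^sub>R \<nu>) - f x) / t n) \<longlonglongrightarrow> F x \<bullet> \<nu>"
        by (rule filterlim_compose) (use t in \<open>auto simp: filterlim_at\<close>)
      then show "(\<lambda>n. q n x) \<longlonglongrightarrow> (F x \<bullet> \<nu>) * indicator \<Omega> x"
        unfolding q_def by (intro tendsto_intros)
    qed
    show "AE x in lborel. norm (q n x) \<le> M * norm \<nu> * indicator (cball 0 R') x" for n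
    proof (rule AE_I2)
      fix x
      show "norm (q n x) \<le> M * norm \<nu> * indicator (cball 0 R') x"
      proof (cases "norm x \<le> R'")
        case True
        have "\<bar>f (x + t n *\<^sub>R \<nu>) - f x\<bar> \<le> M * norm (x + t n *\<^sub>R \<nu> - x)"
          by (rule C1_gradient_lipschitz[OF f M(3)])
        then have "\<bar>f (x + t n *\<^sub>R \<nu>) - f x\<bar> / \<bar>t n\<bar> \<le> M * norm \<nu>"
          using t(2)[of n] by (simp add: field_simps)
        then show ?thesis using True M(1) by (auto simp: q_def indicator_def abs_mult)
      next
        case False
        then show ?thesis using f0[of x "t n"] f0[of x 0] t(3)[of n] by (simp add: q_def indicator_def)
      qed
    qed
  qed simp_all
  then show ?thesis by (simp add: quot)
qed

section \<open>The divergence theorem in a chart\<close>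

text \<open>Vanishing of \<open>h\<close> below \<open>- R\<close> makes the integral over the half line agree locally with one over
  a compact interval, to which the fundamental theorem of calculus applies.\<close>
lemma antiderivative_cutoff:
  fixes h :: "real \<Rightarrow> real"
  assumes h: "continuous_on UNIV h" and R: "\<And>s. s < - R \<Longrightarrow> h s = 0"
  shows "((\<lambda>r. LINT s|lborel. h s * indicator {..<r} s) has_real_derivative h r) (at r)"
proof -
  define L where "L = - \<bar>R\<bar> - \<bar>r\<bar> - 1"
  have [measurable]: "h \<in> borel_measurable borel" using h by (rule borel_measurable_continuous_onI)
  have eq: "(LINT s|lborel. h s * indicator {..<u} s) = integral {L..u} h" for u
  proof -
    have "(LINT s|lborel. h s * indicator {..<u} s) = (LBINT s:{L..u}. h s)"
      unfolding set_lebesgue_integral_def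
    proof (rule integral_cong_AE)
      show "AE s in lborel. h s * indicator {..<u} s = indicator {L..u} s *\<^sub>R h s"
        using AE_lborel_singleton[of u]
      proof eventually_elim
        case (elim s)
        have "s < L \<Longrightarrow> h s = 0" by (rule R) (auto simp: L_def)
        then show ?case using elim by (auto simp: indicator_def not_le)
      qed
    qed simp_all
    also have "\<dots> = integral {L..u} h"
      by (intro set_borel_integral_eq_integral borel_integrable_compact[unfolded set_integrable_def[symmetric]])
         (use h in \<open>auto simp: set_integrable_def intro!: borel_integrable_compact continuous_on_subset[OF h]\<close>)
    finally show ?thesis .
  qed
  have "((\<lambda>u. integral {L..u} h) has_real_derivative h r) (at r within {L..r+1})"
    by (rule integral_has_real_derivative) (auto simp: L_def intro: continuous_on_subset[OF h])
  then have "((\<lambda>u. integral {L..u} h) has_real_derivative h r) (at r within {L<..<r+1})"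
    by (rule DERIV_subset) auto
  then have "((\<lambda>u. integral {L..u} h) has_real_derivative h r) (at r)"
    by (subst (asm) at_within_open) (auto simp: L_def)
  then show ?thesis by (simp add: eq)
qed

lemma antiderivative_cutoff_lipschitz:
  fixes h :: "real \<Rightarrow> real"
  assumes h: "continuous_on UNIV h" and R: "\<And>s. s < - R \<Longrightarrow> h s = 0" and M: "\<And>s. \<bar>h s\<bar> \<le> M"
  shows "\<bar>(LINT s|lborel. h s * indicator {..<r} s) - (LINT s|lborel. h s * indicator {..<u} s)\<bar> \<le> M * \<bar>r - u\<bar>"
proof -
  have "norm ((LINT s|lborel. h s * indicator {..<r} s) - (LINT s|lborel. h s * indicator {..<u} s)) \<le> M * norm (r - u)"
    by (rule field_differentiable_bound[OF convex_UNIV antiderivative_cutoff[OF h R]]) (use M in auto)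
  then show ?thesis by simp
qed

text \<open>A compact convex exhaustion of the base of a chart: there the gradient of the graph function is bounded,
  and base points over a compact part of the chart domain lie in such a set.\<close>
definition shrunk_base :: "'a::euclidean_space \<Rightarrow> 'a \<Rightarrow> real \<Rightarrow> 'a set" where
  "shrunk_base e a r = {y. y \<bullet> e = 0 \<and> (\<forall>b\<in>Basis - {e}. \<bar>y \<bullet> b\<bar> \<le> a \<bullet> b - r)}"

lemma shrunk_base_eq:
  "shrunk_base e a r = {y. y \<bullet> e = 0} \<inter> (\<Inter>b\<in>Basis - {e}. {y. y \<bullet> b \<le> a \<bullet> b - r} \<inter> {y. - (y \<bullet> b) \<le> a \<bullet> b - r})"
  by (auto simp: shrunk_base_def abs_le_iff)

lemma shrunk_base_subset: "r > 0 \<Longrightarrow> shrunk_base e a r \<subseteq> coord_base e a"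
  by (force simp: shrunk_base_def coord_base_def)

lemma closed_shrunk_base: "closed (shrunk_base e a r)"
  unfolding shrunk_base_eq
  by (intro closed_Int closed_INT ballI closed_Collect_eq closed_Collect_le continuous_intros)

lemma convex_shrunk_base: "convex (shrunk_base e a r)"
proof -
  have 1: "{y. y \<bullet> e = 0} = {y. e \<bullet> y = 0}" "\<And>b. {y. y \<bullet> b \<le> a \<bullet> b - r} = {y. b \<bullet> y \<le> a \<bullet> b - r}"
     "\<And>b. {y. - (y \<bullet> b) \<le> a \<bullet> b - r} = {y. (- b) \<bullet> y \<le> a \<bullet> b - r}"
    by (simp_all add: inner_commute)
  show ?thesis unfolding shrunk_base_eq unfolding 1
    by (intro convex_Int convex_INT convex_hyperplane convex_halfspace_le)
qed

lemma compact_shrunk_base: 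
  fixes e :: "'a::euclidean_space"
  assumes "e \<in> Basis"
  shows "compact (shrunk_base e a r)"
proof -
  have "bounded (shrunk_base e a r)"
    unfolding bounded_iff
  proof (intro exI ballI)
    fix y assume y: "y \<in> shrunk_base e a r"
    have "norm y \<le> (\<Sum>b\<in>Basis. \<bar>y \<bullet> b\<bar>)" by (rule norm_le_l1)
    also have "\<dots> \<le> (\<Sum>b\<in>Basis. \<bar>a \<bullet> b - r\<bar>)"
      using y by (intro sum_mono) (force simp: shrunk_base_def)
    finally show "norm y \<le> (\<Sum>b\<in>Basis. \<bar>a \<bullet> b - r\<bar>)" .
  qed
  with closed_shrunk_base show ?thesis by (simp add: compact_eq_bounded_closed)
qed

lemma borel_coord_base [measurable]: 
  fixes e :: "'a::euclidean_space"
  shows "coord_base e a \<in> sets borel"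
proof -
  have "coord_base e a = {y. y \<bullet> e = 0} \<inter> (\<Inter>b\<in>Basis - {e}. {y. \<bar>y \<bullet> b\<bar> < a \<bullet> b})"
    by (auto simp: coord_base_def)
  moreover have "closed {y. y \<bullet> e = 0}" by (intro closed_Collect_eq continuous_intros)
  moreover have "open (\<Inter>b\<in>Basis - {e}. {y. \<bar>y \<bullet> b\<bar> < a \<bullet> b})"
    by (intro open_INT ballI open_Collect_less continuous_intros) auto
  ultimately show ?thesis by auto
qed

lemma open_coord_box: "open (coord_box a)"
proof -
  have "coord_box a = (\<Inter>b\<in>Basis. {y. \<bar>y \<bullet> b\<bar> < a \<bullet> b})"
    by (auto simp: coord_box_def)
  then show ?thesis by (auto intro!: open_INT ballI open_Collect_less continuous_intros)
qed

lemma orthogonal_chart_map: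
  fixes Q :: "'a::euclidean_space \<Rightarrow> 'a"
  assumes Q: "orthogonal_transformation Q"
  shows "Q (inv Q x) = x" "inv Q (Q x) = x" "linear Q" "linear (inv Q)" "norm (Q x) = norm x" "norm (inv Q x) = norm x"
    "Q x \<bullet> Q y = x \<bullet> y" "continuous_on S Q" "continuous_on S (inv Q)"
proof -
  have Q': "orthogonal_transformation (inv Q)" using Q by (rule orthogonal_transformation_inv)
  show "Q (inv Q x) = x" "inv Q (Q x) = x"
    using orthogonal_transformation_bij[OF Q] by (simp_all add: bij_is_surj surj_f_inv_f bij_is_inj)
  show "linear Q" "linear (inv Q)" using Q Q' by (simp_all add: orthogonal_transformation_def)
  then show "continuous_on S Q" "continuous_on S (inv Q)" by (simp_all add: linear_continuous_on linear_linear)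
  show "norm (Q x) = norm x" "norm (inv Q x) = norm x" using Q Q' by (simp_all add: orthogonal_transformation_norm)
  show "Q x \<bullet> Q y = x \<bullet> y" using Q by (simp add: orthogonal_transformation_def)
qed

lemma chart_domain_iff:
  assumes Q: "orthogonal_transformation Q"
  shows "x \<in> chart_domain Q c a \<longleftrightarrow> inv Q (x - c) \<in> coord_box a"
  unfolding chart_domain_def image_iff using orthogonal_chart_map(1,2)[OF Q]
  by (metis add_diff_cancel_right' diff_add_cancel)

lemma open_chart_domain:
  assumes Q: "orthogonal_transformation Q"
  shows "open (chart_domain Q c a)"
proof -
  have "chart_domain Q c a = (\<lambda>x. inv Q (x - c)) -` coord_box a"
    using chart_domain_iff[OF Q] by auto
  moreover have "continuous_on UNIV (\<lambda>x. inv Q (x - c))"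
    by (intro continuous_on_compose2[OF orthogonal_chart_map(9)[OF Q, of UNIV]] continuous_intros) auto
  ultimately show ?thesis using open_vimage[OF open_coord_box] by metis
qed

lemma C1_chartD:
  assumes "C1_chart \<Omega> Q c e a \<phi> g"
  shows "orthogonal_transformation Q" "e \<in> Basis"
    "\<And>y. y \<in> coord_base e a \<Longrightarrow> (\<phi> has_derivative (\<lambda>h. g y \<bullet> h)) (at y within {z. z \<bullet> e = 0})"
    "\<And>y. y \<in> coord_base e a \<Longrightarrow> g y \<bullet> e = 0"
    "continuous_on (coord_base e a) g" "continuous_on (coord_base e a) \<phi>"
    "\<And>y. y \<in> coord_box a \<Longrightarrow> Q y + c \<in> \<Omega> \<longleftrightarrow> y \<bullet> e < \<phi> (y - (y \<bullet> e) *\<^sub>R e)"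
proof -
  show d: "\<And>y. y \<in> coord_base e a \<Longrightarrow> (\<phi> has_derivative (\<lambda>h. g y \<bullet> h)) (at y within {z. z \<bullet> e = 0})"
    using assms by (simp add: C1_chart_def)
  have "coord_base e a \<subseteq> {z. z \<bullet> e = 0}" by (auto simp: coord_base_def)
  with d show "continuous_on (coord_base e a) \<phi>"
    by (auto intro!: has_derivative_continuous_on intro: has_derivative_subset)
qed (use assms in \<open>auto simp: C1_chart_def\<close>)

text \<open>A compact part of the chart domain keeps a distance from its boundary; moving by half of it in a
  coordinate direction stays in the box.\<close>
lemma compact_in_chart_margin:
  fixes K :: "'a::euclidean_space set"
  assumes Q: "orthogonal_transformation Q" and K: "compact K" "K \<subseteq> chart_domain Q c a"
  obtains \<eta> where "\<eta> > 0" "\<And>y b. Q y + c \<in> K \<Longrightarrow> b \<in> Basis \<Longrightarrow> \<bar>y \<bullet> b\<bar> + \<eta> \<le> a \<bullet> b"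
proof -
  obtain \<epsilon> where \<epsilon>: "\<epsilon> > 0" "(\<Union>x\<in>K. ball x \<epsilon>) \<subseteq> chart_domain Q c a"
    using compact_subset_open_imp_ball_epsilon_subset[OF K(1) open_chart_domain[OF Q] K(2)] .
  show ?thesis
  proof (rule that[of "\<epsilon> / 2"])
    show "\<epsilon> / 2 > 0" using \<epsilon> by simp
    fix y b :: 'a assume y: "Q y + c \<in> K" and b: "b \<in> Basis"
    have *: "\<bar>(y + s *\<^sub>R b) \<bullet> b\<bar> < a \<bullet> b" if "\<bar>s\<bar> \<le> \<epsilon> / 2" for s
    proof -
      have "dist (Q y + c) (Q (y + s *\<^sub>R b) + c) = \<bar>s\<bar>"
        using b by (simp add: dist_norm orthogonal_chart_map[OF Q] flip: linear_diff[OF orthogonal_chart_map(3)[OF Q]])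
      then have "Q (y + s *\<^sub>R b) + c \<in> ball (Q y + c) \<epsilon>" using that \<epsilon>(1) by simp
      then have "Q (y + s *\<^sub>R b) + c \<in> chart_domain Q c a" using \<epsilon>(2) y by blast
      then have "y + s *\<^sub>R b \<in> coord_box a" by (simp add: chart_domain_iff[OF Q] orthogonal_chart_map[OF Q])
      then show ?thesis using b by (simp add: coord_box_def)
    qed
    show "\<bar>y \<bullet> b\<bar> + \<epsilon> / 2 \<le> a \<bullet> b"
      using *[of "\<epsilon> / 2"] *[of "- (\<epsilon> / 2)"] \<epsilon>(1) b by (simp add: inner_add_left inner_diff_left abs_if split: if_splits)
  qed
qed

lemma shrunk_base_gradient_bounded:
  assumes chart: "C1_chart \<Omega> Q c e a \<phi> g" and r: "r > 0"
  obtains L where "L > 0" "\<And>y. y \<in> shrunk_base e a r \<Longrightarrow> norm (g y) \<le> L"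
proof -
  have "compact (g ` shrunk_base e a r)"
    by (intro compact_continuous_image compact_shrunk_base C1_chartD(2)[OF chart]
        continuous_on_subset[OF C1_chartD(5)[OF chart]] shrunk_base_subset r)
  then have "bounded (g ` shrunk_base e a r)" by (rule compact_imp_bounded)
  then obtain L where "L > 0" "\<And>y. y \<in> shrunk_base e a r \<Longrightarrow> norm (g y) \<le> L" by (auto simp: bounded_pos)
  then show ?thesis by (rule that)
qed

lemma integrable_shrunk_base:
  fixes f :: "'a::euclidean_space \<Rightarrow> real"
  assumes e: "e \<in> Basis" and f: "continuous_on (coord_base e a) f" and r: "r > 0"
    and M: "\<And>y. y \<in> shrunk_base e a r \<Longrightarrow> \<bar>f y\<bar> \<le> M"
    and f0: "\<And>y. y \<in> coord_base e a \<Longrightarrow> y \<notin> shrunk_base e a r \<Longrightarrow> f y = 0"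
  shows "integrable (hyperplane_lborel e) (\<lambda>y. indicator (coord_base e a) y * f y)"
proof (rule Bochner_Integration.integrable_bound)
  show "integrable (hyperplane_lborel e) (\<lambda>y. M * indicator (shrunk_base e a r) y)"
    using hyperplane_lborel_bounded_finite[OF e, of "shrunk_base e a r"] compact_shrunk_base[OF e, of a r]
    by (intro integrable_mult_right integrable_real_indicator)
       (auto simp: closed_shrunk_base compact_imp_bounded)
  show "(\<lambda>y. indicator (coord_base e a) y * f y) \<in> borel_measurable (hyperplane_lborel e)"
    using borel_measurable_continuous_on_indicator[OF borel_coord_base f]
    by (simp cong: measurable_cong_sets)
  show "AE x in hyperplane_lborel e. norm (indicator (coord_base e a) x * f x) \<le> norm (M * indicator (shrunk_base e a r) x)"
  proof (rule AE_I2)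
    fix y show "norm (indicator (coord_base e a) y * f y) \<le> norm (M * indicator (shrunk_base e a r) y)"
      using M[of y] f0[of y] shrunk_base_subset[OF r, of e a] by (auto simp: indicator_def)
  qed
qed

lemma chart_point_in_K:
  assumes chart: "C1_chart \<Omega> Q c e a \<phi> g"
    and \<eta>: "\<And>y b. Q y + c \<in> K \<Longrightarrow> b \<in> Basis \<Longrightarrow> \<bar>y \<bullet> b\<bar> + \<eta> \<le> a \<bullet> b"
    and y: "y \<bullet> e = 0" "Q (y + s *\<^sub>R e) + c \<in> K"
  shows "y \<in> shrunk_base e a \<eta>" "\<bar>s\<bar> + \<eta> \<le> a \<bullet> e"
proof -
  note e = C1_chartD(2)[OF chart]
  show "\<bar>s\<bar> + \<eta> \<le> a \<bullet> e" using \<eta>[OF y(2) e] y(1) e by (simp add: inner_add_left)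
  have "(y + s *\<^sub>R e) \<bullet> b = y \<bullet> b" if "b \<in> Basis - {e}" for b
    using that e by (auto simp: inner_add_left inner_Basis)
  then show "y \<in> shrunk_base e a \<eta>" using \<eta>[OF y(2)] y(1) by (force simp: shrunk_base_def)
qed

text \<open>Both sides are limits of the difference quotients at \<open>t = 0\<close> of the integral of \<open>f\<close> over \<open>\<Omega> + t \<nu>\<close>. The
  left-hand side is \<open>translation_difference_quotient\<close>. For the other one pass to chart coordinates,
  \<open>\<nu> = Q \<mu>\<close>, and split \<open>\<mu> = \<mu>' + (\<mu> \<bullet> e) e\<close>. On the support of \<open>f\<close> the translated domain lies below the graph of
  \<open>\<phi> (y - t \<mu>') + t (\<mu> \<bullet> e)\<close>, so integrating in direction \<open>e\<close> first leaves an antiderivative evaluated at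
  this height. Its derivative in \<open>t\<close> is \<open>f\<close> on the graph times \<open>\<mu> \<bullet> (e - g y)\<close>.\<close>
lemma chart_divergence:
  fixes \<Omega> :: "'a::euclidean_space set"
  assumes chart: "C1_chart \<Omega> Q c e a \<phi> g" and f: "C1_gradient f F"
    and K: "compact K" "K \<subseteq> chart_domain Q c a" "\<And>x. x \<notin> K \<Longrightarrow> f x = 0" and \<Omega>: "open \<Omega>"
  shows "(LINT x|lborel. (F x \<bullet> \<nu>) * indicator \<Omega> x) =
     (LINT y|hyperplane_lborel e. indicator (coord_base e a) y * (f (Q (y + \<phi> y *\<^sub>R e) + c) * (\<nu> \<bullet> Q (e - g y))))"
proof -
  note Q = C1_chartD(1)[OF chart] and e = C1_chartD(2)[OF chart]
  note Qm = orthogonal_chart_map[OF Q]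
  obtain \<eta> where \<eta>: "\<eta> > 0" "\<And>y b. Q y + c \<in> K \<Longrightarrow> b \<in> Basis \<Longrightarrow> \<bar>y \<bullet> b\<bar> + \<eta> \<le> a \<bullet> b"
    using compact_in_chart_margin[OF Q K(1,2)] by metis
  obtain R where R: "\<And>x. norm x > R \<Longrightarrow> f x = 0"
    using compact_imp_bounded[OF K(1)] K(3) by (metis bounded_iff not_le)
  obtain M where M: "M > 0" "\<And>x. \<bar>f x\<bar> \<le> M" "\<And>x. norm (F x) \<le> M"
    using C1_gradient_bounded[OF f R] by blast
  obtain L where L: "L > 0" "\<And>y. y \<in> shrunk_base e a (\<eta>/2) \<Longrightarrow> norm (g y) \<le> L"
    using shrunk_base_gradient_bounded[OF chart, of "\<eta>/2"] \<eta>(1) by auto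
  define B where "B = shrunk_base e a \<eta>"
  have B_base: "B \<subseteq> coord_base e a" unfolding B_def by (rule shrunk_base_subset[OF \<eta>(1)])
  have [measurable]: "\<Omega> \<in> sets borel" using \<Omega> by simp
  have [measurable]: "f \<in> borel_measurable borel" "F \<in> borel_measurable borel" "Q \<in> borel_measurable borel"
    by (intro borel_measurable_continuous_onI C1_gradientD[OF f] Qm)+
  have [measurable]: "B \<in> sets borel" by (simp add: B_def closed_shrunk_base)
  define h where "h y = f (Q y + c)" for y
  have h_cont: "continuous_on S h" for S
    unfolding h_def
    by (intro continuous_on_compose2[OF C1_gradientD(3)[OF f, of UNIV]] continuous_intros Qm(8)) auto
  have [measurable]: "h \<in> borel_measurable borel" by (rule borel_measurable_continuous_onI[OF h_cont])
  have hM: "\<bar>h y\<bar> \<le> M" for y using M(2) by (simp add: h_def)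
  have h0: "h y = 0" if "Q y + c \<notin> K" for y using K(3)[OF that] by (simp add: h_def)
  define \<mu> where "\<mu> = inv Q \<nu>"
  define \<mu>' where "\<mu>' = \<mu> - (\<mu> \<bullet> e) *\<^sub>R e"
  have \<mu>'e: "\<mu>' \<bullet> e = 0" using e by (simp add: \<mu>'_def inner_diff_left)
  have \<mu>'b: "\<mu>' \<bullet> b = \<mu> \<bullet> b" if "b \<in> Basis - {e}" for b
    using that e by (auto simp: \<mu>'_def inner_diff_left inner_Basis)
  have Q\<mu>: "Q \<mu> = \<nu>" by (simp add: \<mu>_def Qm)
  \<comment> \<open>translations by \<open>s \<mu>\<close> with \<open>|s| \<le> \<tau>\<close> use up at most half of the margin \<open>\<eta>\<close> in each coordinate\<close>
  define \<tau> where "\<tau> = min 1 (\<eta> / (2 * (norm \<mu> + 1)))"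
  have \<tau>: "0 < \<tau>" "\<tau> \<le> 1" using \<eta>(1) by (auto simp: \<tau>_def intro!: divide_pos_pos add_nonneg_pos)
  have small: "\<bar>s\<bar> * \<bar>\<mu> \<bullet> b\<bar> \<le> \<eta> / 2" if "\<bar>s\<bar> \<le> \<tau>" "b \<in> Basis" for s b
  proof -
    have "\<bar>s\<bar> * \<bar>\<mu> \<bullet> b\<bar> \<le> \<tau> * (norm \<mu> + 1)"
      using that \<tau> Basis_le_norm[OF that(2), of \<mu>] by (intro mult_mono) auto
    also have "\<dots> \<le> (\<eta> / (2 * (norm \<mu> + 1))) * (norm \<mu> + 1)"
      by (intro mult_right_mono) (auto simp: \<tau>_def)
    also have "\<dots> = \<eta> / 2" by (simp add: field_simps add_nonneg_eq_0_iff)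
    finally show ?thesis .
  qed
  have shift_B: "y - s *\<^sub>R \<mu>' \<in> shrunk_base e a (\<eta>/2)" if "y \<in> B" "\<bar>s\<bar> \<le> \<tau>" for y s
  proof -
    have "\<bar>(y - s *\<^sub>R \<mu>') \<bullet> b\<bar> \<le> a \<bullet> b - \<eta>/2" if b: "b \<in> Basis - {e}" for b
    proof -
      have "\<bar>(y - s *\<^sub>R \<mu>') \<bullet> b\<bar> \<le> \<bar>y \<bullet> b\<bar> + \<bar>s\<bar> * \<bar>\<mu> \<bullet> b\<bar>"
        using \<mu>'b[OF b] by (simp add: inner_diff_left abs_mult[symmetric] abs_triangle_ineq4)
      also have "\<dots> \<le> a \<bullet> b - \<eta> + \<eta> / 2"
        using \<open>y \<in> B\<close> small[OF \<open>\<bar>s\<bar> \<le> \<tau>\<close>, of b] b by (intro add_mono) (auto simp: B_def shrunk_base_def)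
      finally show ?thesis by simp
    qed
    then show ?thesis using that(1) \<mu>'e by (simp add: shrunk_base_def B_def inner_diff_left)
  qed
  have \<phi>_lip: "\<bar>\<phi> (y - s *\<^sub>R \<mu>') - \<phi> y\<bar> \<le> L * norm \<mu>' * \<bar>s\<bar>" if y: "y \<in> B" and s: "\<bar>s\<bar> \<le> \<tau>" for y s
  proof -
    have "norm (\<phi> (y - s *\<^sub>R \<mu>') - \<phi> y) \<le> L * norm ((y - s *\<^sub>R \<mu>') - y)"
    proof (rule differentiable_bound[OF convex_shrunk_base[of e a "\<eta>/2"]])
      fix z assume z: "z \<in> shrunk_base e a (\<eta>/2)"
      then have "z \<in> coord_base e a" using shrunk_base_subset[of "\<eta>/2" e a] \<eta>(1) by auto
      then show "(\<phi> has_derivative (\<lambda>h. g z \<bullet> h)) (at z within shrunk_base e a (\<eta>/2))"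
        by (rule has_derivative_subset[OF C1_chartD(3)[OF chart]]) (auto simp: shrunk_base_def)
      show "onorm ((\<bullet>) (g z)) \<le> L"
      proof (rule onorm_bound)
        show "norm (g z \<bullet> h) \<le> L * norm h" for h
          using Cauchy_Schwarz_ineq2[of "g z" h] mult_right_mono[OF L(2)[OF z] norm_ge_zero[of h]] by simp
      qed (use L(1) in simp)
    next
      show "y - s *\<^sub>R \<mu>' \<in> shrunk_base e a (\<eta>/2)" by (rule shift_B[OF y s])
      show "y \<in> shrunk_base e a (\<eta>/2)" using shift_B[OF y, of 0] \<tau> by simp
    qed
    then show ?thesis by (simp add: mult_ac)
  qed
  define \<psi> where "\<psi> y s = \<phi> (y - s *\<^sub>R \<mu>') + s * (\<mu> \<bullet> e)" for y s
  define A where "A y r = (LINT s|lborel. h (y + s *\<^sub>R e) * indicator {..<r} s)" for y r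
  have line0: "h (y + s *\<^sub>R e) = 0" if "y \<bullet> e = 0" "y \<notin> B \<or> \<bar>s\<bar> > a \<bullet> e" for y s
    using chart_point_in_K[OF chart \<eta>(2) that(1), where s=s] that \<eta>(1) by (intro h0) (auto simp: B_def)
  \<comment> \<open>the integral over the line through \<open>y\<close> in direction \<open>e\<close>, restricted to the translated domain\<close>
  define J where "J s y = (LINT r|lborel. h (y + r *\<^sub>R e) * indicator \<Omega> (Q (y + r *\<^sub>R e - s *\<^sub>R \<mu>) + c))" for s y
  have J_eq: "J s y = A y (\<psi> y s)" if y: "y \<bullet> e = 0" and s: "\<bar>s\<bar> \<le> \<tau>" for y s
    unfolding J_def A_def
  proof (intro Bochner_Integration.integral_cong refl)
    fix r
    show "h (y + r *\<^sub>R e) * indicator \<Omega> (Q (y + r *\<^sub>R e - s *\<^sub>R \<mu>) + c) = h (y + r *\<^sub>R e) * indicator {..<\<psi> y s} r"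
    proof (cases "Q (y + r *\<^sub>R e) + c \<in> K")
      case True
      let ?z = "y + r *\<^sub>R e - s *\<^sub>R \<mu>"
      have "?z \<in> coord_box a" unfolding coord_box_def
      proof safe
        fix b :: 'a assume b: "b \<in> Basis"
        have "\<bar>?z \<bullet> b\<bar> \<le> \<bar>(y + r *\<^sub>R e) \<bullet> b\<bar> + \<bar>s\<bar> * \<bar>\<mu> \<bullet> b\<bar>"
          by (simp add: inner_diff_left abs_mult[symmetric] abs_triangle_ineq4)
        also have "\<dots> < a \<bullet> b" using \<eta>(2)[OF True b] small[OF s b] \<eta>(1) by simp
        finally show "\<bar>?z \<bullet> b\<bar> < a \<bullet> b" .
      qed
      from C1_chartD(7)[OF chart this]
      have "Q ?z + c \<in> \<Omega> \<longleftrightarrow> ?z \<bullet> e < \<phi> (?z - (?z \<bullet> e) *\<^sub>R e)" .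
      moreover have "?z \<bullet> e = r - s * (\<mu> \<bullet> e)" using y e by (simp add: inner_diff_left inner_add_left)
      moreover have "?z - (r - s * (\<mu> \<bullet> e)) *\<^sub>R e = y - s *\<^sub>R \<mu>'"
        by (simp add: \<mu>'_def algebra_simps)
      ultimately have "Q ?z + c \<in> \<Omega> \<longleftrightarrow> r < \<psi> y s" by (auto simp: \<psi>_def)
      then show ?thesis by (simp add: indicator_def)
    qed (simp add: h0)
  qed
  have A_deriv: "(A y has_real_derivative h (y + r *\<^sub>R e)) (at r)" if "y \<bullet> e = 0" for y r
    unfolding A_def
    by (rule antiderivative_cutoff[where R="a \<bullet> e"])
       (auto intro!: continuous_on_compose2[OF h_cont[of UNIV]] continuous_intros line0[OF that])
  have A_lip: "\<bar>A y r - A y u\<bar> \<le> M * \<bar>r - u\<bar>" if "y \<bullet> e = 0" for y r u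
    unfolding A_def
    by (rule antiderivative_cutoff_lipschitz[where R="a \<bullet> e"])
       (auto intro!: continuous_on_compose2[OF h_cont[of UNIV]] continuous_intros line0[OF that] hM)
  define t where "t n = \<tau> * inverse (real (Suc n))" for n
  have t_le: "\<bar>t n\<bar> \<le> \<tau>" and t_ne: "t n \<noteq> 0" for n
    using \<tau> by (auto simp: t_def field_simps)
  have t_lim: "t \<longlonglongrightarrow> 0" unfolding t_def
    using tendsto_mult[OF tendsto_const[of \<tau>] LIMSEQ_inverse_real_of_nat] by simp
  define q where "q n y = (J (t n) y - J 0 y) / t n" for n y
  define G where "G y = f (Q (y + \<phi> y *\<^sub>R e) + c) * (\<nu> \<bullet> Q (e - g y))" for y
  have G_cont: "continuous_on (coord_base e a) G"
    unfolding G_def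
    by (intro continuous_intros continuous_on_compose2[OF C1_gradientD(3)[OF f, of UNIV]]
        continuous_on_compose2[OF Qm(8)[of UNIV]] C1_chartD(5,6)[OF chart]) auto
  have q_lim: "(\<lambda>n. q n y) \<longlonglongrightarrow> indicator (coord_base e a) y * G y" if y: "y \<bullet> e = 0" for y
  proof (cases "y \<in> B")
    case False
    then have "h (y + r *\<^sub>R e) = 0" for r using line0[OF y] by simp
    then have "q n y = 0" "G y = 0" for n by (simp_all add: q_def J_def G_def flip: h_def)
    then show ?thesis by simp
  next
    case True
    then have yb: "y \<in> coord_base e a" using B_base by auto
    have "((\<lambda>s. \<phi> (y - s *\<^sub>R \<mu>')) has_derivative (\<lambda>s. g y \<bullet> (- s *\<^sub>R \<mu>'))) (at 0)"
    proof (rule has_derivative_in_compose[where f="\<lambda>s. y - s *\<^sub>R \<mu>'" and g=\<phi>])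
      show "((\<lambda>s. y - s *\<^sub>R \<mu>') has_derivative (\<lambda>s. - s *\<^sub>R \<mu>')) (at 0)"
        by (auto intro!: derivative_eq_intros)
      show "(\<phi> has_derivative (\<lambda>h. g y \<bullet> h)) (at (y - 0 *\<^sub>R \<mu>') within range (\<lambda>s. y - s *\<^sub>R \<mu>'))"
      proof -
        have "range (\<lambda>s. y - s *\<^sub>R \<mu>') \<subseteq> {z. z \<bullet> e = 0}"
          using y \<mu>'e by (auto simp: inner_diff_left)
        from has_derivative_subset[OF C1_chartD(3)[OF chart yb] this] show ?thesis by simp
      qed
    qed
    then have "((\<lambda>s. \<phi> (y - s *\<^sub>R \<mu>')) has_real_derivative - (g y \<bullet> \<mu>')) (at 0)"
      unfolding has_field_derivative_def by (rule has_derivative_eq_rhs) (auto simp: fun_eq_iff)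
    then have "(\<psi> y has_real_derivative - (g y \<bullet> \<mu>') + \<mu> \<bullet> e) (at 0)"
      unfolding \<psi>_def by (auto intro!: derivative_eq_intros)
    then have "((\<lambda>s. A y (\<psi> y s)) has_real_derivative h (y + \<psi> y 0 *\<^sub>R e) * (- (g y \<bullet> \<mu>') + \<mu> \<bullet> e)) (at 0)"
      by (rule DERIV_chain2[OF A_deriv[OF y]])
    moreover have "h (y + \<psi> y 0 *\<^sub>R e) * (- (g y \<bullet> \<mu>') + \<mu> \<bullet> e) = G y"
    proof -
      have "g y \<bullet> \<mu>' = g y \<bullet> \<mu>" using C1_chartD(4)[OF chart yb] by (simp add: \<mu>'_def inner_diff_right)
      moreover have "\<nu> \<bullet> Q (e - g y) = \<mu> \<bullet> (e - g y)" by (simp add: Qm flip: Q\<mu>)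
      ultimately show ?thesis by (simp add: G_def \<psi>_def h_def inner_diff_right inner_commute)
    qed
    ultimately have "((\<lambda>s. (A y (\<psi> y s) - A y (\<psi> y 0)) / s) \<longlongrightarrow> G y) (at 0)"
      by (simp add: DERIV_def)
    then have "(\<lambda>n. (A y (\<psi> y (t n)) - A y (\<psi> y 0)) / t n) \<longlonglongrightarrow> G y"
      by (rule filterlim_compose) (use t_lim t_ne in \<open>auto simp: filterlim_at\<close>)
    then show ?thesis using yb J_eq[OF y t_le] J_eq[OF y, of 0] \<tau> by (simp add: q_def)
  qed
  have q_bound: "norm (q n y) \<le> M * (L * norm \<mu>' + \<bar>\<mu> \<bullet> e\<bar>) * indicator B y" if y: "y \<bullet> e = 0" for n y
  proof (cases "y \<in> B")
    case False
    then have "h (y + r *\<^sub>R e) = 0" for r using line0[OF y] by simp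
    then have "q n y = 0" for n by (simp add: q_def J_def)
    then show ?thesis using False by simp
  next
    case True
    have "\<bar>J (t n) y - J 0 y\<bar> \<le> M * \<bar>\<psi> y (t n) - \<psi> y 0\<bar>"
      using J_eq[OF y t_le] J_eq[OF y, of 0] \<tau> A_lip[OF y] by simp
    also have "\<dots> \<le> M * (L * norm \<mu>' * \<bar>t n\<bar> + \<bar>\<mu> \<bullet> e\<bar> * \<bar>t n\<bar>)"
    proof (rule mult_left_mono)
      have "\<bar>t n * (\<mu> \<bullet> e)\<bar> = \<bar>\<mu> \<bullet> e\<bar> * \<bar>t n\<bar>" by (simp add: abs_mult)
      then show "\<bar>\<psi> y (t n) - \<psi> y 0\<bar> \<le> L * norm \<mu>' * \<bar>t n\<bar> + \<bar>\<mu> \<bullet> e\<bar> * \<bar>t n\<bar>"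
        using \<phi>_lip[OF True t_le[of n]] unfolding \<psi>_def by simp
    qed (use M in simp)
    finally show ?thesis using True t_ne[of n] by (simp add: q_def field_simps)
  qed
  have J_int: "integrable lborel (\<lambda>r. h (y + r *\<^sub>R e) * indicator \<Omega> (Q (y + r *\<^sub>R e - s *\<^sub>R \<mu>) + c))" if "y \<bullet> e = 0" for y s
    by (rule integrable_lborel_bounded_support[where M=M and R="a \<bullet> e"])
       (use line0[OF that] hM in \<open>auto simp: indicator_def intro: order_trans[OF abs_ge_zero hM]\<close>)
  \<comment> \<open>the difference quotient is taken before Fubini, so that a single integrability statement suffices\<close>
  define D where "D n y = h y * (indicator \<Omega> (Q (y - t n *\<^sub>R \<mu>) + c) - indicator \<Omega> (Q y + c)) / t n" for n y
  have [measurable]: "D n \<in> borel_measurable borel" for n unfolding D_def by measurable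
  have D_inner: "(LINT s|lborel. D n (y + s *\<^sub>R e)) = q n y" if "y \<bullet> e = 0" for n y
    unfolding D_def q_def J_def right_diff_distrib
    by (subst Bochner_Integration.integral_diff[symmetric]) (use J_int[OF that, of "t n"] J_int[OF that, of 0] in simp_all)
  have hR: "h y = 0" if "norm y > R + norm c" for y
    unfolding h_def by (rule R) (use norm_triangle_ineq4[of "Q y + c" c] that Qm(5)[of y] in auto)
  have h_int: "integrable lborel (\<lambda>y. h y * indicator \<Omega> (Q (y - s *\<^sub>R \<mu>) + c))" for s
    by (rule integrable_lborel_bounded_support[where M=M and R="R + norm c"])
       (use hR hM in \<open>auto simp: indicator_def intro: order_trans[OF abs_ge_zero hM]\<close>)
  have chvar: "(LINT x|lborel. f x * indicator \<Omega> (x - s *\<^sub>R \<nu>)) = (LINT y|lborel. h y * indicator \<Omega> (Q (y - s *\<^sub>R \<mu>) + c))" for s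
  proof -
    have "(LINT x|lborel. f x * indicator \<Omega> (x - s *\<^sub>R \<nu>)) = (LINT x|lborel. f (x + c) * indicator \<Omega> (x + c - s *\<^sub>R \<nu>))"
      by (rule integral_lborel_translate[symmetric]) measurable
    also have "\<dots> = (LINT x|distr lborel borel Q. f (x + c) * indicator \<Omega> (x + c - s *\<^sub>R \<nu>))"
      by (simp add: lborel_distr_orthogonal[OF Q])
    also have "\<dots> = (LINT y|lborel. f (Q y + c) * indicator \<Omega> (Q y + c - s *\<^sub>R \<nu>))"
      by (subst integral_distr) simp_all
    also have "(\<lambda>y. Q y + c - s *\<^sub>R \<nu>) = (\<lambda>y. Q (y - s *\<^sub>R \<mu>) + c)"
      by (simp add: fun_eq_iff linear_diff[OF Qm(3)] linear_scale[OF Qm(3)] Q\<mu>)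
    finally show ?thesis unfolding h_def .
  qed
  have quot: "((LINT x|lborel. f x * indicator \<Omega> (x - t n *\<^sub>R \<nu>)) - (LINT x|lborel. f x * indicator \<Omega> x)) / t n
      = (LINT y|hyperplane_lborel e. q n y)" for n
  proof -
    have "((LINT x|lborel. f x * indicator \<Omega> (x - t n *\<^sub>R \<nu>)) - (LINT x|lborel. f x * indicator \<Omega> x)) / t n
       = (LINT y|lborel. D n y)"
      using chvar[of "t n"] chvar[of 0] h_int[of "t n"] h_int[of 0]
      unfolding D_def by (simp add: right_diff_distrib Bochner_Integration.integral_diff)
    also have "\<dots> = (LINT y|hyperplane_lborel e. (LINT s|lborel. D n (y + s *\<^sub>R e)))"
    proof (rule integral_lborel_hyperplane[OF e])
      show "integrable lborel (D n)" unfolding D_def right_diff_distrib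
        using h_int[of "t n"] h_int[of 0] by (intro integrable_divide Bochner_Integration.integrable_diff) simp_all
    qed simp
    also have "\<dots> = (LINT y|hyperplane_lborel e. q n y)"
    proof (rule integral_cong_AE)
      show "AE y in hyperplane_lborel e. (LINT s|lborel. D n (y + s *\<^sub>R e)) = q n y"
        using AE_hyperplane_lborel[OF e] by eventually_elim (rule D_inner)
    qed (simp_all add: q_def J_def)
    finally show ?thesis .
  qed
  have "(\<lambda>n. LINT y|hyperplane_lborel e. q n y) \<longlonglongrightarrow> (LINT y|hyperplane_lborel e. indicator (coord_base e a) y * G y)"
  proof (rule integral_dominated_convergence)
    show "integrable (hyperplane_lborel e) (\<lambda>y. M * (L * norm \<mu>' + \<bar>\<mu> \<bullet> e\<bar>) * indicator B y)"
      using hyperplane_lborel_bounded_finite[OF e, of B] compact_shrunk_base[OF e, of a \<eta>]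
      by (intro integrable_mult_right integrable_real_indicator)
         (auto simp: B_def compact_imp_bounded closed_shrunk_base)
    show "AE y in hyperplane_lborel e. (\<lambda>n. q n y) \<longlonglongrightarrow> indicator (coord_base e a) y * G y"
      using AE_hyperplane_lborel[OF e] by eventually_elim (rule q_lim)
    show "AE y in hyperplane_lborel e. norm (q n y) \<le> M * (L * norm \<mu>' + \<bar>\<mu> \<bullet> e\<bar>) * indicator B y" for n
      using AE_hyperplane_lborel[OF e] by eventually_elim (rule q_bound)
    show "(\<lambda>y. indicator (coord_base e a) y * G y) \<in> borel_measurable (hyperplane_lborel e)"
      using borel_measurable_continuous_on_indicator[OF borel_coord_base G_cont]
      by (simp cong: measurable_cong_sets)
    show "q n \<in> borel_measurable (hyperplane_lborel e)" for n
      unfolding q_def J_def by simp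
  qed
  moreover have "(\<lambda>n. LINT y|hyperplane_lborel e. q n y) \<longlonglongrightarrow> (LINT x|lborel. (F x \<bullet> \<nu>) * indicator \<Omega> x)"
    unfolding quot[symmetric]
    by (rule translation_difference_quotient[OF f R _ t_lim t_ne]) (use t_le \<tau> in \<open>auto intro: order_trans\<close>)
  ultimately show ?thesis unfolding G_def by (rule LIMSEQ_unique[rotated])
qed

section \<open>Surface integrals and flux in a chart\<close>

text \<open>The vector \<open>e - v\<close> is an outer normal of a graph with gradient \<open>v\<close>, and its length is the area element.\<close>
lemma graph_normal_norm:
  fixes e :: "'a::euclidean_space"
  assumes "e \<in> Basis" "v \<bullet> e = 0"
  shows "norm (e - v) = sqrt (1 + (norm v)\<^sup>2)" "norm (e - v) \<ge> 1"
proof -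
  have "(norm (e - v))\<^sup>2 = 1 + (norm v)\<^sup>2"
    using assms by (simp add: power2_norm_eq_inner inner_diff inner_commute)
  then show "norm (e - v) = sqrt (1 + (norm v)\<^sup>2)" by (metis norm_ge_zero real_sqrt_unique)
  then show "norm (e - v) \<ge> 1" by simp
qed

lemma hypersurface_measureD:
  assumes "hypersurface_measure \<Omega> \<sigma>"
  shows "sets \<sigma> = sets borel" "space \<sigma> = UNIV" "AE x in \<sigma>. x \<in> frontier \<Omega>"
    "C1_chart \<Omega> Q c e a \<phi> g \<Longrightarrow> A \<in> sets borel \<Longrightarrow> A \<subseteq> chart_domain Q c a \<Longrightarrow>
       emeasure \<sigma> A = (\<integral>\<^sup>+y\<in>coord_base e a. ennreal (sqrt (1 + (norm (g y))\<^sup>2)) * indicator A (Q (y + \<phi> y *\<^sub>R e) + c) \<partial>hyperplane_lborel e)"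
proof -
  show s: "sets \<sigma> = sets borel" using assms by (simp add: hypersurface_measure_def)
  from sets_eq_imp_space_eq[OF s] show "space \<sigma> = UNIV" by simp
  show "C1_chart \<Omega> Q c e a \<phi> g \<Longrightarrow> A \<in> sets borel \<Longrightarrow> A \<subseteq> chart_domain Q c a \<Longrightarrow>
       emeasure \<sigma> A = (\<integral>\<^sup>+y\<in>coord_base e a. ennreal (sqrt (1 + (norm (g y))\<^sup>2)) * indicator A (Q (y + \<phi> y *\<^sub>R e) + c) \<partial>hyperplane_lborel e)"
    using assms unfolding hypersurface_measure_def by blast
  show "AE x in \<sigma>. x \<in> frontier \<Omega>"
    by (rule AE_I[where N="- frontier \<Omega>"]) (use assms s in \<open>auto simp: hypersurface_measure_def\<close>)
qed

text \<open>On the chart domain \<open>\<sigma>\<close> coincides with the image under the graph map of the hyperplane measure weighted by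
  the area element, because the two agree on all Borel subsets.\<close>
lemma chart_surface_nn_integral:
  fixes \<Omega> :: "'a::euclidean_space set" and f :: "'a \<Rightarrow> ennreal"
  assumes \<sigma>: "hypersurface_measure \<Omega> \<sigma>" and chart: "C1_chart \<Omega> Q c e a \<phi> g"
    and [measurable]: "f \<in> borel_measurable borel" and f0: "\<And>x. x \<notin> chart_domain Q c a \<Longrightarrow> f x = 0"
  shows "(\<integral>\<^sup>+x. f x \<partial>\<sigma>) = (\<integral>\<^sup>+y. ennreal (indicator (coord_base e a) y * sqrt (1 + (norm (g y))\<^sup>2)) * f (Q (y + \<phi> y *\<^sub>R e) + c) \<partial>hyperplane_lborel e)"
proof -
  note Q = C1_chartD(1)[OF chart] and e = C1_chartD(2)[OF chart]
  note Qm = orthogonal_chart_map[OF Q]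
  define U where "U = chart_domain Q c a"
  have [measurable]: "U \<in> sets borel" using open_chart_domain[OF Q] by (simp add: U_def)
  \<comment> \<open>set to \<open>0\<close> off the base, where the graph map need not be measurable\<close>
  define T where "T y = indicator (coord_base e a) y *\<^sub>R (Q (y + \<phi> y *\<^sub>R e) + c)" for y
  define j where "j y = indicator (coord_base e a) y * sqrt (1 + (norm (g y))\<^sup>2)" for y
  have "continuous_on (coord_base e a) (\<lambda>y. Q (y + \<phi> y *\<^sub>R e) + c)"
    by (intro continuous_intros continuous_on_compose2[OF Qm(8)[of UNIV]] C1_chartD(5,6)[OF chart]) auto
  from borel_measurable_continuous_on_indicator[OF borel_coord_base this]
  have T [measurable]: "T \<in> borel_measurable borel" by (simp add: T_def[abs_def])
  have "continuous_on (coord_base e a) (\<lambda>y. sqrt (1 + (norm (g y))\<^sup>2))"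
    by (intro continuous_intros C1_chartD(5)[OF chart])
  from borel_measurable_continuous_on_indicator[OF borel_coord_base this]
  have j [measurable]: "j \<in> borel_measurable borel" by (simp add: j_def[abs_def])
  define \<tau> where "\<tau> = distr (density (hyperplane_lborel e) (\<lambda>y. ennreal (j y))) borel T"
  have sets\<tau> [simp]: "sets \<tau> = sets borel" "space \<tau> = UNIV" by (simp_all add: \<tau>_def)
  note [simp] = hypersurface_measureD(1,2)[OF \<sigma>]
  have eq: "ennreal (j y) * k (T y) = ennreal (j y) * k (Q (y + \<phi> y *\<^sub>R e) + c)" for y and k :: "'a \<Rightarrow> ennreal"
    by (cases "y \<in> coord_base e a") (simp_all add: j_def T_def)
  have nn: "(\<integral>\<^sup>+x. k x \<partial>\<tau>) = (\<integral>\<^sup>+y. ennreal (j y) * k (Q (y + \<phi> y *\<^sub>R e) + c) \<partial>hyperplane_lborel e)"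
    if [measurable]: "k \<in> borel_measurable borel" for k
  proof -
    have "(\<integral>\<^sup>+x. k x \<partial>\<tau>) = (\<integral>\<^sup>+y. ennreal (j y) * k (T y) \<partial>hyperplane_lborel e)"
      unfolding \<tau>_def by (subst nn_integral_distr, simp, simp, subst nn_integral_density) simp_all
    also have "\<dots> = (\<integral>\<^sup>+y. ennreal (j y) * k (Q (y + \<phi> y *\<^sub>R e) + c) \<partial>hyperplane_lborel e)"
      by (intro nn_integral_cong) (rule eq)
    finally show ?thesis .
  qed
  have "restrict_space \<sigma> U = restrict_space \<tau> U"
  proof (rule measure_eqI)
    show "sets (restrict_space \<sigma> U) = sets (restrict_space \<tau> U)" by (simp add: sets_restrict_space)
    fix A assume "A \<in> sets (restrict_space \<sigma> U)"
    then have A [measurable]: "A \<in> sets borel" and AU: "A \<subseteq> U" by (auto simp: sets_restrict_space_iff)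
    have "emeasure \<sigma> A = (\<integral>\<^sup>+y. ennreal (j y) * indicator A (Q (y + \<phi> y *\<^sub>R e) + c) \<partial>hyperplane_lborel e)"
      unfolding hypersurface_measureD(4)[OF \<sigma> chart A AU[unfolded U_def]]
      by (intro nn_integral_cong) (simp add: j_def indicator_def)
    also have "\<dots> = (\<integral>\<^sup>+x. indicator A x \<partial>\<tau>)" by (rule nn[symmetric]) simp
    also have "\<dots> = emeasure \<tau> A" by (simp add: nn_integral_indicator)
    finally show "emeasure (restrict_space \<sigma> U) A = emeasure (restrict_space \<tau> U) A"
      using AU by (simp add: emeasure_restrict_space)
  qed
  then have "(\<integral>\<^sup>+x. f x * indicator U x \<partial>\<sigma>) = (\<integral>\<^sup>+x. f x * indicator U x \<partial>\<tau>)"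
    using nn_integral_restrict_space[of U \<sigma> f] nn_integral_restrict_space[of U \<tau> f] by simp
  moreover have "f x * indicator U x = f x" for x using f0[of x] by (simp add: U_def indicator_def)
  ultimately have "(\<integral>\<^sup>+x. f x \<partial>\<sigma>) = (\<integral>\<^sup>+x. f x \<partial>\<tau>)" by simp
  then show ?thesis unfolding nn[OF assms(3)] j_def .
qed

lemma
  fixes \<Omega> :: "'a::euclidean_space set" and f :: "'a \<Rightarrow> real"
  assumes \<sigma>: "hypersurface_measure \<Omega> \<sigma>" and chart: "C1_chart \<Omega> Q c e a \<phi> g"
    and K: "compact K" "K \<subseteq> chart_domain Q c a" "\<And>x. x \<notin> K \<Longrightarrow> f x = 0"
    and f: "continuous_on UNIV f"
  shows chart_flux_integrable: "integrable (hyperplane_lborel e)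
      (\<lambda>y. indicator (coord_base e a) y * (f (Q (y + \<phi> y *\<^sub>R e) + c) * (\<nu> \<bullet> Q (e - g y))))"
    and chart_area_integrable: "integrable (hyperplane_lborel e)
      (\<lambda>y. indicator (coord_base e a) y * (f (Q (y + \<phi> y *\<^sub>R e) + c) * norm (e - g y)))"
    and chart_surface_integrable: "(\<And>x. 0 \<le> f x) \<Longrightarrow> integrable \<sigma> f"
    and chart_surface_integral: "(\<And>x. 0 \<le> f x) \<Longrightarrow> (LINT x|\<sigma>. f x) =
      (LINT y|hyperplane_lborel e. indicator (coord_base e a) y * (f (Q (y + \<phi> y *\<^sub>R e) + c) * norm (e - g y)))"
proof -
  note Q = C1_chartD(1)[OF chart] and e = C1_chartD(2)[OF chart]
  note Qm = orthogonal_chart_map[OF Q]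
  obtain \<eta> where \<eta>: "\<eta> > 0" "\<And>y b. Q y + c \<in> K \<Longrightarrow> b \<in> Basis \<Longrightarrow> \<bar>y \<bullet> b\<bar> + \<eta> \<le> a \<bullet> b"
    using compact_in_chart_margin[OF Q K(1,2)] by metis
  obtain L where L: "L > 0" "\<And>y. y \<in> shrunk_base e a \<eta> \<Longrightarrow> norm (g y) \<le> L"
    using shrunk_base_gradient_bounded[OF chart \<eta>(1)] by auto
  have "bounded (f ` K)" by (intro compact_imp_bounded compact_continuous_image continuous_on_subset[OF f] K) auto
  then obtain M where M: "M > 0" "\<And>x. x \<in> K \<Longrightarrow> \<bar>f x\<bar> \<le> M" by (auto simp: bounded_pos)
  have fM: "\<bar>f x\<bar> \<le> M" for x using M K(3)[of x] by (cases "x \<in> K") auto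
  let ?T = "\<lambda>y. Q (y + \<phi> y *\<^sub>R e) + c"
  have f0: "f (?T y) = 0" if "y \<in> coord_base e a" "y \<notin> shrunk_base e a \<eta>" for y
    using chart_point_in_K(1)[OF chart \<eta>(2), where y=y and s="\<phi> y"] that K(3)[of "?T y"] by (auto simp: coord_base_def)
  have Tc: "continuous_on (coord_base e a) ?T"
    by (intro continuous_intros continuous_on_compose2[OF Qm(8)[of UNIV]] C1_chartD(5,6)[OF chart]) auto
  have eg: "norm (e - g y) \<le> 1 + L" if "y \<in> shrunk_base e a \<eta>" for y
    using norm_triangle_ineq4[of e "g y"] L(2)[OF that] e by simp
  show "integrable (hyperplane_lborel e) (\<lambda>y. indicator (coord_base e a) y * (f (?T y) * (\<nu> \<bullet> Q (e - g y))))"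
  proof (rule integrable_shrunk_base[OF e _ \<eta>(1)])
    show "continuous_on (coord_base e a) (\<lambda>y. f (?T y) * (\<nu> \<bullet> Q (e - g y)))"
      by (intro continuous_intros continuous_on_compose2[OF f] continuous_on_compose2[OF Qm(8)[of UNIV]] Tc C1_chartD(5)[OF chart]) auto
    show "\<bar>f (?T y) * (\<nu> \<bullet> Q (e - g y))\<bar> \<le> M * (norm \<nu> * (1 + L))" if "y \<in> shrunk_base e a \<eta>" for y
    proof -
      have "\<bar>\<nu> \<bullet> Q (e - g y)\<bar> \<le> norm \<nu> * norm (e - g y)"
        using Cauchy_Schwarz_ineq2[of \<nu> "Q (e - g y)"] by (simp add: Qm)
      also have "\<dots> \<le> norm \<nu> * (1 + L)" by (intro mult_left_mono eg that) auto
      finally show ?thesis unfolding abs_mult using M(1) by (intro mult_mono fM) auto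
    qed
  qed (simp add: f0)
  show int: "integrable (hyperplane_lborel e) (\<lambda>y. indicator (coord_base e a) y * (f (?T y) * norm (e - g y)))"
  proof (rule integrable_shrunk_base[OF e _ \<eta>(1)])
    show "continuous_on (coord_base e a) (\<lambda>y. f (?T y) * norm (e - g y))"
      by (intro continuous_intros continuous_on_compose2[OF f] Tc C1_chartD(5)[OF chart]) auto
    show "\<bar>f (?T y) * norm (e - g y)\<bar> \<le> M * (1 + L)" if "y \<in> shrunk_base e a \<eta>" for y
      unfolding abs_mult using M(1) eg[OF that] by (intro mult_mono fM) auto
  qed (simp add: f0)
  assume pos: "\<And>x. 0 \<le> f x"
  have fb [measurable]: "f \<in> borel_measurable borel" by (rule borel_measurable_continuous_onI[OF f])
  have f\<sigma>: "f \<in> borel_measurable \<sigma>"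
    using fb by (simp add: measurable_cong_sets[OF hypersurface_measureD(1)[OF \<sigma>] refl])
  have "(\<integral>\<^sup>+x. ennreal (f x) \<partial>\<sigma>) =
    (\<integral>\<^sup>+y. ennreal (indicator (coord_base e a) y * sqrt (1 + (norm (g y))\<^sup>2)) * ennreal (f (?T y)) \<partial>hyperplane_lborel e)"
  proof (intro chart_surface_nn_integral[OF \<sigma> chart])
    show "ennreal (f x) = 0" if "x \<notin> chart_domain Q c a" for x
    proof -
      have "x \<notin> K" using K(2) that by blast
      then show ?thesis by (simp add: K(3))
    qed
  qed simp
  also have "\<dots> = (\<integral>\<^sup>+y. ennreal (indicator (coord_base e a) y * (f (?T y) * norm (e - g y))) \<partial>hyperplane_lborel e)"
  proof (intro nn_integral_cong)
    fix y
    show "ennreal (indicator (coord_base e a) y * sqrt (1 + (norm (g y))\<^sup>2)) * ennreal (f (?T y)) =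
       ennreal (indicator (coord_base e a) y * (f (?T y) * norm (e - g y)))"
      using graph_normal_norm(1)[OF e C1_chartD(4)[OF chart], of y] pos
      by (cases "y \<in> coord_base e a") (simp_all add: ennreal_mult[symmetric] mult.commute)
  qed
  also have "\<dots> = ennreal (LINT y|hyperplane_lborel e. indicator (coord_base e a) y * (f (?T y) * norm (e - g y)))"
    by (rule nn_integral_eq_integral[OF int]) (simp add: pos)
  finally have nn: "(\<integral>\<^sup>+x. ennreal (f x) \<partial>\<sigma>) =
     ennreal (LINT y|hyperplane_lborel e. indicator (coord_base e a) y * (f (?T y) * norm (e - g y)))" .
  show i\<sigma>: "integrable \<sigma> f"
    by (rule integrableI_nonneg[OF f\<sigma>]) (simp_all add: pos nn)
  show "(LINT x|\<sigma>. f x) =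
      (LINT y|hyperplane_lborel e. indicator (coord_base e a) y * (f (?T y) * norm (e - g y)))"
    by (subst integral_eq_nn_integral[OF f\<sigma>]) (auto simp: pos nn intro!: integral_nonneg_AE)
qed

text \<open>Translations by small multiples of \<open>\<nu>\<close> do not carry points of \<open>K\<close> across the boundary, since a ball that
  meets both \<open>\<Omega>\<close> and its complement meets the boundary. The difference quotients therefore vanish.\<close>
lemma interior_divergence:
  fixes \<Omega> :: "'a::euclidean_space set"
  assumes f: "C1_gradient f F" and K: "compact K" "\<And>x. x \<notin> K \<Longrightarrow> f x = 0" "K \<inter> frontier \<Omega> = {}" and \<Omega>: "open \<Omega>"
  shows "(LINT x|lborel. (F x \<bullet> \<nu>) * indicator \<Omega> x) = 0"
proof -
  have [measurable]: "\<Omega> \<in> sets borel" using \<Omega> by simp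
  obtain R where R: "\<And>x. norm x > R \<Longrightarrow> f x = 0"
    using compact_imp_bounded[OF K(1)] K(2) by (metis bounded_iff not_le)
  obtain \<delta> where \<delta>: "\<delta> > 0" "(\<Union>x\<in>K. ball x \<delta>) \<subseteq> - frontier \<Omega>"
    using compact_subset_open_imp_ball_epsilon_subset[OF K(1), of "- frontier \<Omega>"] K(3) by auto
  have const: "x - s *\<^sub>R \<nu> \<in> \<Omega> \<longleftrightarrow> x \<in> \<Omega>" if x: "x \<in> K" and s: "norm (s *\<^sub>R \<nu>) < \<delta>" for x s
  proof (rule ccontr)
    assume "\<not> ?thesis"
    moreover have "x \<in> ball x \<delta>" "x - s *\<^sub>R \<nu> \<in> ball x \<delta>" using s \<delta>(1) by (auto simp: dist_norm)
    ultimately have "ball x \<delta> \<inter> \<Omega> \<noteq> {}" "ball x \<delta> - \<Omega> \<noteq> {}" by blast+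
    then have "ball x \<delta> \<inter> frontier \<Omega> \<noteq> {}" by (intro connected_Int_frontier) auto
    then show False using \<delta>(2) x by blast
  qed
  define \<tau> where "\<tau> = min 1 (\<delta> / (norm \<nu> + 1))"
  have \<tau>: "0 < \<tau>" "\<tau> \<le> 1" using \<delta>(1) by (auto simp: \<tau>_def intro!: divide_pos_pos add_nonneg_pos)
  have small: "norm (s *\<^sub>R \<nu>) < \<delta>" if "\<bar>s\<bar> \<le> \<tau>" for s
  proof (cases "\<nu> = 0")
    case False
    have "\<bar>s\<bar> * norm \<nu> \<le> \<tau> * norm \<nu>" using that by (intro mult_right_mono) auto
    also have "\<dots> < \<tau> * (norm \<nu> + 1)" using \<tau> by simp
    also have "\<dots> \<le> \<delta> / (norm \<nu> + 1) * (norm \<nu> + 1)" by (intro mult_right_mono) (auto simp: \<tau>_def)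
    also have "\<dots> = \<delta>" by (simp add: add_nonneg_eq_0_iff)
    finally show ?thesis by simp
  qed (simp add: \<delta>)
  define t where "t n = \<tau> * inverse (real (Suc n))" for n
  have t_le: "\<bar>t n\<bar> \<le> \<tau>" and t_ne: "t n \<noteq> 0" for n
    using \<tau> by (auto simp: t_def field_simps)
  have t_lim: "t \<longlonglongrightarrow> 0" unfolding t_def
    using tendsto_mult[OF tendsto_const[of \<tau>] LIMSEQ_inverse_real_of_nat] by simp
  have eq: "f x * indicator \<Omega> (x - t n *\<^sub>R \<nu>) = f x * indicator \<Omega> x" for n x
    using const[of x "t n"] small[OF t_le[of n]] K(2)[of x] by (cases "x \<in> K") (auto simp: indicator_def)
  have "(\<lambda>n. ((LINT x|lborel. f x * indicator \<Omega> (x - t n *\<^sub>R \<nu>)) - (LINT x|lborel. f x * indicator \<Omega> x)) / t n)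
    \<longlonglongrightarrow> (LINT x|lborel. (F x \<bullet> \<nu>) * indicator \<Omega> x)"
    by (rule translation_difference_quotient[OF f R _ t_lim t_ne]) (use t_le \<tau> in \<open>auto intro: order_trans\<close>)
  then show ?thesis by (simp add: eq LIMSEQ_const_iff)
qed

text \<open>The flux density is \<open>\<nu> \<bullet> N\<close> with the normal \<open>N = Q (e - g y)\<close>, the area density is \<open>|N|\<close>, and
  \<open>\<nu> \<bullet> N \<le> |N|\<close>.\<close>
lemma chart_flux_le_surface:
  fixes \<Omega> :: "'a::euclidean_space set"
  assumes \<sigma>: "hypersurface_measure \<Omega> \<sigma>" and chart: "C1_chart \<Omega> Q c e a \<phi> g" and f: "C1_gradient f F"
    and K: "compact K" "K \<subseteq> chart_domain Q c a" "\<And>x. x \<notin> K \<Longrightarrow> f x = 0" and \<Omega>: "open \<Omega>"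
    and pos: "\<And>x. 0 \<le> f x" and \<nu>: "norm \<nu> = 1"
  shows "(LINT x|lborel. (F x \<bullet> \<nu>) * indicator \<Omega> x) \<le> (LINT x|\<sigma>. f x)" (is "?flux \<le> ?area")
proof -
  note Qm = orthogonal_chart_map[OF C1_chartD(1)[OF chart]]
  note ints = \<sigma> chart K C1_gradientD(3)[OF f]
  have eqs: "?flux =
     (LINT y|hyperplane_lborel e. indicator (coord_base e a) y * (f (Q (y + \<phi> y *\<^sub>R e) + c) * (\<nu> \<bullet> Q (e - g y))))"
    "?area = (LINT y|hyperplane_lborel e. indicator (coord_base e a) y * (f (Q (y + \<phi> y *\<^sub>R e) + c) * norm (e - g y)))"
    by - (rule chart_divergence[OF chart f K \<Omega>], assumption, rule chart_surface_integral[OF ints pos], assumption)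
  show ?thesis
    unfolding eqs
  proof (rule integral_mono[OF chart_flux_integrable[OF ints] chart_area_integrable[OF ints]])
    fix y
    have "\<nu> \<bullet> Q (e - g y) \<le> norm (e - g y)"
      using norm_cauchy_schwarz[of \<nu> "Q (e - g y)"] \<nu> by (simp add: Qm)
    then show "indicator (coord_base e a) y * (f (Q (y + \<phi> y *\<^sub>R e) + c) * (\<nu> \<bullet> Q (e - g y)))
      \<le> indicator (coord_base e a) y * (f (Q (y + \<phi> y *\<^sub>R e) + c) * norm (e - g y))"
      by (intro mult_left_mono pos) auto
  qed
qed

text \<open>With \<open>N = e - g y\<close> and \<open>N0 = e - g0\<close>, the flux density in direction \<open>N0 / |N0|\<close> is at least
  \<open>|N0| - |N - N0| \<ge> |N| - 2 \<epsilon> \<ge> (1 - 2 \<epsilon>) |N|\<close>, the last step by \<open>|N| \<ge> 1\<close>.\<close>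
lemma chart_flux_ge_surface:
  fixes \<Omega> :: "'a::euclidean_space set"
  assumes \<sigma>: "hypersurface_measure \<Omega> \<sigma>" and chart: "C1_chart \<Omega> Q c e a \<phi> g" and f: "C1_gradient f F"
    and K: "compact K" "K \<subseteq> chart_domain Q c a" "\<And>x. x \<notin> K \<Longrightarrow> f x = 0" and \<Omega>: "open \<Omega>"
    and pos: "\<And>x. 0 \<le> f x" and g0: "g0 \<bullet> e = 0"
    and osc: "\<And>y. y \<in> coord_base e a \<Longrightarrow> Q (y + \<phi> y *\<^sub>R e) + c \<in> K \<Longrightarrow> norm (g y - g0) \<le> \<epsilon>"
  shows "(1 - 2 * \<epsilon>) * (LINT x|\<sigma>. f x) \<le> (LINT x|lborel. (F x \<bullet> (Q (e - g0) /\<^sub>R norm (e - g0))) * indicator \<Omega> x)"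
    (is "_ * ?area \<le> ?flux")
proof -
  note e = C1_chartD(2)[OF chart]
  note Qm = orthogonal_chart_map[OF C1_chartD(1)[OF chart]]
  note ints = \<sigma> chart K C1_gradientD(3)[OF f]
  define N0 where "N0 = e - g0"
  have N0: "norm N0 \<ge> 1" unfolding N0_def by (rule graph_normal_norm(2)[OF e g0])
  have eqs: "?flux =
     (LINT y|hyperplane_lborel e. indicator (coord_base e a) y * (f (Q (y + \<phi> y *\<^sub>R e) + c) * ((Q (e - g0) /\<^sub>R norm (e - g0)) \<bullet> Q (e - g y))))"
    "?area = (LINT y|hyperplane_lborel e. indicator (coord_base e a) y * (f (Q (y + \<phi> y *\<^sub>R e) + c) * norm (e - g y)))"
    by - (rule chart_divergence[OF chart f K \<Omega>], assumption, rule chart_surface_integral[OF ints pos], assumption)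
  show ?thesis
    unfolding eqs integral_mult_right_zero[symmetric]
  proof (rule integral_mono[OF integrable_mult_right[OF chart_area_integrable[OF ints]] chart_flux_integrable[OF ints]])
    fix y
    show "(1 - 2 * \<epsilon>) * (indicator (coord_base e a) y * (f (Q (y + \<phi> y *\<^sub>R e) + c) * norm (e - g y)))
      \<le> indicator (coord_base e a) y * (f (Q (y + \<phi> y *\<^sub>R e) + c) * ((Q (e - g0) /\<^sub>R norm (e - g0)) \<bullet> Q (e - g y)))"
    proof (cases "y \<in> coord_base e a \<and> Q (y + \<phi> y *\<^sub>R e) + c \<in> K")
      case False
      then show ?thesis using K(3) by (auto simp: indicator_def)
    next
      case True
      define N where "N = e - g y"
      define d where "d = norm (g y - g0)"
      have d: "0 \<le> d" "d \<le> \<epsilon>" using osc True by (auto simp: d_def)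
      have N: "norm N \<ge> 1" unfolding N_def using graph_normal_norm(2)[OF e] C1_chartD(4)[OF chart] True by blast
      have NN: "norm (N - N0) = d" by (simp add: N_def N0_def d_def norm_minus_commute)
      have "N0 \<bullet> N = N0 \<bullet> N0 + N0 \<bullet> (N - N0)" by (simp add: inner_diff_right)
      also have "\<dots> \<ge> norm N0 * norm N0 - norm N0 * d"
        using Cauchy_Schwarz_ineq2[of N0 "N - N0"] NN by (simp add: power2_norm_eq_inner flip: power2_eq_square)
      finally have "norm N0 * (norm N0 - d) \<le> N0 \<bullet> N" by (simp add: algebra_simps)
      then have "norm N0 - d \<le> (N0 \<bullet> N) / norm N0" using N0 by (subst pos_le_divide_eq) (auto simp: mult.commute)
      moreover have "norm N \<le> norm N0 + d" using norm_triangle_ineq[of N0 "N - N0"] NN by simp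
      moreover have "\<epsilon> \<le> \<epsilon> * norm N" using d N by (simp add: mult_le_cancel_left1)
      ultimately have "(1 - 2 * \<epsilon>) * norm N \<le> (N0 \<bullet> N) / norm N0" using d by (simp add: algebra_simps)
      also have "\<dots> = (Q N0 /\<^sub>R norm N0) \<bullet> Q N" by (simp add: Qm divide_inverse mult.commute)
      finally have "(1 - 2 * \<epsilon>) * norm N \<le> (Q N0 /\<^sub>R norm N0) \<bullet> Q N" .
      from mult_left_mono[OF this pos[of "Q (y + \<phi> y *\<^sub>R e) + c"]] True
      show ?thesis by (simp add: N_def N0_def mult_ac)
    qed
  qed
qed

section \<open>Partitions of unity at a given scale\<close>

text \<open>The remainder of first order is at most \<open>(u - t)\<^sup>2\<close>, whatever the signs of \<open>t\<close> and \<open>u\<close>.\<close>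
lemma max_zero_squared_has_derivative: "((\<lambda>t::real. (max 0 t)\<^sup>2) has_real_derivative 2 * max 0 t) (at t)"
proof -
  have bound: "\<bar>(max 0 u)\<^sup>2 - (max 0 t)\<^sup>2 - 2 * max 0 t * (u - t)\<bar> \<le> (u - t)\<^sup>2" for u
  proof -
    consider "t \<ge> 0" "u \<ge> 0" | "t \<ge> 0" "u < 0" | "t < 0" "u \<ge> 0" | "t < 0" "u < 0" by linarith
    then show ?thesis
    proof cases
      case 1
      then have "(max 0 u)\<^sup>2 - (max 0 t)\<^sup>2 - 2 * max 0 t * (u - t) = (u - t)\<^sup>2"
        by (simp add: power2_eq_square algebra_simps)
      then show ?thesis by simp
    next
      case 2
      then have "(max 0 u)\<^sup>2 - (max 0 t)\<^sup>2 - 2 * max 0 t * (u - t) = t * t - 2 * (t * u)" "t * u \<le> 0" "(u - t)\<^sup>2 = u * u + (t * t - 2 * (t * u))"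
        by (simp_all add: power2_eq_square algebra_simps mult_nonneg_nonpos)
      moreover have "u * u \<ge> 0" "t * t \<ge> 0" by simp_all
      ultimately show ?thesis by linarith
    next
      case 3
      then have "u\<^sup>2 \<le> (u - t)\<^sup>2" by (intro power_mono) auto
      then show ?thesis using 3 by simp
    qed simp
  qed
  have "((\<lambda>h. ((max 0 (t + h))\<^sup>2 - (max 0 t)\<^sup>2) / h - 2 * max 0 t) \<longlongrightarrow> 0) (at 0)"
  proof (rule Lim_null_comparison)
    show "\<forall>\<^sub>F h in at 0. norm (((max 0 (t + h))\<^sup>2 - (max 0 t)\<^sup>2) / h - 2 * max 0 t) \<le> \<bar>h\<bar>"
    proof (rule eventually_at_filter[THEN iffD2], rule always_eventually, safe)
      fix h :: real assume h: "h \<noteq> 0"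
      have "norm (((max 0 (t + h))\<^sup>2 - (max 0 t)\<^sup>2) / h - 2 * max 0 t) = \<bar>(max 0 (t + h))\<^sup>2 - (max 0 t)\<^sup>2 - 2 * max 0 t * h\<bar> / \<bar>h\<bar>"
        using h by (simp add: field_simps flip: abs_divide)
      also have "\<dots> \<le> h\<^sup>2 / \<bar>h\<bar>" using bound[of "t + h"] by (intro divide_right_mono) auto
      also have "\<dots> = \<bar>h\<bar>" using h by (simp add: power2_eq_square field_simps)
      finally show "norm (((max 0 (t + h))\<^sup>2 - (max 0 t)\<^sup>2) / h - 2 * max 0 t) \<le> \<bar>h\<bar>" .
    qed
    show "((\<lambda>h::real. \<bar>h\<bar>) \<longlongrightarrow> 0) (at 0)" by (intro tendsto_rabs_zero tendsto_ident_at)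
  qed
  then show ?thesis by (simp add: DERIV_def LIM_zero_iff)
qed

text \<open>A continuously differentiable transition from \<open>0\<close> to \<open>1\<close> on the unit interval: its derivative is the tent
  with peak \<open>2\<close> at \<open>1/2\<close>. Squares of positive parts give one formula on the whole line.\<close>
definition step :: "real \<Rightarrow> real" where
  "step t = 2 * (max 0 t)\<^sup>2 - 4 * (max 0 (t - 1/2))\<^sup>2 + 2 * (max 0 (t - 1))\<^sup>2"

definition step_deriv :: "real \<Rightarrow> real" where
  "step_deriv t = 4 * max 0 t - 8 * max 0 (t - 1/2) + 4 * max 0 (t - 1)"

lemma step_has_derivative: "(step has_real_derivative step_deriv t) (at t)"
proof -
  have "((\<lambda>t. (max 0 (t - c))\<^sup>2) has_real_derivative 2 * max 0 (t - c)) (at t)" for c :: real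
    by (rule DERIV_chain2[OF max_zero_squared_has_derivative, THEN DERIV_cong]) (rule derivative_eq_intros refl | simp)+
  from DERIV_add[OF DERIV_diff[OF DERIV_cmult[OF this[of 0], of 2] DERIV_cmult[OF this[of "1/2"], of 4]]
      DERIV_cmult[OF this[of 1], of 2]]
  show ?thesis unfolding step_def[abs_def] step_deriv_def by simp
qed

lemma step_deriv_bounds: "0 \<le> step_deriv t" "step_deriv t \<le> 2" "t \<le> 0 \<Longrightarrow> step_deriv t = 0" "1 \<le> t \<Longrightarrow> step_deriv t = 0"
  by (auto simp: step_deriv_def max_def)

lemma step_values: "t \<le> 0 \<Longrightarrow> step t = 0" "1 \<le> t \<Longrightarrow> step t = 1"
  by (auto simp: step_def max_def power2_eq_square algebra_simps)

lemma step_mono: "s \<le> t \<Longrightarrow> step s \<le> step t"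
  by (rule DERIV_nonneg_imp_nondecreasing) (use step_has_derivative step_deriv_bounds in blast)+

lemma step_range: "0 \<le> step t" "step t \<le> 1"
  using step_mono[of 0 t] step_mono[of t 1] step_values(1)[of t] step_values(2)[of t] step_values(1)[of 0] step_values(2)[of 1]
  by (cases "t \<le> 0"; cases "t \<ge> 1"; simp)+

text \<open>A bump supported in \<open>[-1, 1]\<close>. As a difference of steps, its integer translates sum to \<open>1\<close> by telescoping.\<close>
definition hat :: "real \<Rightarrow> real" where "hat t = step (t + 1) - step t"
definition hat_deriv :: "real \<Rightarrow> real" where "hat_deriv t = step_deriv (t + 1) - step_deriv t"

lemma hat_has_derivative: "(hat has_real_derivative hat_deriv t) (at t)"
proof -
  have "((\<lambda>t. step (t + 1)) has_real_derivative step_deriv (t + 1)) (at t)"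
    by (rule DERIV_chain2[OF step_has_derivative, THEN DERIV_cong]) (rule derivative_eq_intros refl | simp)+
  then show ?thesis unfolding hat_def[abs_def] hat_deriv_def by (intro DERIV_diff step_has_derivative)
qed

lemma hat_deriv_continuous: "continuous_on S hat_deriv"
  unfolding hat_deriv_def[abs_def] step_deriv_def[abs_def] by (intro continuous_intros)

lemma hat_bounds: "0 \<le> hat t" "hat t \<le> 1" "\<bar>hat_deriv t\<bar> \<le> 2" "1 \<le> \<bar>t\<bar> \<Longrightarrow> hat t = 0" "1 \<le> \<bar>t\<bar> \<Longrightarrow> hat_deriv t = 0"
proof -
  show "0 \<le> hat t" using step_mono[of t "t + 1"] by (simp add: hat_def)
  show "hat t \<le> 1" using step_range[of t] step_range[of "t + 1"] by (simp add: hat_def)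
  show "\<bar>hat_deriv t\<bar> \<le> 2" using step_deriv_bounds[of t] step_deriv_bounds[of "t + 1"] by (simp add: hat_deriv_def)
  show "hat t = 0" "hat_deriv t = 0" if "1 \<le> \<bar>t\<bar>"
    using that step_values[of t] step_values[of "t + 1"] step_deriv_bounds(3,4)[of t] step_deriv_bounds(3,4)[of "t + 1"]
    by (auto simp: hat_def hat_deriv_def abs_if split: if_splits)
qed

lemma hat_sum: "(\<Sum>k\<in>{- int N..int N}. hat (t - of_int k)) = step (t + real N + 1) - step (t - real N)"
proof (induction N)
  case 0
  then show ?case by (simp add: hat_def)
next
  case (Suc N)
  have "{- int (Suc N)..int (Suc N)} = insert (- int (Suc N)) (insert (int (Suc N)) {- int N..int N})" by auto
  then show ?case using Suc.IH by (simp add: hat_def algebra_simps)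
qed

lemma hat_partition: "\<bar>t\<bar> \<le> real N \<Longrightarrow> (\<Sum>k\<in>{- int N..int N}. hat (t - of_int k)) = 1"
  unfolding hat_sum by (simp add: step_values)

lemma card_near_ints:
  fixes t :: real
  shows "finite {k::int. \<bar>t - of_int k\<bar> < 1}" "card {k::int. \<bar>t - of_int k\<bar> < 1} \<le> 2"
proof -
  have sub: "{k::int. \<bar>t - of_int k\<bar> < 1} \<subseteq> {\<lfloor>t\<rfloor>, \<lfloor>t\<rfloor> + 1}" by auto linarith+
  show "finite {k::int. \<bar>t - of_int k\<bar> < 1}" by (rule finite_subset[OF sub]) simp
  show "card {k::int. \<bar>t - of_int k\<bar> < 1} \<le> 2" using card_mono[OF _ sub] by simp
qed

definition lattice_bump :: "real \<Rightarrow> ('a::euclidean_space \<Rightarrow> int) \<Rightarrow> 'a \<Rightarrow> real" where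
  "lattice_bump d k x = (\<Prod>b\<in>Basis. hat (x \<bullet> b / d - of_int (k b)))"

definition lattice_bump_gradient :: "real \<Rightarrow> ('a::euclidean_space \<Rightarrow> int) \<Rightarrow> 'a \<Rightarrow> 'a" where
  "lattice_bump_gradient d k x = (\<Sum>b\<in>Basis. (hat_deriv (x \<bullet> b / d - of_int (k b)) / d *
      (\<Prod>j\<in>Basis - {b}. hat (x \<bullet> j / d - of_int (k j)))) *\<^sub>R b)"

lemma C1_gradient_lattice_bump:
  assumes d: "d > 0"
  shows "C1_gradient (lattice_bump d k) (lattice_bump_gradient d k)"
  unfolding C1_gradient_def
proof (intro conjI allI)
  fix x :: 'a
  have 1: "((\<lambda>x. hat (x \<bullet> b / d - of_int (k b))) has_derivative (\<lambda>h. hat_deriv (x \<bullet> b / d - of_int (k b)) * (h \<bullet> b / d))) (at x)" for b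
    by (rule has_derivative_compose[where g=hat, OF _ hat_has_derivative[unfolded has_field_derivative_def]])
       (use d in \<open>auto intro!: derivative_eq_intros\<close>)
  show "(lattice_bump d k has_derivative (\<lambda>h. lattice_bump_gradient d k x \<bullet> h)) (at x)"
    unfolding lattice_bump_def[abs_def] lattice_bump_gradient_def
    by (rule has_derivative_eq_rhs[OF has_derivative_prod[OF 1]])
       (unfold inner_sum_left inner_scaleR_left, intro ext sum.cong refl, simp add: inner_commute)
  show "continuous_on UNIV (lattice_bump_gradient d k)"
    unfolding lattice_bump_gradient_def[abs_def]
    by (intro continuous_intros continuous_on_compose2[OF hat_deriv_continuous[of UNIV]]
        continuous_on_compose2[OF DERIV_continuous_on[OF hat_has_derivative], of UNIV]) (use d in auto)
qed

lemma lattice_bump_nonneg: "0 \<le> lattice_bump d k x"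
  unfolding lattice_bump_def by (intro prod_nonneg hat_bounds)

lemma lattice_bump_support:
  assumes "b \<in> Basis" "1 \<le> \<bar>x \<bullet> b / d - of_int (k b)\<bar>"
  shows "lattice_bump d k x = 0" "lattice_bump_gradient d k x = 0"
proof -
  show "lattice_bump d k x = 0"
    unfolding lattice_bump_def using assms hat_bounds(4) by (intro prod_zero bexI[of _ b]) auto
  have "hat_deriv (x \<bullet> c / d - of_int (k c)) / d * (\<Prod>j\<in>Basis - {c}. hat (x \<bullet> j / d - of_int (k j))) = 0" if c: "c \<in> Basis" for c
  proof (cases "c = b")
    case False
    then have "(\<Prod>j\<in>Basis - {c}. hat (x \<bullet> j / d - of_int (k j))) = 0"
      using assms hat_bounds(4) by (intro prod_zero bexI[of _ b]) auto
    then show ?thesis by simp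
  qed (simp add: hat_bounds assms)
  then show "lattice_bump_gradient d k x = 0" unfolding lattice_bump_gradient_def by (simp add: sum.neutral)
qed

lemma lattice_bump_gradient_bound:
  fixes x :: "'a::euclidean_space"
  assumes d: "d > 0"
  shows "norm (lattice_bump_gradient d k x) \<le> 2 * DIM('a) / d"
proof -
  have "norm (lattice_bump_gradient d k x) \<le> (\<Sum>b\<in>(Basis::'a set). 2 / d)"
    unfolding lattice_bump_gradient_def
  proof (rule sum_norm_le)
    fix b :: 'a assume b: "b \<in> Basis"
    have "\<bar>hat_deriv (x \<bullet> b / d - of_int (k b)) / d\<bar> \<le> 2 / d"
      using hat_bounds(3) d by (simp add: abs_divide divide_right_mono)
    moreover have "\<bar>\<Prod>j\<in>Basis - {b}. hat (x \<bullet> j / d - of_int (k j))\<bar> \<le> 1"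
      unfolding abs_prod by (intro prod_le_1) (auto simp: hat_bounds)
    ultimately have "\<bar>hat_deriv (x \<bullet> b / d - of_int (k b)) / d\<bar> * \<bar>\<Prod>j\<in>Basis - {b}. hat (x \<bullet> j / d - of_int (k j))\<bar> \<le> 2 / d * 1"
      using d by (intro mult_mono) auto
    then show "norm ((hat_deriv (x \<bullet> b / d - of_int (k b)) / d *
      (\<Prod>j\<in>Basis - {b}. hat (x \<bullet> j / d - of_int (k j)))) *\<^sub>R b) \<le> 2 / d"
      using b by (simp add: abs_mult)
  qed
  then show ?thesis by (simp add: mult.commute)
qed

lemma lattice_bump_partition:
  fixes x :: "'a::euclidean_space"
  assumes "\<And>b. b \<in> Basis \<Longrightarrow> \<bar>x \<bullet> b / d\<bar> \<le> real N"
  shows "(\<Sum>k\<in>PiE Basis (\<lambda>_. {- int N..int N}). lattice_bump d k x) = 1"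
proof -
  have "(\<Sum>k\<in>PiE Basis (\<lambda>_. {- int N..int N}). lattice_bump d k x) =
     (\<Prod>b\<in>Basis. \<Sum>k\<in>{- int N..int N}. hat (x \<bullet> b / d - of_int k))"
    unfolding lattice_bump_def by (subst prod_sum_PiE) auto
  also have "\<dots> = (\<Prod>b\<in>(Basis::'a set). 1)" by (intro prod.cong refl hat_partition assms)
  finally show ?thesis by simp
qed

text \<open>A bump and its gradient are nonzero at \<open>x\<close> only if \<open>x\<close> is within one lattice spacing of the centre in
  every coordinate, which leaves at most two choices per coordinate.\<close>
lemma lattice_bump_gradient_sum_bound:
  fixes x :: "'a::euclidean_space"
  assumes d: "d > 0" and I: "I \<subseteq> PiE Basis (\<lambda>_. UNIV)" "finite I"
  shows "(\<Sum>k\<in>I. norm (lattice_bump_gradient d k x)) \<le> 2 ^ DIM('a) * (2 * DIM('a) / d)"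
proof -
  define S where "S = PiE (Basis::'a set) (\<lambda>b. {k::int. \<bar>x \<bullet> b / d - of_int k\<bar> < 1})"
  have S: "finite S" unfolding S_def by (intro finite_PiE card_near_ints) auto
  have "card S \<le> (\<Prod>b\<in>(Basis::'a set). 2)"
    unfolding S_def by (subst card_PiE, simp) (intro prod_mono conjI card_near_ints zero_le)
  then have cardS: "card S \<le> 2 ^ DIM('a)" by simp
  have "(\<Sum>k\<in>I. norm (lattice_bump_gradient d k x)) = (\<Sum>k\<in>I \<inter> S. norm (lattice_bump_gradient d k x))"
  proof (rule sum.mono_neutral_right[OF I(2)])
    show "\<forall>k\<in>I - I \<inter> S. norm (lattice_bump_gradient d k x) = 0"
    proof
      fix k assume k: "k \<in> I - I \<inter> S"
      then have "k \<notin> S" "k \<in> PiE Basis (\<lambda>_. UNIV)" using I by auto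
      then obtain b where "b \<in> Basis" "1 \<le> \<bar>x \<bullet> b / d - of_int (k b)\<bar>" by (auto simp: S_def PiE_iff not_less)
      from lattice_bump_support(2)[where k=k, OF this] show "norm (lattice_bump_gradient d k x) = 0" by simp
    qed
  qed auto
  also have "\<dots> \<le> card (I \<inter> S) * (2 * DIM('a) / d)"
    by (rule sum_bounded_above) (rule lattice_bump_gradient_bound[OF d])
  also have "\<dots> \<le> 2 ^ DIM('a) * (2 * DIM('a) / d)"
  proof (rule mult_right_mono)
    have "card (I \<inter> S) \<le> 2 ^ DIM('a)" using card_mono[OF S, of "I \<inter> S"] cardS by simp
    then show "real (card (I \<inter> S)) \<le> 2 ^ DIM('a)" by (metis of_nat_le_iff of_nat_numeral of_nat_power)
  qed (use d in simp)
  finally show ?thesis .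
qed

text \<open>The bound on the sum of the gradients is
  inherited by the divergence of every field that is glued with them from vectors of length at most \<open>1\<close>.\<close>
definition fine_partition ::
    "real \<Rightarrow> real \<Rightarrow> real \<Rightarrow> 'k set \<Rightarrow> ('k \<Rightarrow> 'a::euclidean_space \<Rightarrow> real) \<Rightarrow> ('k \<Rightarrow> 'a \<Rightarrow> 'a) \<Rightarrow> ('k \<Rightarrow> 'a set) \<Rightarrow> bool"
where
  "fine_partition C \<delta> R I \<zeta> X K \<longleftrightarrow> finite I \<and>
      (\<forall>k\<in>I. C1_gradient (\<zeta> k) (X k) \<and> compact (K k) \<and> (\<forall>x. x \<notin> K k \<longrightarrow> \<zeta> k x = 0) \<and>
         (\<forall>x\<in>K k. \<forall>z\<in>K k. dist x z \<le> \<delta>) \<and> (\<forall>x. 0 \<le> \<zeta> k x)) \<and>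
      (\<forall>x. norm x \<le> R \<longrightarrow> (\<Sum>k\<in>I. \<zeta> k x) = 1) \<and>
      (\<forall>x. (\<Sum>k\<in>I. norm (X k x)) \<le> C / \<delta>)"

lemma fine_partitionD:
  assumes "fine_partition C \<delta> R I \<zeta> X K"
  shows "finite I" "norm x \<le> R \<Longrightarrow> (\<Sum>k\<in>I. \<zeta> k x) = 1" "(\<Sum>k\<in>I. norm (X k x)) \<le> C / \<delta>"
    and "\<And>k. k \<in> I \<Longrightarrow> C1_gradient (\<zeta> k) (X k)" "\<And>k. k \<in> I \<Longrightarrow> compact (K k)"
      "\<And>k x. k \<in> I \<Longrightarrow> x \<notin> K k \<Longrightarrow> \<zeta> k x = 0"
      "\<And>k x z. k \<in> I \<Longrightarrow> x \<in> K k \<Longrightarrow> z \<in> K k \<Longrightarrow> dist x z \<le> \<delta>" "\<And>k x. k \<in> I \<Longrightarrow> 0 \<le> \<zeta> k x"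
  using assms by (auto simp: fine_partition_def)

text \<open>The bump of a lattice with spacing \<open>d\<close> lives on a cube of side \<open>2 d\<close>, of diameter at most
  \<open>2 DIM d\<close>; so \<open>d = \<delta> / (2 DIM)\<close>.\<close>
lemma fine_partition_exists:
  "\<exists>C>0. \<forall>\<delta>>0. \<forall>R. \<exists>(I :: ('a::euclidean_space \<Rightarrow> int) set) (\<zeta> :: _ \<Rightarrow> 'a \<Rightarrow> real) X K. fine_partition C \<delta> R I \<zeta> X K"
proof (intro exI[of _ "2 ^ DIM('a) * (2 * real DIM('a)) * (2 * real DIM('a))"] conjI allI impI)
  let ?n = "real DIM('a)"
  have n: "?n > 0" by simp
  show "2 ^ DIM('a) * (2 * ?n) * (2 * ?n) > 0" using n by simp
  fix \<delta> R :: real assume \<delta>: "\<delta> > 0"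
  define d where "d = \<delta> / (2 * ?n)"
  have d: "d > 0" using \<delta> n by (simp add: d_def)
  define N where "N = nat \<lceil>R / d\<rceil>"
  define I where "I = PiE (Basis::'a set) (\<lambda>_. {- int N..int N})"
  define K where "K k = cbox (\<Sum>b\<in>Basis. (d * (of_int (k b) - 1)) *\<^sub>R b) (\<Sum>b\<in>(Basis::'a set). (d * (of_int (k b) + 1)) *\<^sub>R b)" for k
  have "finite I" unfolding I_def by (intro finite_PiE) auto
  moreover have "lattice_bump d k x = 0" if "x \<notin> K k" for k x
  proof -
    obtain b where b: "b \<in> Basis" "\<not> (d * (of_int (k b) - 1) \<le> x \<bullet> b \<and> x \<bullet> b \<le> d * (of_int (k b) + 1))"
      using \<open>x \<notin> K k\<close> by (auto simp: K_def mem_box)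
    then have "\<not> (of_int (k b) - 1 \<le> x \<bullet> b / d \<and> x \<bullet> b / d \<le> of_int (k b) + 1)"
      using d by (simp add: field_simps)
    then show ?thesis by (intro lattice_bump_support(1)[OF b(1)]) linarith
  qed
  moreover have "dist x z \<le> \<delta>" if "x \<in> K k" "z \<in> K k" for x z k
  proof -
    have "norm (x - z) \<le> (\<Sum>b\<in>Basis. \<bar>(x - z) \<bullet> b\<bar>)" by (rule norm_le_l1)
    also have "\<dots> \<le> (\<Sum>b\<in>(Basis::'a set). 2 * d)"
    proof (rule sum_mono)
      fix b :: 'a assume b: "b \<in> Basis"
      then have "d * (of_int (k b) - 1) \<le> x \<bullet> b \<and> x \<bullet> b \<le> d * (of_int (k b) + 1)"
        "d * (of_int (k b) - 1) \<le> z \<bullet> b \<and> z \<bullet> b \<le> d * (of_int (k b) + 1)"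
        using that by (auto simp: K_def mem_box)
      then show "\<bar>(x - z) \<bullet> b\<bar> \<le> 2 * d" by (simp add: inner_diff_left algebra_simps abs_le_iff)
    qed
    also have "\<dots> = \<delta>" using n by (simp add: d_def)
    finally show ?thesis by (simp add: dist_norm)
  qed
  moreover have "(\<Sum>k\<in>I. lattice_bump d k x) = 1" if "norm x \<le> R" for x
    unfolding I_def
  proof (rule lattice_bump_partition)
    fix b :: 'a assume "b \<in> Basis"
    then have "\<bar>x \<bullet> b / d\<bar> \<le> R / d" using Basis_le_norm[of b x] that d by (simp add: divide_right_mono)
    also have "\<dots> \<le> real N" by (simp add: N_def real_nat_ceiling_ge)
    finally show "\<bar>x \<bullet> b / d\<bar> \<le> real N" .
  qed
  moreover have "(\<Sum>k\<in>I. norm (lattice_bump_gradient d k x)) \<le> 2 ^ DIM('a) * (2 * ?n) * (2 * ?n) / \<delta>" for x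
  proof -
    have "(\<Sum>k\<in>I. norm (lattice_bump_gradient d k x)) \<le> 2 ^ DIM('a) * (2 * DIM('a) / d)"
      by (rule lattice_bump_gradient_sum_bound[OF d _ \<open>finite I\<close>]) (auto simp: I_def PiE_iff)
    then show ?thesis using \<delta> by (simp add: d_def field_simps)
  qed
  ultimately have "fine_partition (2 ^ DIM('a) * (2 * ?n) * (2 * ?n)) \<delta> R I (lattice_bump d) (lattice_bump_gradient d) K"
    unfolding fine_partition_def
    by (auto intro!: C1_gradient_lattice_bump[OF d] lattice_bump_nonneg simp: K_def)
  then show "\<exists>(I :: ('a \<Rightarrow> int) set) (\<zeta> :: _ \<Rightarrow> 'a \<Rightarrow> real) X K. fine_partition (2 ^ DIM('a) * (2 * ?n) * (2 * ?n)) \<delta> R I \<zeta> X K"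
    by blast
qed

section \<open>Flux inequalities on the whole domain\<close>

text \<open>Near each boundary point, one constant vector is normal to the boundary up to an error of order \<open>\<epsilon>\<close>. The
  regularity of the boundary enters the estimates only through the relation between \<open>\<epsilon>\<close> and \<open>\<delta>\<close>.\<close>
definition flat_at :: "'a::euclidean_space set \<Rightarrow> 'a \<Rightarrow> real \<Rightarrow> real \<Rightarrow> bool" where
  "flat_at \<Omega> x \<epsilon> \<delta> \<longleftrightarrow> (\<exists>Q c e a \<phi> g g0. C1_chart \<Omega> Q c e a \<phi> g \<and>
     cball x \<delta> \<subseteq> chart_domain Q c a \<and> g0 \<bullet> e = 0 \<and>
     (\<forall>y\<in>coord_base e a. Q (y + \<phi> y *\<^sub>R e) + c \<in> cball x \<delta> \<longrightarrow> norm (g y - g0) \<le> \<epsilon>))"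

definition nearly_flat :: "'a::euclidean_space set \<Rightarrow> real \<Rightarrow> real \<Rightarrow> bool" where
  "nearly_flat \<Omega> \<epsilon> \<delta> \<longleftrightarrow> (\<forall>x\<in>frontier \<Omega>. flat_at \<Omega> x \<epsilon> \<delta>)"

text \<open>If \<open>K\<close> misses the boundary then the flux and the surface integral both vanish. Otherwise \<open>K\<close> lies in the ball of radius
  \<open>\<delta>\<close> about a boundary point, hence in a single chart.\<close>
lemma
  fixes \<Omega> :: "'a::euclidean_space set"
  assumes \<sigma>: "hypersurface_measure \<Omega> \<sigma>" and flat: "nearly_flat \<Omega> \<epsilon> \<delta>" and \<Omega>: "open \<Omega>"
    and f: "C1_gradient f F" and K: "compact K" "\<And>x. x \<notin> K \<Longrightarrow> f x = 0" "\<And>x z. x \<in> K \<Longrightarrow> z \<in> K \<Longrightarrow> dist x z \<le> \<delta>"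
    and pos: "\<And>x. 0 \<le> f x"
  shows small_piece_integrable: "integrable \<sigma> f" (is ?int)
    and small_piece_flux_le: "norm \<nu> = 1 \<Longrightarrow> (LINT x|lborel. (F x \<bullet> \<nu>) * indicator \<Omega> x) \<le> (LINT x|\<sigma>. f x)" (is "_ \<Longrightarrow> ?le")
    and small_piece_flux_ge: "\<exists>\<nu>. norm \<nu> \<le> 1 \<and> (1 - 2 * \<epsilon>) * (LINT x|\<sigma>. f x) \<le> (LINT x|lborel. (F x \<bullet> \<nu>) * indicator \<Omega> x)" (is ?ge)
proof -
  have f\<sigma>: "f \<in> borel_measurable \<sigma>"
    using borel_measurable_continuous_onI[OF C1_gradientD(3)[OF f]]
    by (simp add: measurable_cong_sets[OF hypersurface_measureD(1)[OF \<sigma>] refl])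
  show ?int and "norm \<nu> = 1 \<Longrightarrow> ?le" and ?ge
  proof (atomize(full), cases "K \<inter> frontier \<Omega> = {}")
    case True
    have ae: "AE x in \<sigma>. f x = 0"
      using hypersurface_measureD(3)[OF \<sigma>] by eventually_elim (use True K(2) in blast)
    have "integrable \<sigma> f \<longleftrightarrow> integrable \<sigma> (\<lambda>x. 0 :: real)"
      by (rule integrable_cong_AE) (use f\<sigma> ae in auto)
    moreover have "(LINT x|\<sigma>. f x) = 0"
      using integral_cong_AE[of f \<sigma> "\<lambda>x. 0"] f\<sigma> ae by simp
    moreover have "(LINT x|lborel. (F x \<bullet> \<mu>) * indicator \<Omega> x) = 0" for \<mu>
      by (rule interior_divergence[OF f K(1,2) True \<Omega>])
    ultimately show "?int \<and> (norm \<nu> = 1 \<longrightarrow> ?le) \<and> ?ge"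
      by (auto intro!: exI[of _ 0])
  next
    case False
    then obtain z where z: "z \<in> K" "z \<in> frontier \<Omega>" by auto
    have Kz: "K \<subseteq> cball z \<delta>" using K(3)[OF z(1)] by auto
    obtain Q c e a \<phi> g g0 where chart: "C1_chart \<Omega> Q c e a \<phi> g" and sub: "cball z \<delta> \<subseteq> chart_domain Q c a"
      and g0: "g0 \<bullet> e = 0" and osc: "\<forall>y\<in>coord_base e a. Q (y + \<phi> y *\<^sub>R e) + c \<in> cball z \<delta> \<longrightarrow> norm (g y - g0) \<le> \<epsilon>"
      using bspec[OF flat[unfolded nearly_flat_def flat_at_def] z(2)] by (elim exE conjE) (rule that)
    note Q = C1_chartD(1)[OF chart] and e = C1_chartD(2)[OF chart]
    have Kd: "K \<subseteq> chart_domain Q c a" using Kz sub by blast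
    have "integrable \<sigma> f"
      by (rule chart_surface_integrable[OF \<sigma> chart K(1) Kd K(2) C1_gradientD(3)[OF f] pos])
    moreover have "(LINT x|lborel. (F x \<bullet> \<nu>) * indicator \<Omega> x) \<le> (LINT x|\<sigma>. f x)" if "norm \<nu> = 1"
      by (rule chart_flux_le_surface[OF \<sigma> chart f K(1) Kd K(2) \<Omega> pos that])
    moreover have "norm (Q (e - g0) /\<^sub>R norm (e - g0)) \<le> 1"
      using graph_normal_norm(2)[OF e g0] by (simp add: orthogonal_chart_map(5)[OF Q] field_simps)
    moreover have "(1 - 2 * \<epsilon>) * (LINT x|\<sigma>. f x) \<le> (LINT x|lborel. (F x \<bullet> (Q (e - g0) /\<^sub>R norm (e - g0))) * indicator \<Omega> x)"
      by (rule chart_flux_ge_surface[OF \<sigma> chart f K(1) Kd K(2) \<Omega> pos g0]) (use osc Kz in blast)+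
    ultimately show "?int \<and> (norm \<nu> = 1 \<longrightarrow> ?le) \<and> ?ge"
      by blast
  qed
qed

lemma integrable_continuous_bounded_set:
  fixes h :: "'a::euclidean_space \<Rightarrow> real"
  assumes h: "continuous_on UNIV h" and \<Omega>: "bounded \<Omega>" and [measurable]: "\<Omega> \<in> sets borel"
  shows "integrable lborel (\<lambda>x. h x * indicator \<Omega> x)"
proof -
  obtain R where R: "\<And>x. x \<in> \<Omega> \<Longrightarrow> norm x \<le> R" using \<Omega> by (auto simp: bounded_iff)
  have "bounded (h ` cball 0 R)" by (intro compact_imp_bounded compact_continuous_image continuous_on_subset[OF h]) auto
  then obtain M where M: "M > 0" "\<And>x. norm x \<le> R \<Longrightarrow> \<bar>h x\<bar> \<le> M" by (auto simp: bounded_pos)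
  have [measurable]: "h \<in> borel_measurable borel" by (rule borel_measurable_continuous_onI[OF h])
  show ?thesis
    by (rule integrable_lborel_bounded_support[where M=M and R=R]) (use M R in \<open>force simp: indicator_def\<close>)+
qed

text \<open>On the boundary the constant \<open>1\<close> is a finite sum of bumps, each of them integrable by the chart formula;
  so \<open>\<sigma>\<close> is finite, and \<open>h\<close> is bounded on the compact boundary.\<close>
lemma surface_integrable:
  fixes \<Omega> :: "'a::euclidean_space set" and h :: "'a \<Rightarrow> real"
  assumes \<sigma>: "hypersurface_measure \<Omega> \<sigma>" and flat: "nearly_flat \<Omega> \<epsilon> \<delta>" "\<delta> > 0" and \<Omega>: "open \<Omega>" "bounded \<Omega>"
    and h: "continuous_on UNIV h"
  shows "integrable \<sigma> h"
proof -
  have frontier: "compact (frontier \<Omega>)" using \<Omega> by (simp add: compact_frontier_bounded)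
  then obtain R where R: "\<And>x. x \<in> frontier \<Omega> \<Longrightarrow> norm x \<le> R" by (meson bounded_iff compact_imp_bounded)
  obtain C where parts: "\<forall>\<delta>>0. \<forall>R. \<exists>(I :: ('a \<Rightarrow> int) set) (\<zeta> :: _ \<Rightarrow> 'a \<Rightarrow> real) X K. fine_partition C \<delta> R I \<zeta> X K"
    using fine_partition_exists[where 'a='a] by (elim exE conjE) (rule that)
  obtain I :: "('a \<Rightarrow> int) set" and \<zeta> :: "_ \<Rightarrow> 'a \<Rightarrow> real" and X K where
    part: "fine_partition C \<delta> R I \<zeta> X K" using parts[rule_format, OF flat(2), of R] by (elim exE) (rule that)
  note P = fine_partitionD[OF part]
  have hm: "h \<in> borel_measurable \<sigma>"
    using borel_measurable_continuous_onI[OF h]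
    by (simp add: measurable_cong_sets[OF hypersurface_measureD(1)[OF \<sigma>] refl])
  have "bounded (h ` frontier \<Omega>)" by (intro compact_imp_bounded compact_continuous_image continuous_on_subset[OF h] frontier) auto
  then obtain M where M: "M > 0" "\<And>x. x \<in> frontier \<Omega> \<Longrightarrow> \<bar>h x\<bar> \<le> M" by (auto simp: bounded_pos)
  show ?thesis
  proof (rule Bochner_Integration.integrable_bound[OF _ hm])
    show "integrable \<sigma> (\<lambda>x. M * (\<Sum>k\<in>I. \<zeta> k x))"
    proof (intro integrable_mult_right Bochner_Integration.integrable_sum)
      fix k assume "k \<in> I"
      from small_piece_integrable[OF \<sigma> flat(1) \<Omega>(1) P(4,5,6,7,8)[OF this]]
      show "integrable \<sigma> (\<zeta> k)" .
    qed
    show "AE x in \<sigma>. norm (h x) \<le> norm (M * (\<Sum>k\<in>I. \<zeta> k x))"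
      using hypersurface_measureD(3)[OF \<sigma>]
    proof eventually_elim
      case (elim x)
      then show ?case using M(1) M(2)[OF elim] P(2)[OF R[OF elim]] by simp
    qed
  qed
qed

text \<open>The products \<open>\<zeta> k * f\<close> have supports small enough for the inequalities in a single chart, and their gradients
  add up to \<open>F\<close> on \<open>\<Omega>\<close> because the sum of the bumps is constant near the closure of \<open>\<Omega>\<close>.\<close>
lemma partition_localize:
  fixes \<Omega> :: "'a::euclidean_space set" and f :: "'a \<Rightarrow> real"
  assumes \<sigma>: "hypersurface_measure \<Omega> \<sigma>" and flat: "nearly_flat \<Omega> \<epsilon> \<delta>" "\<delta> > 0" and \<Omega>: "open \<Omega>" "bounded \<Omega>"
    and f: "C1_gradient f F" and pos: "\<And>x. 0 \<le> f x"
    and R: "\<And>x. x \<in> closure \<Omega> \<Longrightarrow> norm x < R" and part: "fine_partition C \<delta> R I \<zeta> X K"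
  defines "Fk \<equiv> \<lambda>k x. f x *\<^sub>R X k x + \<zeta> k x *\<^sub>R F x"
  shows "(LINT x|\<sigma>. f x) = (\<Sum>k\<in>I. LINT x|\<sigma>. \<zeta> k x * f x)"
    and "\<And>k \<nu>. k \<in> I \<Longrightarrow> integrable lborel (\<lambda>x. (Fk k x \<bullet> \<nu>) * indicator \<Omega> x)"
    and "\<And>x. x \<in> \<Omega> \<Longrightarrow> (\<Sum>k\<in>I. Fk k x) = F x"
    and "\<And>k \<nu>. k \<in> I \<Longrightarrow> norm \<nu> = 1 \<Longrightarrow> (LINT x|lborel. (Fk k x \<bullet> \<nu>) * indicator \<Omega> x) \<le> (LINT x|\<sigma>. \<zeta> k x * f x)"
    and "\<And>k. k \<in> I \<Longrightarrow> \<exists>\<nu>. norm \<nu> \<le> 1 \<and> (1 - 2 * \<epsilon>) * (LINT x|\<sigma>. \<zeta> k x * f x) \<le> (LINT x|lborel. (Fk k x \<bullet> \<nu>) * indicator \<Omega> x)"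
proof -
  note P = fine_partitionD[OF part]
  have c1: "C1_gradient (\<lambda>x. \<zeta> k x * f x) (Fk k)" if "k \<in> I" for k
    unfolding Fk_def by (rule C1_gradient_mult[OF P(4)[OF that] f])
  have supp: "\<zeta> k x * f x = 0" if "k \<in> I" "x \<notin> K k" for k x using P(6)[OF that] by simp
  have nonneg: "0 \<le> \<zeta> k x * f x" if "k \<in> I" for k x using P(8)[OF that] pos by simp
  have bor: "h \<in> borel_measurable \<sigma>" if "continuous_on UNIV h" for h :: "'a \<Rightarrow> real"
    using borel_measurable_continuous_onI[OF that]
    by (simp add: measurable_cong_sets[OF hypersurface_measureD(1)[OF \<sigma>] refl])
  have "(LINT x|\<sigma>. f x) = (LINT x|\<sigma>. (\<Sum>k\<in>I. \<zeta> k x * f x))"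
  proof (rule integral_cong_AE)
    show "AE x in \<sigma>. f x = (\<Sum>k\<in>I. \<zeta> k x * f x)"
      using hypersurface_measureD(3)[OF \<sigma>]
    proof eventually_elim
      case (elim x)
      then have "norm x \<le> R" using R[of x] by (simp add: frontier_def less_imp_le)
      then show ?case by (simp add: P(2) flip: sum_distrib_right)
    qed
    show "f \<in> borel_measurable \<sigma>" by (rule bor[OF C1_gradientD(3)[OF f]])
    show "(\<lambda>x. \<Sum>k\<in>I. \<zeta> k x * f x) \<in> borel_measurable \<sigma>"
      by (intro borel_measurable_sum bor C1_gradientD(3)[OF c1])
  qed
  also have "\<dots> = (\<Sum>k\<in>I. LINT x|\<sigma>. \<zeta> k x * f x)"
    by (intro Bochner_Integration.integral_sum surface_integrable[OF \<sigma> flat \<Omega>] C1_gradientD(3)[OF c1])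
  finally show "(LINT x|\<sigma>. f x) = (\<Sum>k\<in>I. LINT x|\<sigma>. \<zeta> k x * f x)" .
  show "integrable lborel (\<lambda>x. (Fk k x \<bullet> \<nu>) * indicator \<Omega> x)" if "k \<in> I" for k \<nu>
    using \<Omega> by (intro integrable_continuous_bounded_set continuous_intros C1_gradientD(2)[OF c1[OF that]]) auto
  show "(\<Sum>k\<in>I. Fk k x) = F x" if x: "x \<in> \<Omega>" for x
  proof -
    \<comment> \<open>the sum of the bumps minus \<open>1\<close> vanishes on a neighbourhood of \<open>x\<close>, so the gradients \<open>X k x\<close> cancel\<close>
    have "C1_gradient (\<lambda>x. (\<Sum>k\<in>I. \<zeta> k x) + - 1) (\<lambda>x. \<Sum>k\<in>I. X k x)"
    proof -
      have s: "C1_gradient (\<lambda>x. \<Sum>k\<in>I. \<zeta> k x) (\<lambda>x. \<Sum>k\<in>I. X k x)"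
        by (rule C1_gradient_sum[OF P(1) P(4)])
      show ?thesis unfolding C1_gradient_def
        by (intro conjI allI has_derivative_add_const C1_gradientD[OF s])
    qed
    then have "(\<Sum>k\<in>I. X k x) = 0"
    proof (rule C1_gradient_vanishing)
      show "x \<in> ball 0 R" using R[of x] x closure_subset[of \<Omega>] by auto
    qed (auto simp: P(2))
    moreover have "norm x \<le> R" using R[of x] x closure_subset[of \<Omega>] by (auto simp: less_imp_le)
    ultimately show ?thesis
      using P(2)[of x] by (simp add: Fk_def sum.distrib flip: scaleR_sum_right scaleR_sum_left)
  qed
  fix k assume k: "k \<in> I"
  note small = \<sigma> flat(1) \<Omega>(1) c1[OF k] P(5)[OF k] supp[OF k] P(7)[OF k] nonneg[OF k]
  show "(LINT x|lborel. (Fk k x \<bullet> \<nu>) * indicator \<Omega> x) \<le> (LINT x|\<sigma>. \<zeta> k x * f x)" if "norm \<nu> = 1" for \<nu>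
    by (rule small_piece_flux_le[OF small that])
  show "\<exists>\<nu>. norm \<nu> \<le> 1 \<and> (1 - 2 * \<epsilon>) * (LINT x|\<sigma>. \<zeta> k x * f x) \<le> (LINT x|lborel. (Fk k x \<bullet> \<nu>) * indicator \<Omega> x)"
    by (rule small_piece_flux_ge[OF small])
qed

lemma divergence_inequality:
  fixes \<Omega> :: "'a::euclidean_space set" and f :: "'a \<Rightarrow> real"
  assumes \<sigma>: "hypersurface_measure \<Omega> \<sigma>" and flat: "nearly_flat \<Omega> \<epsilon> \<delta>" "\<delta> > 0" and \<Omega>: "open \<Omega>" "bounded \<Omega>"
    and f: "C1_gradient f F" and pos: "\<And>x. 0 \<le> f x" and \<nu>: "norm \<nu> = 1"
  shows "(LINT x|lborel. (F x \<bullet> \<nu>) * indicator \<Omega> x) \<le> (LINT x|\<sigma>. f x)"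
proof -
  have "bounded (closure \<Omega>)" using \<Omega> by (simp add: bounded_closure)
  then obtain R0 where "\<And>x. x \<in> closure \<Omega> \<Longrightarrow> norm x \<le> R0" by (auto simp: bounded_iff)
  then have R: "\<And>x. x \<in> closure \<Omega> \<Longrightarrow> norm x < R0 + 1" by force
  obtain C where parts: "\<forall>\<delta>>0. \<forall>R. \<exists>(I :: ('a \<Rightarrow> int) set) (\<zeta> :: _ \<Rightarrow> 'a \<Rightarrow> real) X K. fine_partition C \<delta> R I \<zeta> X K"
    using fine_partition_exists[where 'a='a] by (elim exE conjE) (rule that)
  obtain I :: "('a \<Rightarrow> int) set" and \<zeta> :: "_ \<Rightarrow> 'a \<Rightarrow> real" and X K where
    part: "fine_partition C \<delta> (R0 + 1) I \<zeta> X K" using parts[rule_format, OF flat(2), of "R0 + 1"] by (elim exE) (rule that)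
  note L = partition_localize[OF \<sigma> flat \<Omega> f pos R part]
  have "(LINT x|lborel. (F x \<bullet> \<nu>) * indicator \<Omega> x) =
      (LINT x|lborel. (\<Sum>k\<in>I. ((f x *\<^sub>R X k x + \<zeta> k x *\<^sub>R F x) \<bullet> \<nu>) * indicator \<Omega> x))"
    using L(3) by (intro Bochner_Integration.integral_cong refl) (simp add: indicator_def flip: inner_sum_left)
  also have "\<dots> = (\<Sum>k\<in>I. LINT x|lborel. ((f x *\<^sub>R X k x + \<zeta> k x *\<^sub>R F x) \<bullet> \<nu>) * indicator \<Omega> x)"
    by (intro Bochner_Integration.integral_sum L(2))
  also have "\<dots> \<le> (\<Sum>k\<in>I. LINT x|\<sigma>. \<zeta> k x * f x)"
    by (intro sum_mono L(4) \<nu>)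
  also have "\<dots> = (LINT x|\<sigma>. f x)" by (rule L(1)[symmetric])
  finally show ?thesis .
qed

text \<open>The divergence theorem for \<open>f Z\<close>, where the field \<open>Z\<close> is the sum of \<open>\<zeta> k \<nu> k\<close> with a nearly normal vector
  \<open>\<nu> k\<close> for each bump.\<close>
lemma surface_le_bulk:
  fixes \<Omega> :: "'a::euclidean_space set"
  assumes \<sigma>: "hypersurface_measure \<Omega> \<sigma>" and \<Omega>: "open \<Omega>" "bounded \<Omega>"
  shows "\<exists>C>0. \<forall>\<epsilon> \<delta> f F. nearly_flat \<Omega> \<epsilon> \<delta> \<and> \<delta> > 0 \<and> C1_gradient f F \<and> (\<forall>x. 0 \<le> f x) \<longrightarrow>
      (1 - 2 * \<epsilon>) * (LINT x|\<sigma>. f x) \<le> (LINT x|lborel. (norm (F x) + C / \<delta> * f x) * indicator \<Omega> x)"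
proof -
  obtain C where C: "C > 0" and parts: "\<forall>\<delta>>0. \<forall>R. \<exists>(I :: ('a \<Rightarrow> int) set) (\<zeta> :: _ \<Rightarrow> 'a \<Rightarrow> real) X K. fine_partition C \<delta> R I \<zeta> X K"
    using fine_partition_exists[where 'a='a] by (elim exE conjE) (rule that)
  show ?thesis
  proof (intro exI[of _ C] conjI C allI impI; elim conjE)
    fix \<epsilon> \<delta> and f :: "'a \<Rightarrow> real" and F
    assume flat: "nearly_flat \<Omega> \<epsilon> \<delta>" "\<delta> > 0" and f: "C1_gradient f F" and nonneg: "\<forall>x. 0 \<le> f x"
    note pos = nonneg[rule_format]
    have "bounded (closure \<Omega>)" using \<Omega> by (simp add: bounded_closure)
    then obtain R0 where "\<And>x. x \<in> closure \<Omega> \<Longrightarrow> norm x \<le> R0" by (auto simp: bounded_iff)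
    then have R: "\<And>x. x \<in> closure \<Omega> \<Longrightarrow> norm x < R0 + 1" by force
    obtain I :: "('a \<Rightarrow> int) set" and \<zeta> :: "_ \<Rightarrow> 'a \<Rightarrow> real" and X K where
      part: "fine_partition C \<delta> (R0 + 1) I \<zeta> X K" using parts[rule_format, OF flat(2), of "R0 + 1"] by (elim exE) (rule that)
    note P = fine_partitionD[OF part]
    note L = partition_localize[OF \<sigma> flat \<Omega> f pos R part]
    define Fk where "Fk k x = f x *\<^sub>R X k x + \<zeta> k x *\<^sub>R F x" for k x
    obtain \<nu> where \<nu>: "\<And>k. k \<in> I \<Longrightarrow> norm (\<nu> k) \<le> 1"
      "\<And>k. k \<in> I \<Longrightarrow> (1 - 2 * \<epsilon>) * (LINT x|\<sigma>. \<zeta> k x * f x) \<le> (LINT x|lborel. (Fk k x \<bullet> \<nu> k) * indicator \<Omega> x)"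
      using L(5) unfolding Fk_def[symmetric] by metis
    have int: "integrable lborel (\<lambda>x. (Fk k x \<bullet> \<nu> k) * indicator \<Omega> x)" if "k \<in> I" for k
      unfolding Fk_def by (rule L(2)) (use that in auto)
    have "(1 - 2 * \<epsilon>) * (LINT x|\<sigma>. f x) = (\<Sum>k\<in>I. (1 - 2 * \<epsilon>) * (LINT x|\<sigma>. \<zeta> k x * f x))"
      by (simp add: L(1) sum_distrib_left)
    also have "\<dots> \<le> (\<Sum>k\<in>I. LINT x|lborel. (Fk k x \<bullet> \<nu> k) * indicator \<Omega> x)"
      by (intro sum_mono \<nu>)
    also have "\<dots> = (LINT x|lborel. (\<Sum>k\<in>I. (Fk k x \<bullet> \<nu> k) * indicator \<Omega> x))"
      by (intro Bochner_Integration.integral_sum[symmetric] int)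
    also have "\<dots> \<le> (LINT x|lborel. (norm (F x) + C / \<delta> * f x) * indicator \<Omega> x)"
    proof (rule integral_mono)
      show "integrable lborel (\<lambda>x. \<Sum>k\<in>I. (Fk k x \<bullet> \<nu> k) * indicator \<Omega> x)"
        by (intro Bochner_Integration.integrable_sum int)
      show "integrable lborel (\<lambda>x. (norm (F x) + C / \<delta> * f x) * indicator \<Omega> x)"
        using \<Omega> by (intro integrable_continuous_bounded_set continuous_intros C1_gradientD(2,3)[OF f]) auto
      fix x
      show "(\<Sum>k\<in>I. (Fk k x \<bullet> \<nu> k) * indicator \<Omega> x) \<le> (norm (F x) + C / \<delta> * f x) * indicator \<Omega> x"
      proof (cases "x \<in> \<Omega>")
        case True
        have "(\<Sum>k\<in>I. Fk k x \<bullet> \<nu> k) \<le> (\<Sum>k\<in>I. f x * norm (X k x) + \<zeta> k x * norm (F x))"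
        proof (rule sum_mono)
          fix k assume k: "k \<in> I"
          have "Fk k x \<bullet> \<nu> k \<le> norm (Fk k x) * norm (\<nu> k)" by (rule norm_cauchy_schwarz)
          also have "\<dots> \<le> norm (Fk k x) * 1" by (intro mult_left_mono \<nu> k) auto
          also have "\<dots> \<le> norm (f x *\<^sub>R X k x) + norm (\<zeta> k x *\<^sub>R F x)" unfolding Fk_def mult_1_right by (rule norm_triangle_ineq)
          finally show "Fk k x \<bullet> \<nu> k \<le> f x * norm (X k x) + \<zeta> k x * norm (F x)" using pos P(8)[OF k] by simp
        qed
        also have "\<dots> = f x * (\<Sum>k\<in>I. norm (X k x)) + (\<Sum>k\<in>I. \<zeta> k x) * norm (F x)"
          by (simp add: sum.distrib sum_distrib_left sum_distrib_right)
        also have "(\<Sum>k\<in>I. \<zeta> k x) = 1"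
          using R[of x] True closure_subset[of \<Omega>] by (intro P(2)) (auto simp: less_imp_le)
        also have "f x * (\<Sum>k\<in>I. norm (X k x)) \<le> f x * (C / \<delta>)" by (intro mult_left_mono P(3) pos)
        finally show ?thesis using True by (simp add: mult.commute)
      qed simp
    qed
    finally show "(1 - 2 * \<epsilon>) * (LINT x|\<sigma>. f x) \<le> (LINT x|lborel. (norm (F x) + C / \<delta> * f x) * indicator \<Omega> x)" .
  qed
qed

section \<open>Flatness of the boundary at small scales\<close>

text \<open>A Lebesgue number argument. The index \<open>m\<close> stands for a bound that has to become uniform along with the
  radius, such as the Hoelder constants of finitely many charts.\<close>
lemma compact_uniform_radius:
  fixes P :: "nat \<Rightarrow> 'a::metric_space set \<Rightarrow> bool"
  assumes S: "compact S" and loc: "\<And>x. x \<in> S \<Longrightarrow> \<exists>r>0. \<exists>m. P m (cball x r)"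
    and mono: "\<And>m n A B. P m A \<Longrightarrow> m \<le> n \<Longrightarrow> B \<subseteq> A \<Longrightarrow> P n B"
  shows "\<exists>\<delta>>0. \<exists>m. \<forall>x\<in>S. P m (cball x \<delta>)"
proof -
  obtain r m where r: "\<And>x. x \<in> S \<Longrightarrow> r x > 0" "\<And>x. x \<in> S \<Longrightarrow> P (m x) (cball x (r x))"
    using loc by metis
  have "S \<subseteq> (\<Union>x\<in>S. ball x (r x / 2))" using r(1) by force
  with S obtain D where D: "D \<subseteq> S" "finite D" "S \<subseteq> (\<Union>x\<in>D. ball x (r x / 2))"
    using compactE_image[OF S, of S "\<lambda>x. ball x (r x / 2)"] by (metis open_ball)
  define \<delta> where "\<delta> = Min (insert 1 ((\<lambda>x. r x / 2) ` D))"
  define M where "M = Max (insert 0 (m ` D))"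
  have "\<delta> > 0" unfolding \<delta>_def using D(1,2) r(1) by (subst Min_gr_iff) auto
  moreover have "P M (cball x \<delta>)" if x: "x \<in> S" for x
  proof -
    obtain z where z: "z \<in> D" "x \<in> ball z (r z / 2)" using D(3) x by blast
    have "\<delta> \<le> r z / 2" unfolding \<delta>_def using z(1) D(2) by (intro Min_le) auto
    moreover have "m z \<le> M" unfolding M_def using z(1) D(2) by (intro Max_ge) auto
    moreover have "cball x \<delta> \<subseteq> cball z (r z)"
    proof
      fix y assume "y \<in> cball x \<delta>"
      then have "dist x y \<le> r z / 2" using \<open>\<delta> \<le> r z / 2\<close> by simp
      then show "y \<in> cball z (r z)" using z(2) dist_triangle[of z y x] by simp
    qed
    moreover have "P (m z) (cball z (r z))" using r(2) z(1) D(1) by auto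
    ultimately show ?thesis using mono by blast
  qed
  ultimately show ?thesis by blast
qed

text \<open>The witness is the base point of \<open>x\<close>; projecting to the base does not increase distances.\<close>
lemma chart_base_point:
  assumes chart: "C1_chart \<Omega> Q c e a \<phi> g" and x: "x \<in> chart_domain Q c a"
  shows "\<exists>y0\<in>coord_base e a. \<forall>y\<in>coord_base e a. norm (y - y0) \<le> dist x (Q (y + \<phi> y *\<^sub>R e) + c)"
proof -
  note Q = C1_chartD(1)[OF chart] and e = C1_chartD(2)[OF chart]
  note Qm = orthogonal_chart_map[OF Q]
  define z where "z = inv Q (x - c)"
  have z: "z \<in> coord_box a" using x by (simp add: chart_domain_iff[OF Q] z_def)
  have xz: "x = Q z + c" by (simp add: z_def Qm)
  define y0 where "y0 = z - (z \<bullet> e) *\<^sub>R e"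
  have y0e: "y0 \<bullet> e = 0" using e by (simp add: y0_def inner_diff_left)
  have y0b: "y0 \<bullet> b = z \<bullet> b" if "b \<in> Basis - {e}" for b
    using that e by (auto simp: y0_def inner_diff_left inner_Basis)
  have "y0 \<in> coord_base e a" using z y0e y0b by (auto simp: coord_base_def coord_box_def)
  moreover have "norm (y - y0) \<le> dist x (Q (y + \<phi> y *\<^sub>R e) + c)" if y: "y \<in> coord_base e a" for y
  proof -
    define s where "s = \<phi> y - z \<bullet> e"
    have "dist x (Q (y + \<phi> y *\<^sub>R e) + c) = norm (Q (y + \<phi> y *\<^sub>R e - z))"
      by (simp add: xz dist_norm norm_minus_commute linear_diff[OF Qm(3)])
    also have "y + \<phi> y *\<^sub>R e - z = (y - y0) + s *\<^sub>R e"
      by (simp add: s_def y0_def algebra_simps)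
    also have "norm (Q ((y - y0) + s *\<^sub>R e)) = norm ((y - y0) + s *\<^sub>R e)" by (rule Qm(5))
    finally have d: "dist x (Q (y + \<phi> y *\<^sub>R e) + c) = norm ((y - y0) + s *\<^sub>R e)" .
    have "(y - y0) \<bullet> e = 0" using y y0e by (simp add: coord_base_def inner_diff_left)
    moreover from this have "e \<bullet> (y - y0) = 0" by (simp only: inner_commute)
    ultimately have "(norm (y - y0))\<^sup>2 \<le> (norm ((y - y0) + s *\<^sub>R e))\<^sup>2"
      unfolding power2_norm_eq_inner using e
      by (simp add: inner_add_left inner_add_right)
    then show ?thesis unfolding d by (rule power2_le_imp_le) simp
  qed
  ultimately show ?thesis by blast
qed

lemma C1_domainD:
  assumes "C1_domain \<Omega>"
  shows "open \<Omega>" "bounded \<Omega>" "\<Omega> \<noteq> {}" "compact (frontier \<Omega>)"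
  using conjunct1[OF assms[unfolded C1_domain_def]] by (simp_all add: bounded_domain_def compact_frontier_bounded)

lemma flat_atI:
  assumes chart: "C1_chart \<Omega> Q c e a \<phi> g" and "cball x \<delta> \<subseteq> chart_domain Q c a" and y0: "y0 \<in> coord_base e a"
    and osc: "\<And>y. y \<in> coord_base e a \<Longrightarrow> Q (y + \<phi> y *\<^sub>R e) + c \<in> cball x \<delta> \<Longrightarrow> norm (g y - g y0) \<le> \<epsilon>"
  shows "flat_at \<Omega> x \<epsilon> \<delta>"
  unfolding flat_at_def
  by (rule exI[of _ Q], rule exI[of _ c], rule exI[of _ e], rule exI[of _ a], rule exI[of _ \<phi>], rule exI[of _ g],
      rule exI[of _ "g y0"], intro conjI ballI impI assms(1,2) C1_chartD(4)[OF chart y0] osc)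

lemma C1_domain_nearly_flat:
  fixes \<Omega> :: "'a::euclidean_space set"
  assumes \<Omega>: "C1_domain \<Omega>" and \<epsilon>: "\<epsilon> > 0"
  shows "\<exists>\<delta>>0. nearly_flat \<Omega> \<epsilon> \<delta>"
proof -
  define P where "P A \<longleftrightarrow> (\<forall>z \<delta>. cball z \<delta> \<subseteq> A \<longrightarrow> flat_at \<Omega> z \<epsilon> \<delta>)" for A
  have "\<exists>\<delta>>0. \<exists>m::nat. \<forall>x\<in>frontier \<Omega>. P (cball x \<delta>)"
  proof (rule compact_uniform_radius[OF C1_domainD(4)[OF \<Omega>], where P="\<lambda>_. P"])
    fix x assume x: "x \<in> frontier \<Omega>"
    obtain Q c e a \<phi> g where chart: "C1_chart \<Omega> Q c e a \<phi> g" and xd: "x \<in> chart_domain Q c a"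
      using bspec[OF conjunct2[OF \<Omega>[unfolded C1_domain_def]] x] by (elim exE conjE) (rule that)
    obtain y0 where y0: "y0 \<in> coord_base e a"
      "\<forall>y\<in>coord_base e a. norm (y - y0) \<le> dist x (Q (y + \<phi> y *\<^sub>R e) + c)"
      using chart_base_point[OF chart xd] by (elim bexE) (rule that)
    obtain \<rho> where \<rho>: "\<rho> > 0" "\<And>y. y \<in> coord_base e a \<Longrightarrow> dist y y0 < \<rho> \<Longrightarrow> dist (g y) (g y0) < \<epsilon>"
      using C1_chartD(5)[OF chart] y0(1) \<epsilon> unfolding continuous_on_iff by meson
    obtain r where r: "r > 0" "cball x r \<subseteq> chart_domain Q c a"
      using open_chart_domain[OF C1_chartD(1)[OF chart]] xd open_contains_cball by blast
    have "P (cball x (min r (\<rho> / 2)))"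
      unfolding P_def
    proof (intro allI impI)
      fix z \<delta> assume sub: "cball z \<delta> \<subseteq> cball x (min r (\<rho> / 2))"
      show "flat_at \<Omega> z \<epsilon> \<delta>"
      proof (rule flat_atI[OF chart _ y0(1)])
        have "cball x (min r (\<rho> / 2)) \<subseteq> cball x r" by auto
        with sub r(2) show "cball z \<delta> \<subseteq> chart_domain Q c a" by (meson order_trans)
        fix y assume y: "y \<in> coord_base e a" "Q (y + \<phi> y *\<^sub>R e) + c \<in> cball z \<delta>"
        then have "Q (y + \<phi> y *\<^sub>R e) + c \<in> cball x (min r (\<rho> / 2))" using sub by blast
        then have "dist y y0 < \<rho>" using y0(2)[rule_format, OF y(1)] \<rho>(1) by (simp add: dist_norm)
        then show "norm (g y - g y0) \<le> \<epsilon>" using \<rho>(2)[OF y(1)] by (simp add: dist_norm)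
      qed
    qed
    then show "\<exists>r>0. \<exists>m::nat. P (cball x r)" using r(1) \<rho>(1) by (intro exI[of _ "min r (\<rho> / 2)"]) auto
  next
    show "P B" if "P A" "B \<subseteq> A" for A B
      using that unfolding P_def by (meson order_trans)
  qed
  then show ?thesis unfolding P_def nearly_flat_def by blast
qed

lemma C1_holder_domain_nearly_flat:
  fixes \<Omega> :: "'a::euclidean_space set"
  assumes \<Omega>: "C1_holder_domain \<theta> \<Omega>" and \<theta>: "\<theta> > 0"
  shows "\<exists>\<delta>0>0. \<exists>L\<ge>0. \<forall>\<delta>. 0 < \<delta> \<and> \<delta> \<le> \<delta>0 \<longrightarrow> nearly_flat \<Omega> (L * \<delta> powr \<theta>) \<delta>"
proof -
  define P where "P m A \<longleftrightarrow> (\<forall>z \<delta> L. 0 < \<delta> \<and> cball z \<delta> \<subseteq> A \<and> real m \<le> L \<longrightarrow> flat_at \<Omega> z (L * \<delta> powr \<theta>) \<delta>)"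
    for m A
  have "compact (frontier \<Omega>)"
    using conjunct1[OF \<Omega>[unfolded C1_holder_domain_def]] by (simp add: bounded_domain_def compact_frontier_bounded)
  then have "\<exists>\<delta>>0. \<exists>m::nat. \<forall>x\<in>frontier \<Omega>. P m (cball x \<delta>)"
  proof (rule compact_uniform_radius[where P=P])
    fix x assume x: "x \<in> frontier \<Omega>"
    obtain Q c e a \<phi> g C where chart: "C1_chart \<Omega> Q c e a \<phi> g" and xd: "x \<in> chart_domain Q c a"
      and C: "\<forall>y\<in>coord_base e a. \<forall>z\<in>coord_base e a. norm (g y - g z) \<le> C * norm (y - z) powr \<theta>"
      using bspec[OF conjunct2[OF \<Omega>[unfolded C1_holder_domain_def]] x] by (elim exE conjE) (rule that)
    obtain r where r: "r > 0" "cball x r \<subseteq> chart_domain Q c a"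
      using open_chart_domain[OF C1_chartD(1)[OF chart]] xd open_contains_cball by blast
    have "P (nat \<lceil>C\<rceil>) (cball x r)"
      unfolding P_def
    proof (intro allI impI, elim conjE)
      fix z \<delta> L assume \<delta>: "0 < \<delta>" and sub: "cball z \<delta> \<subseteq> cball x r" and L: "real (nat \<lceil>C\<rceil>) \<le> L"
      have zd: "cball z \<delta> \<subseteq> chart_domain Q c a" using sub r(2) by (rule order_trans)
      then have "z \<in> chart_domain Q c a" using \<delta> by auto
      from chart_base_point[OF chart this] obtain y0 where y0: "y0 \<in> coord_base e a"
        "\<forall>y\<in>coord_base e a. norm (y - y0) \<le> dist z (Q (y + \<phi> y *\<^sub>R e) + c)"
        by (elim bexE) (rule that)
      show "flat_at \<Omega> z (L * \<delta> powr \<theta>) \<delta>"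
      proof (rule flat_atI[OF chart zd y0(1)])
        fix y assume y: "y \<in> coord_base e a" "Q (y + \<phi> y *\<^sub>R e) + c \<in> cball z \<delta>"
        have CL: "C \<le> L" "0 \<le> L" using L real_nat_ceiling_ge[of C] by linarith+
        have "norm (g y - g y0) \<le> C * norm (y - y0) powr \<theta>" using C y(1) y0(1) by blast
        also have "\<dots> \<le> L * norm (y - y0) powr \<theta>" using CL by (intro mult_right_mono) auto
        also have "\<dots> \<le> L * \<delta> powr \<theta>"
          using y0(2)[rule_format, OF y(1)] y(2) \<theta> CL by (intro mult_left_mono powr_mono2) auto
        finally show "norm (g y - g y0) \<le> L * \<delta> powr \<theta>" .
      qed
    qed
    then show "\<exists>r>0. \<exists>m. P m (cball x r)" using r(1) by blast
  next
    fix m n :: nat and A B assume "P m A" "m \<le> n" "B \<subseteq> A"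
    then show "P n B" unfolding P_def by (meson of_nat_le_iff order_trans)
  qed
  then obtain \<delta>0 m where \<delta>0: "\<delta>0 > 0" and P: "\<And>x. x \<in> frontier \<Omega> \<Longrightarrow> P m (cball x \<delta>0)" by auto
  have "nearly_flat \<Omega> (real m * \<delta> powr \<theta>) \<delta>" if "0 < \<delta>" "\<delta> \<le> \<delta>0" for \<delta>
    using P that unfolding nearly_flat_def P_def by (simp add: subset_cball)
  then show ?thesis using \<delta>0 by (intro exI[of _ \<delta>0] conjI exI[of _ "real m"]) auto
qed

section \<open>Inequalities for p-th powers\<close>

text \<open>Convexity of the power, applied to \<open>x + y = l (x / l) + (1 - l) (y / (1 - l))\<close>.\<close>
lemma powr_add_le_convex:
  fixes x y p l :: real
  assumes p: "p \<ge> 1" and l: "0 < l" "l < 1" and xy: "0 \<le> x" "0 \<le> y"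
  shows "(x + y) powr p \<le> l powr (1 - p) * x powr p + (1 - l) powr (1 - p) * y powr p"
proof -
  have one: "1 \<le> t powr (1 - p)" if "0 < t" "t < 1" for t :: real
    using powr_mono'[of "1 - p" 0 t] that p by simp
  consider "x = 0" | "y = 0" | "x > 0" "y > 0" using xy by linarith
  then show ?thesis
  proof cases
    case 1
    then show ?thesis using mult_right_mono[OF one[of "1 - l"], of "y powr p"] l p by simp
  next
    case 2
    then show ?thesis using mult_right_mono[OF one[of "l"], of "x powr p"] l p by simp
  next
    case 3
    have "(l * (x / l) + (1 - l) * (y / (1 - l))) powr p \<le> l * (x / l) powr p + (1 - l) * (y / (1 - l)) powr p"
      using convex_onD[OF powr_convex[OF p], of "1 - l" "x / l" "y / (1 - l)"] l 3 by simp
    moreover have "t * (u / t) powr p = t powr (1 - p) * u powr p" if "0 < t" "0 < u" for t u :: real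
      using that by (simp add: powr_divide powr_diff field_simps)
    ultimately show ?thesis using l 3 by simp
  qed
qed

lemma integrable_powr_norm_diff:
  fixes f g :: "'x \<Rightarrow> 'b::{banach,second_countable_topology}"
  assumes p: "p \<ge> 1" and [measurable]: "f \<in> borel_measurable M" "g \<in> borel_measurable M"
    and int: "integrable M (\<lambda>x. norm (f x) powr p)" "integrable M (\<lambda>x. norm (g x) powr p)"
  shows "integrable M (\<lambda>x. norm (f x - g x) powr p)"
proof (rule Bochner_Integration.integrable_bound)
  show "integrable M (\<lambda>x. (1/2) powr (1 - p) * norm (f x) powr p + (1 - 1/2) powr (1 - p) * norm (g x) powr p)"
    by (intro Bochner_Integration.integrable_add integrable_mult_right int)
  show "AE x in M. norm (norm (f x - g x) powr p) \<le>
      norm ((1/2) powr (1 - p) * norm (f x) powr p + (1 - 1/2) powr (1 - p) * norm (g x) powr p)"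
  proof (rule AE_I2)
    fix x
    have "norm (f x - g x) powr p \<le> (norm (f x) + norm (g x)) powr p"
      using p by (intro powr_mono2 norm_triangle_ineq4) auto
    also have "\<dots> \<le> (1/2) powr (1 - p) * norm (f x) powr p + (1 - 1/2) powr (1 - p) * norm (g x) powr p"
      by (rule powr_add_le_convex[OF p]) auto
    finally show "norm (norm (f x - g x) powr p) \<le>
      norm ((1/2) powr (1 - p) * norm (f x) powr p + (1 - 1/2) powr (1 - p) * norm (g x) powr p)" by simp
  qed
qed simp

lemma integral_powr_norm_convex:
  fixes f g :: "'x \<Rightarrow> 'b::{banach,second_countable_topology}"
  assumes p: "p \<ge> 1" and l: "0 < l" "l < 1" and [measurable]: "f \<in> borel_measurable M" "g \<in> borel_measurable M"
    and int: "integrable M (\<lambda>x. norm (f x) powr p)" "integrable M (\<lambda>x. norm (g x) powr p)"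
  shows "(LINT x|M. norm (f x) powr p) \<le> l powr (1 - p) * (LINT x|M. norm (g x) powr p)
    + (1 - l) powr (1 - p) * (LINT x|M. norm (f x - g x) powr p)"
proof -
  note d = integrable_powr_norm_diff[OF p assms(4,5) int]
  have "(LINT x|M. norm (f x) powr p) \<le>
     (LINT x|M. l powr (1 - p) * norm (g x) powr p + (1 - l) powr (1 - p) * norm (f x - g x) powr p)"
  proof (rule integral_mono[OF int(1)])
    show "integrable M (\<lambda>x. l powr (1 - p) * norm (g x) powr p + (1 - l) powr (1 - p) * norm (f x - g x) powr p)"
      by (intro Bochner_Integration.integrable_add integrable_mult_right int d)
    fix x
    have "norm (f x) powr p \<le> (norm (g x) + norm (f x - g x)) powr p"
      using p norm_triangle_ineq[of "g x" "f x - g x"] by (intro powr_mono2) auto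
    also have "\<dots> \<le> l powr (1 - p) * norm (g x) powr p + (1 - l) powr (1 - p) * norm (f x - g x) powr p"
      by (rule powr_add_le_convex[OF p l]) auto
    finally show "norm (f x) powr p \<le> l powr (1 - p) * norm (g x) powr p + (1 - l) powr (1 - p) * norm (f x - g x) powr p" .
  qed
  also have "\<dots> = l powr (1 - p) * (LINT x|M. norm (g x) powr p) + (1 - l) powr (1 - p) * (LINT x|M. norm (f x - g x) powr p)"
    using int d by simp
  finally show ?thesis .
qed

text \<open>The convexity estimate bounds each of the two integrals by \<open>l\<^sup>1\<^sup>-\<^sup>p\<close> times the other one plus a multiple of the
  integral of the difference; the factor tends to \<open>1\<close> as \<open>l\<close> does.\<close>
lemma Lp_norm_tendsto:
  fixes f :: "nat \<Rightarrow> 'x \<Rightarrow> 'b::{banach,second_countable_topology}"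
  assumes p: "p \<ge> 1" and f: "\<And>j. f j \<in> borel_measurable M" and g: "g \<in> borel_measurable M"
    and int: "\<And>j. integrable M (\<lambda>x. norm (f j x) powr p)" "integrable M (\<lambda>x. norm (g x) powr p)"
    and lim: "(\<lambda>j. \<integral>x. norm (f j x - g x) powr p \<partial>M) \<longlonglongrightarrow> 0"
  shows "(\<lambda>j. \<integral>x. norm (f j x) powr p \<partial>M) \<longlonglongrightarrow> (LINT x|M. norm (g x) powr p)"
proof -
  define X d Y where "X j = (LINT x|M. norm (f j x) powr p)" and "d j = (LINT x|M. norm (f j x - g x) powr p)"
    and "Y = (LINT x|M. norm (g x) powr p)" for j
  have up: "X j \<le> l powr (1 - p) * Y + (1 - l) powr (1 - p) * d j" if "0 < l" "l < 1" for l j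
    unfolding X_def Y_def d_def by (rule integral_powr_norm_convex[OF p that f g int])
  have low: "Y \<le> l powr (1 - p) * X j + (1 - l) powr (1 - p) * d j" if "0 < l" "l < 1" for l j
    unfolding X_def Y_def d_def
    using integral_powr_norm_convex[OF p that g f int(2,1), of j] by (simp add: norm_minus_commute)
  have d0: "d \<longlonglongrightarrow> 0" using lim by (simp add: d_def[abs_def])
  have ev: "eventually (\<lambda>l::real. 0 < l \<and> l < 1) (at_left 1)"
    using eventually_at_left_real[of 0 "1::real"] by (auto elim: eventually_mono)
  have "X \<longlonglongrightarrow> Y"
  proof (rule order_tendstoI)
    fix b assume b: "Y < b"
    have "((\<lambda>l. l powr (1 - p) * Y) \<longlongrightarrow> 1 powr (1 - p) * Y) (at_left 1)"
      by (intro tendsto_intros) auto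
    from order_tendstoD(2)[OF this] b have "eventually (\<lambda>l. l powr (1 - p) * Y < b) (at_left 1)" by simp
    from eventually_happens'[OF _ eventually_conj[OF ev this]]
    obtain l where l: "0 < l" "l < 1" "l powr (1 - p) * Y < b" by auto
    have "(\<lambda>j. l powr (1 - p) * Y + (1 - l) powr (1 - p) * d j) \<longlonglongrightarrow> l powr (1 - p) * Y + (1 - l) powr (1 - p) * 0"
      by (intro tendsto_intros d0)
    from order_tendstoD(2)[OF this] l(3) have "\<forall>\<^sub>F j in sequentially. l powr (1 - p) * Y + (1 - l) powr (1 - p) * d j < b" by simp
    then show "\<forall>\<^sub>F j in sequentially. X j < b"
      by eventually_elim (rule le_less_trans[OF up[OF l(1,2)]])
  next
    fix b assume b: "b < Y"
    have "((\<lambda>l. Y / l powr (1 - p)) \<longlongrightarrow> Y / 1 powr (1 - p)) (at_left 1)"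
      by (intro tendsto_intros) auto
    from order_tendstoD(1)[OF this] b have "eventually (\<lambda>l. b < Y / l powr (1 - p)) (at_left 1)" by simp
    from eventually_happens'[OF _ eventually_conj[OF ev this]]
    obtain l where l: "0 < l" "l < 1" "b < Y / l powr (1 - p)" by auto
    have "(\<lambda>j. (Y - (1 - l) powr (1 - p) * d j) / l powr (1 - p)) \<longlonglongrightarrow> (Y - (1 - l) powr (1 - p) * 0) / l powr (1 - p)"
      by (intro tendsto_intros d0) (use l in auto)
    from order_tendstoD(1)[OF this] l(3) have "\<forall>\<^sub>F j in sequentially. b < (Y - (1 - l) powr (1 - p) * d j) / l powr (1 - p)" by simp
    then show "\<forall>\<^sub>F j in sequentially. b < X j"
    proof eventually_elim
      case (elim j)
      have "(Y - (1 - l) powr (1 - p) * d j) / l powr (1 - p) \<le> X j"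
        using low[OF l(1,2), of j] l(1) by (simp add: field_simps)
      with elim show ?case by simp
    qed
  qed
  then show ?thesis by (simp add: X_def[abs_def] Y_def)
qed

lemma
  fixes h :: "'a::euclidean_space \<Rightarrow> 'b::{banach,second_countable_topology}"
  assumes \<Omega>: "open \<Omega>" and h: "continuous_on UNIV h"
  shows measurable_lebesgue_on_continuous: "h \<in> borel_measurable (lebesgue_on \<Omega>)"
    and integral_lebesgue_on_continuous: "(LINT x|lebesgue_on \<Omega>. h x) = (LINT x|lborel. indicator \<Omega> x *\<^sub>R h x)"
    and integrable_lebesgue_on_continuous: "integrable (lebesgue_on \<Omega>) h \<longleftrightarrow> integrable lborel (\<lambda>x. indicator \<Omega> x *\<^sub>R h x)"
proof -
  have [measurable]: "h \<in> borel_measurable borel" by (rule borel_measurable_continuous_onI[OF h])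
  have [measurable]: "\<Omega> \<in> sets borel" using \<Omega> by simp
  have \<Omega>l: "\<Omega> \<inter> space lebesgue \<in> sets lebesgue" using \<Omega> by (simp add: lmeasurable_open)
  show "h \<in> borel_measurable (lebesgue_on \<Omega>)"
    by (intro measurable_restrict_space1 measurable_completion) simp
  show "(LINT x|lebesgue_on \<Omega>. h x) = (LINT x|lborel. indicator \<Omega> x *\<^sub>R h x)"
    by (subst integral_restrict_space[OF \<Omega>l]) (simp add: integral_completion)
  show "integrable (lebesgue_on \<Omega>) h \<longleftrightarrow> integrable lborel (\<lambda>x. indicator \<Omega> x *\<^sub>R h x)"
    by (subst integrable_restrict_space[OF \<Omega>l]) (simp add: integrable_completion)
qed

text \<open>The derivative \<open>p |t|\<^sup>p\<^sup>-\<^sup>1 sgn t\<close> is written with positive parts, in which form its continuity at \<open>0\<close>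
  is immediate.\<close>
lemma C1_gradient_abs_powr:
  fixes v :: "'a::euclidean_space \<Rightarrow> real"
  assumes v: "C1_gradient v V" and p: "p > 1"
  shows "C1_gradient (\<lambda>x. \<bar>v x\<bar> powr p) (\<lambda>x. (p * (max 0 (v x) powr (p - 1) - max 0 (- v x) powr (p - 1))) *\<^sub>R V x)"
proof (rule C1_gradient_compose[OF v, where \<phi>="\<lambda>t. \<bar>t\<bar> powr p" and \<phi>'="\<lambda>t. p * (max 0 t powr (p - 1) - max 0 (- t) powr (p - 1))"])
  fix t :: real
  consider "t > 0" | "t < 0" | "t = 0" by linarith
  then show "((\<lambda>t. \<bar>t\<bar> powr p) has_real_derivative p * (max 0 t powr (p - 1) - max 0 (- t) powr (p - 1))) (at t)"
  proof cases
    case 1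
    have "((\<lambda>t. t powr p) has_real_derivative p * t powr (p - 1)) (at t)" by (rule has_real_derivative_powr[OF 1])
    then have "((\<lambda>t. \<bar>t\<bar> powr p) has_real_derivative p * t powr (p - 1)) (at t)"
      by (rule has_field_derivative_transform_within_open[where S="{0<..}"]) (use 1 in auto)
    then show ?thesis using 1 p by simp
  next
    case 2
    have "((\<lambda>t. (- t) powr p) has_real_derivative - (p * (- t) powr (p - 1))) (at t)"
      using 2 by (auto intro!: derivative_eq_intros simp: powr_diff)
    then have "((\<lambda>t. \<bar>t\<bar> powr p) has_real_derivative - (p * (- t) powr (p - 1))) (at t)"
      by (rule has_field_derivative_transform_within_open[where S="{..<0}"]) (use 2 in auto)
    then show ?thesis using 2 p by simp
  next
    case 3
    have "((\<lambda>h. \<bar>h\<bar> powr p / h) \<longlongrightarrow> 0) (at 0)"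
    proof (rule Lim_null_comparison)
      show "\<forall>\<^sub>F h::real in at 0. norm (\<bar>h\<bar> powr p / h) \<le> \<bar>h\<bar> powr (p - 1)"
        by (rule eventually_at_filter[THEN iffD2], rule always_eventually) (auto simp: powr_diff)
      show "((\<lambda>h::real. \<bar>h\<bar> powr (p - 1)) \<longlongrightarrow> 0) (at 0)"
      proof -
        have "((\<lambda>h::real. \<bar>h\<bar>) \<longlongrightarrow> 0) (at 0)" by (intro tendsto_rabs_zero tendsto_ident_at)
        from tendsto_powr'[OF this tendsto_const[of "p - 1"]] p show ?thesis by simp
      qed
    qed
    then show ?thesis using 3 p by (simp add: DERIV_def)
  qed
next
  show "continuous_on UNIV (\<lambda>t. p * (max 0 t powr (p - 1) - max 0 (- t) powr (p - 1)))"
    using p by (intro continuous_intros continuous_on_powr') auto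
qed

lemma abs_powr_derivative_bound:
  fixes t p :: real
  assumes "p > 1"
  shows "\<bar>p * (max 0 t powr (p - 1) - max 0 (- t) powr (p - 1))\<bar> = p * \<bar>t\<bar> powr (p - 1)"
  using assms by (cases "t > 0"; cases "t = 0") (auto simp: abs_mult)

text \<open>Young's inequality for \<open>n\<close> and \<open>\<beta> s\<^sup>p\<^sup>-\<^sup>1\<close>, where \<open>(p - 1) q = p\<close> and \<open>p / q = p - 1\<close>.\<close>
lemma Young_boundary_term:
  fixes p q \<beta> s n :: real
  assumes p: "p > 1" and q: "q = p / (p - 1)" and "\<beta> \<ge> 0" "n \<ge> 0" "s \<ge> 0"
  shows "\<beta> * (p * s powr (p - 1) * n) \<le> n powr p + (p - 1) * \<beta> powr q * s powr p"
proof -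
  have q1: "q > 1" "1/p + 1/q = 1" using p by (auto simp: q field_simps)
  have "n * (\<beta> * s powr (p - 1)) \<le> n powr p / p + (\<beta> * s powr (p - 1)) powr q / q"
    using assms q1 by (intro Youngs_inequality) auto
  also have "(\<beta> * s powr (p - 1)) powr q = \<beta> powr q * s powr p"
    using assms p by (simp add: powr_mult powr_powr q)
  finally have "p * (n * (\<beta> * s powr (p - 1))) \<le> p * (n powr p / p + \<beta> powr q * s powr p / q)"
    using p by (intro mult_left_mono) auto
  also have "\<dots> = n powr p + (p - 1) * \<beta> powr q * s powr p"
    using p q1 by (simp add: q field_simps)
  finally show ?thesis by (simp add: mult_ac)
qed

section \<open>Bounds for the Rayleigh quotient\<close>

lemma
  fixes h :: "'a::euclidean_space \<Rightarrow> real"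
  assumes \<Omega>: "open \<Omega>" and h: "continuous_on UNIV h"
  shows integral_lebesgue_on_continuous_real: "(LINT x|lebesgue_on \<Omega>. h x) = (LINT x|lborel. h x * indicator \<Omega> x)"
    and integrable_lebesgue_on_continuous_real: "bounded \<Omega> \<Longrightarrow> integrable (lebesgue_on \<Omega>) h"
proof -
  show "(LINT x|lebesgue_on \<Omega>. h x) = (LINT x|lborel. h x * indicator \<Omega> x)"
    using integral_lebesgue_on_continuous[OF \<Omega> h] by (simp add: mult.commute)
  assume "bounded \<Omega>"
  then have "integrable lborel (\<lambda>x. h x * indicator \<Omega> x)"
    using \<Omega> by (intro integrable_continuous_bounded_set h) auto
  then show "integrable (lebesgue_on \<Omega>) h"
    unfolding integrable_lebesgue_on_continuous[OF \<Omega> h] by (simp add: mult.commute)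
qed

text \<open>The assumption \<open>bulk\<close> is applied to \<open>f = |v|\<^sup>p\<close>, and Young's inequality absorbs its gradient into \<open>|\<nabla>v|\<^sup>p\<close>.\<close>
lemma robin_form_lower_bound_C1:
  fixes \<Omega> :: "'a::euclidean_space set"
  assumes p: "p > 1" and q: "q = p / (p - 1)" and \<Omega>: "open \<Omega>"
    and bulk: "\<And>f F. C1_gradient f F \<Longrightarrow> (\<And>x. 0 \<le> f x) \<Longrightarrow>
      (1 - 2 * \<epsilon>) * (LINT x|\<sigma>. f x) \<le> (LINT x|lborel. (norm (F x) + C / \<delta> * f x) * indicator \<Omega> x)"
    and b: "bounded \<Omega>" and \<epsilon>: "2 * \<epsilon> < 1" and \<alpha>: "\<alpha> \<ge> 0" and v: "C1_gradient v V"
  shows "- ((p - 1) * (\<alpha> / (1 - 2 * \<epsilon>)) powr q + \<alpha> / (1 - 2 * \<epsilon>) * (C / \<delta>)) * (LINT x|lebesgue_on \<Omega>. \<bar>v x\<bar> powr p)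
    \<le> (LINT x|lebesgue_on \<Omega>. norm (V x) powr p) - \<alpha> * (LINT x|\<sigma>. \<bar>v x\<bar> powr p)"
proof -
  define \<beta> where "\<beta> = \<alpha> / (1 - 2 * \<epsilon>)"
  have \<beta>: "\<beta> \<ge> 0" using \<alpha> \<epsilon> by (simp add: \<beta>_def)
  define W where "W x = (p * (max 0 (v x) powr (p - 1) - max 0 (- v x) powr (p - 1))) *\<^sub>R V x" for x
  have W: "C1_gradient (\<lambda>x. \<bar>v x\<bar> powr p) W" unfolding W_def[abs_def] by (rule C1_gradient_abs_powr[OF v p])
  have normW: "norm (W x) = p * \<bar>v x\<bar> powr (p - 1) * norm (V x)" for x
    unfolding W_def norm_scaleR abs_powr_derivative_bound[OF p] ..
  have cV: "continuous_on UNIV (\<lambda>x. norm (V x) powr p)"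
    using p by (intro continuous_on_powr' continuous_intros C1_gradientD(2)[OF v]) auto
  have cv: "continuous_on UNIV (\<lambda>x. \<bar>v x\<bar> powr p)" by (rule C1_gradientD(3)[OF W])
  have i: "integrable lborel (\<lambda>x. h x * indicator \<Omega> x)" if "continuous_on UNIV h" for h :: "'a \<Rightarrow> real"
    using \<Omega> by (intro integrable_continuous_bounded_set that b) simp
  have "\<alpha> * (LINT x|\<sigma>. \<bar>v x\<bar> powr p) = \<beta> * ((1 - 2 * \<epsilon>) * (LINT x|\<sigma>. \<bar>v x\<bar> powr p))"
    using \<epsilon> by (simp add: \<beta>_def)
  also have "\<dots> \<le> \<beta> * (LINT x|lborel. (norm (W x) + C / \<delta> * \<bar>v x\<bar> powr p) * indicator \<Omega> x)"
    by (intro mult_left_mono bulk W \<beta>) simp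
  also have "\<dots> = (LINT x|lborel. \<beta> * ((norm (W x) + C / \<delta> * \<bar>v x\<bar> powr p) * indicator \<Omega> x))" by simp
  also have "\<dots> \<le> (LINT x|lborel. (norm (V x) powr p + ((p - 1) * \<beta> powr q + \<beta> * (C / \<delta>)) * \<bar>v x\<bar> powr p) * indicator \<Omega> x)"
  proof (rule integral_mono)
    show "integrable lborel (\<lambda>x. \<beta> * ((norm (W x) + C / \<delta> * \<bar>v x\<bar> powr p) * indicator \<Omega> x))"
      by (intro integrable_mult_right i continuous_intros C1_gradientD(2)[OF W] cv)
    show "integrable lborel (\<lambda>x. (norm (V x) powr p + ((p - 1) * \<beta> powr q + \<beta> * (C / \<delta>)) * \<bar>v x\<bar> powr p) * indicator \<Omega> x)"
      by (intro i continuous_on_add continuous_on_mult continuous_on_const cV cv)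
    fix x
    have "\<beta> * (norm (W x) + C / \<delta> * \<bar>v x\<bar> powr p) \<le> norm (V x) powr p + ((p - 1) * \<beta> powr q + \<beta> * (C / \<delta>)) * \<bar>v x\<bar> powr p"
      using Young_boundary_term[OF p q \<beta>, of "norm (V x)" "\<bar>v x\<bar>"] by (simp add: normW algebra_simps)
    then show "\<beta> * ((norm (W x) + C / \<delta> * \<bar>v x\<bar> powr p) * indicator \<Omega> x) \<le>
        (norm (V x) powr p + ((p - 1) * \<beta> powr q + \<beta> * (C / \<delta>)) * \<bar>v x\<bar> powr p) * indicator \<Omega> x"
      by (simp add: indicator_def)
  qed
  also have "\<dots> = (LINT x|lborel. norm (V x) powr p * indicator \<Omega> x + ((p - 1) * \<beta> powr q + \<beta> * (C / \<delta>)) * (\<bar>v x\<bar> powr p * indicator \<Omega> x))"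
    by (simp add: distrib_right mult.assoc)
  also have "\<dots> = (LINT x|lborel. norm (V x) powr p * indicator \<Omega> x) + ((p - 1) * \<beta> powr q + \<beta> * (C / \<delta>)) * (LINT x|lborel. \<bar>v x\<bar> powr p * indicator \<Omega> x)"
    using i[OF cV] i[OF cv] by (subst Bochner_Integration.integral_add) auto
  finally show ?thesis
    unfolding \<beta>_def[symmetric] integral_lebesgue_on_continuous_real[OF \<Omega> cV] integral_lebesgue_on_continuous_real[OF \<Omega> cv]
    by (simp only: minus_mult_left[symmetric])
qed

text \<open>All three integrals of a Sobolev function are limits of the same integrals of the \<open>C\<^sup>1\<close> functions that
  define its trace.\<close>
lemma robin_form_lower_bound:
  fixes \<Omega> :: "'a::euclidean_space set"
  assumes p: "p > 1" and \<Omega>: "open \<Omega>" "bounded \<Omega>"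
    and \<sigma>i: "\<And>h :: 'a \<Rightarrow> real. continuous_on UNIV h \<Longrightarrow> integrable \<sigma> h" and \<sigma>s: "sets \<sigma> = sets borel"
    and C1: "\<And>v V. C1_gradient v V \<Longrightarrow> - c * (LINT x|lebesgue_on \<Omega>. \<bar>v x\<bar> powr p)
      \<le> (LINT x|lebesgue_on \<Omega>. norm (V x) powr p) - \<alpha> * (LINT x|\<sigma>. \<bar>v x\<bar> powr p)"
    and u: "W1p_with_gradient p \<Omega> u G" and w: "boundary_trace p \<Omega> \<sigma> u G w"
  shows "- c * (LINT x|lebesgue_on \<Omega>. \<bar>u x\<bar> powr p)
      \<le> (LINT x|lebesgue_on \<Omega>. norm (G x) powr p) - \<alpha> * (LINT x|\<sigma>. \<bar>w x\<bar> powr p)"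
proof -
  have uL: "u \<in> borel_measurable (lebesgue_on \<Omega>)" "integrable (lebesgue_on \<Omega>) (\<lambda>x. norm (u x) powr p)"
    and GL: "G \<in> borel_measurable (lebesgue_on \<Omega>)" "integrable (lebesgue_on \<Omega>) (\<lambda>x. norm (G x) powr p)"
    using u by (auto simp: W1p_with_gradient_def in_Lp_def)
  have wL: "w \<in> borel_measurable \<sigma>" "integrable \<sigma> (\<lambda>x. norm (w x) powr p)"
    using w by (auto simp: boundary_trace_def in_Lp_def)
  obtain v :: "nat \<Rightarrow> 'a \<Rightarrow> real" where v: "\<forall>j. C_k 1 (v j)"
    and lim: "(\<lambda>j. LINT x|lebesgue_on \<Omega>. \<bar>v j x - u x\<bar> powr p) \<longlonglongrightarrow> 0"
      "(\<lambda>j. LINT x|lebesgue_on \<Omega>. norm (gradient (v j) x - G x) powr p) \<longlonglongrightarrow> 0"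
      "(\<lambda>j. LINT x|\<sigma>. \<bar>v j x - w x\<bar> powr p) \<longlonglongrightarrow> 0"
    using conjunct2[OF w[unfolded boundary_trace_def]] by (elim exE conjE) (rule that)
  have v1: "C1_gradient (v j) (gradient (v j))" for j by (rule C_k_1_C1_gradient[OF v[rule_format]])
  have cn: "continuous_on UNIV (\<lambda>x. norm (h x) powr p)" if "continuous_on UNIV h" for h :: "'a \<Rightarrow> 'b::real_normed_vector"
    using p by (intro continuous_on_powr' continuous_intros that) auto
  note int = integrable_lebesgue_on_continuous_real[OF \<Omega>(1) _ \<Omega>(2)]
  have p1: "p \<ge> 1" using p by simp
  have "(\<lambda>j. \<integral>x. norm (v j x) powr p \<partial>lebesgue_on \<Omega>) \<longlonglongrightarrow> (LINT x|lebesgue_on \<Omega>. norm (u x) powr p)"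
    by (rule Lp_norm_tendsto[OF p1 measurable_lebesgue_on_continuous[OF \<Omega>(1) C1_gradientD(3)[OF v1]] uL(1) int[OF cn[OF C1_gradientD(3)[OF v1]]] uL(2)])
       (use lim(1) in simp)
  moreover have "(\<lambda>j. \<integral>x. norm (gradient (v j) x) powr p \<partial>lebesgue_on \<Omega>) \<longlonglongrightarrow> (LINT x|lebesgue_on \<Omega>. norm (G x) powr p)"
    by (rule Lp_norm_tendsto[OF p1 measurable_lebesgue_on_continuous[OF \<Omega>(1) C1_gradientD(2)[OF v1]] GL(1) int[OF cn[OF C1_gradientD(2)[OF v1]]] GL(2)])
       (use lim(2) in simp)
  moreover have "(\<lambda>j. \<integral>x. norm (v j x) powr p \<partial>\<sigma>) \<longlonglongrightarrow> (LINT x|\<sigma>. norm (w x) powr p)"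
  proof (rule Lp_norm_tendsto[OF p1 _ wL(1) \<sigma>i[OF cn[OF C1_gradientD(3)[OF v1]]] wL(2)])
    show "v j \<in> borel_measurable \<sigma>" for j
      using borel_measurable_continuous_onI[OF C1_gradientD(3)[OF v1]] by (simp add: measurable_cong_sets[OF \<sigma>s refl])
  qed (use lim(3) in simp)
  ultimately have
    "(\<lambda>j. - c * (LINT x|lebesgue_on \<Omega>. norm (v j x) powr p)) \<longlonglongrightarrow> - c * (LINT x|lebesgue_on \<Omega>. norm (u x) powr p)"
    "(\<lambda>j. (LINT x|lebesgue_on \<Omega>. norm (gradient (v j) x) powr p) - \<alpha> * (LINT x|\<sigma>. norm (v j x) powr p))
      \<longlonglongrightarrow> (LINT x|lebesgue_on \<Omega>. norm (G x) powr p) - \<alpha> * (LINT x|\<sigma>. norm (w x) powr p)"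
    by (auto intro!: tendsto_intros)
  then have "- c * (LINT x|lebesgue_on \<Omega>. norm (u x) powr p) \<le> (LINT x|lebesgue_on \<Omega>. norm (G x) powr p) - \<alpha> * (LINT x|\<sigma>. norm (w x) powr p)"
    by (rule LIMSEQ_le) (use C1[OF v1] in auto)
  then show ?thesis by simp
qed

definition admissible ::
    "real \<Rightarrow> 'a::euclidean_space set \<Rightarrow> 'a measure \<Rightarrow> ('a \<Rightarrow> real) \<Rightarrow> ('a \<Rightarrow> 'a) \<Rightarrow> ('a \<Rightarrow> real) \<Rightarrow> bool" where
  "admissible p \<Omega> \<sigma> u G w \<longleftrightarrow> W1p_with_gradient p \<Omega> u G \<and> boundary_trace p \<Omega> \<sigma> u G w \<and>
     \<not> (AE x in lebesgue_on \<Omega>. u x = 0)"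

definition rayleigh_quotient ::
    "real \<Rightarrow> 'a::euclidean_space set \<Rightarrow> 'a measure \<Rightarrow> real \<Rightarrow> ('a \<Rightarrow> real) \<Rightarrow> ('a \<Rightarrow> 'a) \<Rightarrow> ('a \<Rightarrow> real) \<Rightarrow> real"
where
  "rayleigh_quotient p \<Omega> \<sigma> \<alpha> u G w = ((LINT x|lebesgue_on \<Omega>. norm (G x) powr p) - \<alpha> * (LINT x|\<sigma>. \<bar>w x\<bar> powr p)) /
          (LINT x|lebesgue_on \<Omega>. \<bar>u x\<bar> powr p)"

lemma robin_Lambda_eq_Inf:
  "robin_Lambda p \<Omega> \<sigma> \<alpha> = Inf {rayleigh_quotient p \<Omega> \<sigma> \<alpha> u G w | u G w. admissible p \<Omega> \<sigma> u G w}"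
  unfolding robin_Lambda_def admissible_def rayleigh_quotient_def ..

text \<open>The witness is \<open>exp (\<beta> (x \<bullet> \<nu>))\<close> with \<open>\<beta> = \<alpha>\<^sup>q\<^sup>-\<^sup>1\<close>, its own trace. Its gradient is also its
  weak gradient, since a product with a test function has no flux through the boundary.\<close>
lemma robin_exponential_test_function:
  fixes \<Omega> :: "'a::euclidean_space set"
  assumes p: "p > 1" and q: "q = p / (p - 1)" and \<Omega>: "open \<Omega>" "bounded \<Omega>" "\<Omega> \<noteq> {}" and \<alpha>: "\<alpha> > 0"
    and \<sigma>i: "\<And>h :: 'a \<Rightarrow> real. continuous_on UNIV h \<Longrightarrow> integrable \<sigma> h" and \<sigma>s: "sets \<sigma> = sets borel"
    and div: "\<And>f F \<nu>. C1_gradient f F \<Longrightarrow> (\<And>x. 0 \<le> f x) \<Longrightarrow> norm \<nu> = 1 \<Longrightarrow>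
      (LINT x|lborel. (F x \<bullet> \<nu>) * indicator \<Omega> x) \<le> (LINT x|\<sigma>. f x)"
  shows "\<exists>u G w. admissible p \<Omega> \<sigma> u G w \<and> rayleigh_quotient p \<Omega> \<sigma> \<alpha> u G w \<le> (1 - p) * \<alpha> powr q"
proof -
  obtain \<nu> :: 'a where \<nu>: "norm \<nu> = 1" using vector_choose_size[of 1] by auto
  \<comment> \<open>this \<open>\<beta>\<close> maximises \<open>\<alpha> p \<beta> - \<beta>\<^sup>p\<close>\<close>
  define \<beta> where "\<beta> = \<alpha> powr (q - 1)"
  have q1: "(q - 1) * p = q" "q > 1" using p by (auto simp: q field_simps)
  have \<beta>: "\<beta> > 0" "\<beta> powr p = \<alpha> powr q" "\<alpha> * \<beta> = \<alpha> powr q"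
    using \<alpha> q1 powr_add[of \<alpha> 1 "q - 1"] by (simp_all add: \<beta>_def powr_powr)
  define ex where "ex c x = exp (c * (x \<bullet> \<nu>))" for c x
  have ex: "C1_gradient (ex c) (\<lambda>x. (c * ex c x) *\<^sub>R \<nu>)" for c
    unfolding ex_def[abs_def]
    by (rule C1_gradient_compose[OF C1_gradient_inner, where \<phi>="\<lambda>t. exp (c * t)" and \<phi>'="\<lambda>t. c * exp (c * t)"])
       (auto intro!: derivative_eq_intros continuous_intros)
  define u where "u = ex \<beta>"
  define G where "G x = (\<beta> * u x) *\<^sub>R \<nu>" for x
  have u: "C1_gradient u G" using ex[of \<beta>] by (simp add: u_def G_def[abs_def])
  have upos: "u x > 0" for x by (simp add: u_def ex_def)
  have up: "\<bar>u x\<bar> powr p = ex (p * \<beta>) x" for x by (simp add: u_def ex_def exp_powr_real mult_ac)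
  have Gp: "norm (G x) powr p = \<beta> powr p * ex (p * \<beta>) x" for x
    using \<beta>(1) upos[of x] up[of x] by (simp add: G_def \<nu> abs_mult powr_mult)
  have int: "integrable lborel (\<lambda>x. h x * indicator \<Omega> x)" if "continuous_on UNIV h" for h :: "'a \<Rightarrow> real"
    using \<Omega> by (intro integrable_continuous_bounded_set that) auto
  note intl = integrable_lebesgue_on_continuous_real[OF \<Omega>(1) _ \<Omega>(2)]
  note intl_eq = integral_lebesgue_on_continuous_real[OF \<Omega>(1)]
  have exc: "continuous_on UNIV (ex c)" for c by (rule C1_gradientD(3)[OF ex])
  have weak: "weak_gradient \<Omega> u G"
    unfolding weak_gradient_def
  proof (intro ballI)
    fix \<psi> and b :: 'a assume \<psi>: "\<psi> \<in> test_functions \<Omega>" and b: "b \<in> Basis"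
    have \<psi>k: "\<forall>m. C_k m \<psi>" and K: "compact (closure {x. \<psi> x \<noteq> 0})" "closure {x. \<psi> x \<noteq> 0} \<subseteq> \<Omega>"
      using \<psi> by (auto simp: test_functions_def)
    have \<psi>1: "C1_gradient \<psi> (gradient \<psi>)" by (rule C_k_1_C1_gradient) (rule \<psi>k[rule_format])
    have m: "C1_gradient (\<lambda>x. u x * \<psi> x) (\<lambda>x. \<psi> x *\<^sub>R G x + u x *\<^sub>R gradient \<psi> x)"
      by (rule C1_gradient_mult[OF u \<psi>1])
    have c: "continuous_on UNIV (\<lambda>x. u x * (gradient \<psi> x \<bullet> b))" "continuous_on UNIV (\<lambda>x. (G x \<bullet> b) * \<psi> x)"
      by (intro continuous_intros C1_gradientD[OF u] C1_gradientD[OF \<psi>1])+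
    have "(LINT x|lborel. ((\<psi> x *\<^sub>R G x + u x *\<^sub>R gradient \<psi> x) \<bullet> b) * indicator \<Omega> x) = 0"
    proof (rule interior_divergence[OF m K(1) _ _ \<Omega>(1)])
      show "u x * \<psi> x = 0" if "x \<notin> closure {x. \<psi> x \<noteq> 0}" for x
        using that closure_subset[of "{x. \<psi> x \<noteq> 0}"] by auto
      show "closure {x. \<psi> x \<noteq> 0} \<inter> frontier \<Omega> = {}"
        using K(2) \<Omega>(1) by (auto simp: frontier_def interior_open)
    qed
    also have "(\<lambda>x. ((\<psi> x *\<^sub>R G x + u x *\<^sub>R gradient \<psi> x) \<bullet> b) * indicator \<Omega> x) =
       (\<lambda>x. (u x * (gradient \<psi> x \<bullet> b)) * indicator \<Omega> x + ((G x \<bullet> b) * \<psi> x) * indicator \<Omega> x)"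
      by (simp add: fun_eq_iff inner_add_left algebra_simps)
    also have "(LINT x|lborel. (u x * (gradient \<psi> x \<bullet> b)) * indicator \<Omega> x + ((G x \<bullet> b) * \<psi> x) * indicator \<Omega> x) =
       (LINT x|lebesgue_on \<Omega>. u x * (gradient \<psi> x \<bullet> b)) + (LINT x|lebesgue_on \<Omega>. (G x \<bullet> b) * \<psi> x)"
      unfolding intl_eq[OF c(1)] intl_eq[OF c(2)] by (rule Bochner_Integration.integral_add[OF int[OF c(1)] int[OF c(2)]])
    finally show "(LINT x|lebesgue_on \<Omega>. u x * (gradient \<psi> x \<bullet> b)) = - (LINT x|lebesgue_on \<Omega>. (G x \<bullet> b) * \<psi> x)" by simp
  qed
  have W: "W1p_with_gradient p \<Omega> u G"
    unfolding W1p_with_gradient_def in_Lp_def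
    using measurable_lebesgue_on_continuous[OF \<Omega>(1) C1_gradientD(3)[OF u]] measurable_lebesgue_on_continuous[OF \<Omega>(1) C1_gradientD(2)[OF u]]
      intl[OF exc] weak by (simp add: up Gp)
  have T: "boundary_trace p \<Omega> \<sigma> u G u"
    unfolding boundary_trace_def in_Lp_def
  proof (intro conjI exI[of _ "\<lambda>_. u"] allI)
    show "u \<in> borel_measurable \<sigma>"
      using borel_measurable_continuous_onI[OF C1_gradientD(3)[OF u]] by (simp add: measurable_cong_sets[OF \<sigma>s refl])
    show "integrable \<sigma> (\<lambda>x. norm (u x) powr p)" using \<sigma>i[OF exc] by (simp add: up)
    show "C_k 1 u" by (rule C1_gradient_gradient(1)[OF u])
  qed (simp_all add: C1_gradient_gradient(2)[OF u])
  have nz: "\<not> (AE x in lebesgue_on \<Omega>. u x = 0)"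
  proof
    assume "AE x in lebesgue_on \<Omega>. u x = 0"
    then have "AE x in lebesgue_on \<Omega>. False"
    proof eventually_elim
      case (elim x)
      then show ?case using upos[of x] by simp
    qed
    then have "AE x in lebesgue. x \<notin> \<Omega>"
      using \<Omega>(1) by (subst (asm) AE_restrict_space_iff) (auto simp: lmeasurable_open)
    then have "\<Omega> \<in> null_sets lebesgue" using \<Omega>(1) by (subst AE_iff_null_sets) auto
    then show False using open_not_negligible[OF \<Omega>(1,3)] by (simp add: negligible_iff_null_sets)
  qed
  define U where "U = (LINT x|lebesgue_on \<Omega>. ex (p * \<beta>) x)"
  define S where "S = (LINT x|\<sigma>. ex (p * \<beta>) x)"
  have "U \<noteq> 0"
  proof
    assume "U = 0"
    then have "AE x in lebesgue_on \<Omega>. ex (p * \<beta>) x = 0"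
      unfolding U_def by (subst (asm) integral_nonneg_eq_0_iff_AE[OF intl[OF exc]]) (auto simp: ex_def)
    then show False using nz by (simp add: ex_def u_def)
  qed
  moreover have "U \<ge> 0" unfolding U_def by (rule integral_nonneg_AE) (simp add: ex_def)
  ultimately have U: "U > 0" by simp
  have "p * \<beta> * U \<le> S"
  proof -
    have "p * \<beta> * U = (LINT x|lborel. p * \<beta> * (ex (p * \<beta>) x * indicator \<Omega> x))"
      by (simp add: U_def intl_eq[OF exc])
    also have "\<dots> = (LINT x|lborel. (((p * \<beta> * ex (p * \<beta>) x) *\<^sub>R \<nu>) \<bullet> \<nu>) * indicator \<Omega> x)"
    proof -
      have "\<nu> \<bullet> \<nu> = 1" using \<nu> by (simp add: norm_eq_1)
      then show ?thesis by (simp only: inner_scaleR_left mult_1_right mult.assoc)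
    qed
    also have "\<dots> \<le> S"
      unfolding S_def by (rule div[OF ex _ \<nu>]) (simp add: ex_def)
    finally show ?thesis .
  qed
  then have "\<beta> powr p * U - \<alpha> * S \<le> \<beta> powr p * U - \<alpha> * (p * \<beta> * U)" using \<alpha> by simp
  also have "\<dots> = (1 - p) * \<alpha> powr q * U" unfolding \<beta>(2) \<beta>(3)[symmetric] by (simp add: algebra_simps)
  finally have "(\<beta> powr p * U - \<alpha> * S) / U \<le> (1 - p) * \<alpha> powr q" using U by (simp add: field_simps)
  then have "rayleigh_quotient p \<Omega> \<sigma> \<alpha> u G u \<le> (1 - p) * \<alpha> powr q"
    unfolding rayleigh_quotient_def up Gp by (simp add: U_def S_def)
  moreover have "admissible p \<Omega> \<sigma> u G u" unfolding admissible_def by (intro conjI W T nz)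
  ultimately show ?thesis by - (rule exI[of _ u], rule exI[of _ G], rule exI[of _ u], intro conjI)
qed

lemma robin_Lambda_bounds:
  fixes \<Omega> :: "'a::euclidean_space set"
  assumes \<Omega>: "C1_domain \<Omega>"
    and \<sigma>: "hypersurface_measure \<Omega> \<sigma>" and p: "p > 1" and q: "q = p / (p - 1)"
  shows "\<exists>C>0. \<forall>\<alpha> \<epsilon> \<delta>. 0 < \<alpha> \<and> 2 * \<epsilon> < 1 \<and> 0 < \<delta> \<and> nearly_flat \<Omega> \<epsilon> \<delta> \<longrightarrow>
     robin_Lambda p \<Omega> \<sigma> \<alpha> \<le> (1 - p) * \<alpha> powr q \<and>
     - ((p - 1) * (\<alpha> / (1 - 2 * \<epsilon>)) powr q + \<alpha> / (1 - 2 * \<epsilon>) * (C / \<delta>)) \<le> robin_Lambda p \<Omega> \<sigma> \<alpha>"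
proof -
  note \<Omega>' = C1_domainD[OF \<Omega>]
  obtain C where C: "C > 0" and bulk: "\<forall>\<epsilon> \<delta> f F. nearly_flat \<Omega> \<epsilon> \<delta> \<and> \<delta> > 0 \<and> C1_gradient f F \<and> (\<forall>x. 0 \<le> f x) \<longrightarrow>
      (1 - 2 * \<epsilon>) * (LINT x|\<sigma>. f x) \<le> (LINT x|lborel. (norm (F x) + C / \<delta> * f x) * indicator \<Omega> x)"
    using surface_le_bulk[OF \<sigma> \<Omega>'(1,2)] by (elim exE conjE) (rule that)
  show ?thesis
  proof (intro exI[of _ C] conjI C allI impI; elim conjE)
    fix \<alpha> \<epsilon> \<delta> :: real assume \<alpha>: "0 < \<alpha>" and \<epsilon>: "2 * \<epsilon> < 1" and \<delta>: "0 < \<delta>" and flat: "nearly_flat \<Omega> \<epsilon> \<delta>"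
    define c where "c = (p - 1) * (\<alpha> / (1 - 2 * \<epsilon>)) powr q + \<alpha> / (1 - 2 * \<epsilon>) * (C / \<delta>)"
    define A where "A = {rayleigh_quotient p \<Omega> \<sigma> \<alpha> u G w | u G w. admissible p \<Omega> \<sigma> u G w}"
    note \<sigma>s = hypersurface_measureD(1)[OF \<sigma>]
    note \<sigma>i = surface_integrable[OF \<sigma> flat \<delta> \<Omega>'(1,2)]
    have low: "- c \<le> z" if "z \<in> A" for z
    proof -
      obtain u G w where z: "z = rayleigh_quotient p \<Omega> \<sigma> \<alpha> u G w" and adm: "admissible p \<Omega> \<sigma> u G w"
        using \<open>z \<in> A\<close> unfolding A_def mem_Collect_eq by (elim exE conjE) (rule that)
      then have u: "W1p_with_gradient p \<Omega> u G" "boundary_trace p \<Omega> \<sigma> u G w" and nz: "\<not> (AE x in lebesgue_on \<Omega>. u x = 0)"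
        by (simp_all add: admissible_def)
      have int: "integrable (lebesgue_on \<Omega>) (\<lambda>x. \<bar>u x\<bar> powr p)" using u(1) by (simp add: W1p_with_gradient_def in_Lp_def)
      have "(LINT x|lebesgue_on \<Omega>. \<bar>u x\<bar> powr p) \<noteq> 0"
        using nz integral_nonneg_eq_0_iff_AE[OF int] by auto
      moreover have "(LINT x|lebesgue_on \<Omega>. \<bar>u x\<bar> powr p) \<ge> 0" by (rule integral_nonneg_AE) simp
      ultimately have pos: "(LINT x|lebesgue_on \<Omega>. \<bar>u x\<bar> powr p) > 0" by (simp add: less_le)
      have "- c * (LINT x|lebesgue_on \<Omega>. \<bar>u x\<bar> powr p) \<le> (LINT x|lebesgue_on \<Omega>. norm (G x) powr p) - \<alpha> * (LINT x|\<sigma>. \<bar>w x\<bar> powr p)"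
      proof (rule robin_form_lower_bound[OF p \<Omega>'(1,2) \<sigma>i \<sigma>s _ u])
        fix v :: "'a \<Rightarrow> real" and V assume v: "C1_gradient v V"
        show "- c * (LINT x|lebesgue_on \<Omega>. \<bar>v x\<bar> powr p)
            \<le> (LINT x|lebesgue_on \<Omega>. norm (V x) powr p) - \<alpha> * (LINT x|\<sigma>. \<bar>v x\<bar> powr p)"
          unfolding c_def
        proof (rule robin_form_lower_bound_C1[OF p q \<Omega>'(1) _ \<Omega>'(2) \<epsilon> _ v])
          fix f :: "'a \<Rightarrow> real" and F assume "C1_gradient f F" "\<And>x. 0 \<le> f x"
          then show "(1 - 2 * \<epsilon>) * (LINT x|\<sigma>. f x) \<le> (LINT x|lborel. (norm (F x) + C / \<delta> * f x) * indicator \<Omega> x)"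
            by (intro bulk[rule_format] conjI flat \<delta> allI)
        qed (use \<alpha> in simp)
      qed
      then show ?thesis unfolding z rayleigh_quotient_def by (subst pos_le_divide_eq[OF pos])
    qed
    obtain z where z: "z \<in> A" "z \<le> (1 - p) * \<alpha> powr q"
    proof -
      have "\<exists>u G w. admissible p \<Omega> \<sigma> u G w \<and> rayleigh_quotient p \<Omega> \<sigma> \<alpha> u G w \<le> (1 - p) * \<alpha> powr q"
        by (rule robin_exponential_test_function[OF p q \<Omega>'(1,2,3) \<alpha> \<sigma>i \<sigma>s], assumption)
           (rule divergence_inequality[OF \<sigma> flat \<delta> \<Omega>'(1,2)])
      then obtain u G w where adm: "admissible p \<Omega> \<sigma> u G w" and le: "rayleigh_quotient p \<Omega> \<sigma> \<alpha> u G w \<le> (1 - p) * \<alpha> powr q"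
        by (elim exE conjE) (rule that)
      have "rayleigh_quotient p \<Omega> \<sigma> \<alpha> u G w \<in> A"
        unfolding A_def mem_Collect_eq by (rule exI[of _ u], rule exI[of _ G], rule exI[of _ w], intro conjI refl adm)
      then show ?thesis using le by (rule that)
    qed
    have \<Lambda>: "robin_Lambda p \<Omega> \<sigma> \<alpha> = Inf A" unfolding robin_Lambda_eq_Inf A_def ..
    have "bdd_below A" using low by (rule bdd_belowI)
    then have "Inf A \<le> (1 - p) * \<alpha> powr q" using cInf_lower[OF z(1)] z(2) by simp
    then show "robin_Lambda p \<Omega> \<sigma> \<alpha> \<le> (1 - p) * \<alpha> powr q" by (simp add: \<Lambda>)
    have "- c \<le> Inf A" using z(1) low by (intro cInf_greatest) auto
    then show "- ((p - 1) * (\<alpha> / (1 - 2 * \<epsilon>)) powr q + \<alpha> / (1 - 2 * \<epsilon>) * (C / \<delta>)) \<le> robin_Lambda p \<Omega> \<sigma> \<alpha>"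
      by (simp add: \<Lambda> c_def)
  qed
qed

section \<open>Asymptotics\<close>

text \<open>Write \<open>1 / (1 - 2 \<epsilon>) = 1 + s\<close> with \<open>0 \<le> s \<le> 1\<close>; by convexity the power lies below its chord between
  \<open>1\<close> and \<open>2\<close>.\<close>
lemma inverse_powr_linear_bound:
  fixes q \<epsilon> :: real
  assumes q: "q \<ge> 1" and \<epsilon>: "0 \<le> \<epsilon>" "\<epsilon> \<le> 1/4"
  shows "(1 / (1 - 2 * \<epsilon>)) powr q - 1 \<le> 4 * 2 powr q * \<epsilon>"
proof -
  define s where "s = 2 * \<epsilon> / (1 - 2 * \<epsilon>)"
  have s: "0 \<le> s" "s \<le> 1" "s \<le> 4 * \<epsilon>"
  proof -
    show "0 \<le> s" "s \<le> 1" using \<epsilon> by (simp_all add: s_def field_simps)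
    have "2 * \<epsilon> \<le> 4 * \<epsilon> * (1 - 2 * \<epsilon>)" using \<epsilon> mult_left_mono[of "4 * \<epsilon>" 1 \<epsilon>] by (simp add: algebra_simps)
    then show "s \<le> 4 * \<epsilon>" using \<epsilon> by (simp add: s_def pos_divide_le_eq)
  qed
  have eq: "1 / (1 - 2 * \<epsilon>) = 1 + s" using \<epsilon> by (simp add: s_def field_simps)
  have "((1 - s) *\<^sub>R 1 + s *\<^sub>R 2) powr q \<le> (1 - s) * 1 powr q + s * 2 powr q"
    by (rule convex_onD[OF powr_convex[OF q] s(1,2)]) auto
  then have "(1 + s) powr q - 1 \<le> s * (2 powr q - 1)" by (simp add: algebra_simps)
  also have "\<dots> \<le> 4 * \<epsilon> * 2 powr q"
    using s \<epsilon> ge_one_powr_ge_zero[of 2 q] q by (intro mult_mono) auto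
  finally show ?thesis unfolding eq by (simp add: mult_ac)
qed

text \<open>The two-sided bound with the dependence on \<open>\<epsilon>\<close> made linear, so that \<open>\<delta>\<close> can be optimised.\<close>
lemma robin_Lambda_error:
  fixes \<Omega> :: "'a::euclidean_space set"
  assumes \<Omega>: "C1_domain \<Omega>"
    and \<sigma>: "hypersurface_measure \<Omega> \<sigma>" and p: "p > 1" and q: "q = p / (p - 1)"
  shows "\<exists>A>0. \<exists>B>0. \<forall>\<alpha> \<epsilon> \<delta>. 0 < \<alpha> \<and> 0 \<le> \<epsilon> \<and> \<epsilon> \<le> 1/4 \<and> 0 < \<delta> \<and> nearly_flat \<Omega> \<epsilon> \<delta> \<longrightarrow>
     \<bar>robin_Lambda p \<Omega> \<sigma> \<alpha> - (1 - p) * \<alpha> powr q\<bar> \<le> A * \<epsilon> * \<alpha> powr q + B * (\<alpha> / \<delta>)"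
proof -
  obtain C where C: "C > 0" and bounds: "\<forall>\<alpha> \<epsilon> \<delta>. 0 < \<alpha> \<and> 2 * \<epsilon> < 1 \<and> 0 < \<delta> \<and> nearly_flat \<Omega> \<epsilon> \<delta> \<longrightarrow>
     robin_Lambda p \<Omega> \<sigma> \<alpha> \<le> (1 - p) * \<alpha> powr q \<and>
     - ((p - 1) * (\<alpha> / (1 - 2 * \<epsilon>)) powr q + \<alpha> / (1 - 2 * \<epsilon>) * (C / \<delta>)) \<le> robin_Lambda p \<Omega> \<sigma> \<alpha>"
    using robin_Lambda_bounds[OF assms] by (elim exE conjE) (rule that)
  have q1: "q > 1" using p by (simp add: q field_simps)
  show ?thesis
  proof (rule exI[of _ "(p - 1) * (4 * 2 powr q)"], intro conjI, use p in simp, rule exI[of _ "2 * C"], intro conjI allI impI, use C in simp, elim conjE)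
    fix \<alpha> \<epsilon> \<delta> :: real
    assume \<alpha>: "0 < \<alpha>" and \<epsilon>: "0 \<le> \<epsilon>" "\<epsilon> \<le> 1/4" and \<delta>: "0 < \<delta>" and flat: "nearly_flat \<Omega> \<epsilon> \<delta>"
    have b: "robin_Lambda p \<Omega> \<sigma> \<alpha> \<le> (1 - p) * \<alpha> powr q"
      "- ((p - 1) * (\<alpha> / (1 - 2 * \<epsilon>)) powr q + \<alpha> / (1 - 2 * \<epsilon>) * (C / \<delta>)) \<le> robin_Lambda p \<Omega> \<sigma> \<alpha>"
      using bounds[rule_format, of \<alpha> \<epsilon> \<delta>] \<alpha> \<epsilon> \<delta> flat by auto
    have "(\<alpha> / (1 - 2 * \<epsilon>)) powr q = (1 / (1 - 2 * \<epsilon>)) powr q * \<alpha> powr q"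
      using \<alpha> \<epsilon> by (simp add: powr_divide)
    also have "\<dots> \<le> (1 + 4 * 2 powr q * \<epsilon>) * \<alpha> powr q"
      using inverse_powr_linear_bound[of q \<epsilon>] q1 \<epsilon> by (intro mult_right_mono) auto
    finally have "(p - 1) * (\<alpha> / (1 - 2 * \<epsilon>)) powr q \<le> (p - 1) * ((1 + 4 * 2 powr q * \<epsilon>) * \<alpha> powr q)"
      using p by (intro mult_left_mono) auto
    moreover have "\<alpha> / (1 - 2 * \<epsilon>) \<le> 2 * \<alpha>"
    proof -
      have "\<alpha> * 1 \<le> \<alpha> * (2 * (1 - 2 * \<epsilon>))" using \<alpha> \<epsilon> by (intro mult_left_mono) auto
      then show ?thesis using \<epsilon> by (simp add: pos_divide_le_eq mult_ac)
    qed
    then have "\<alpha> / (1 - 2 * \<epsilon>) * (C / \<delta>) \<le> 2 * \<alpha> * (C / \<delta>)"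
      using C \<delta> by (intro mult_right_mono) auto
    ultimately have "(1 - p) * \<alpha> powr q - robin_Lambda p \<Omega> \<sigma> \<alpha> \<le> (p - 1) * (4 * 2 powr q) * \<epsilon> * \<alpha> powr q + 2 * C * (\<alpha> / \<delta>)"
      using b(2) by (simp add: algebra_simps)
    then show "\<bar>robin_Lambda p \<Omega> \<sigma> \<alpha> - (1 - p) * \<alpha> powr q\<bar> \<le> (p - 1) * (4 * 2 powr q) * \<epsilon> * \<alpha> powr q + 2 * C * (\<alpha> / \<delta>)"
      using b(1) by simp
  qed
qed

theorem theorem1:
  fixes \<Omega> :: "'a::euclidean_space set" and \<sigma> :: "'a measure" and p q :: real
  assumes "C1_domain \<Omega>"
    and "hypersurface_measure \<Omega> \<sigma>"
    and "p > 1"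
    and "q = p / (p - 1)"
  shows "(\<lambda>\<alpha>. robin_Lambda p \<Omega> \<sigma> \<alpha> - (1 - p) * \<alpha> powr q) \<in> o[at_top](\<lambda>\<alpha>. \<alpha> powr q) \<and>
    (\<forall>\<theta> k :: real. 0 < \<theta> \<and> \<theta> < 1 \<and> C1_holder_domain \<theta> \<Omega> \<and> k = (q + \<theta>) / (1 + \<theta>) \<longrightarrow>
       k \<in> {(q + 1) / 2 <..< q} \<and>
       (\<lambda>\<alpha>. robin_Lambda p \<Omega> \<sigma> \<alpha> - (1 - p) * \<alpha> powr q) \<in> O[at_top](\<lambda>\<alpha>. \<alpha> powr k))"
proof -
  have q1: "q > 1" using assms(3) by (simp add: assms(4) field_simps)
  obtain A B where A: "A > 0" and B: "B > 0" and err: "\<forall>\<alpha> \<epsilon> \<delta>. 0 < \<alpha> \<and> 0 \<le> \<epsilon> \<and> \<epsilon> \<le> 1/4 \<and> 0 < \<delta> \<and> nearly_flat \<Omega> \<epsilon> \<delta> \<longrightarrow>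
     \<bar>robin_Lambda p \<Omega> \<sigma> \<alpha> - (1 - p) * \<alpha> powr q\<bar> \<le> A * \<epsilon> * \<alpha> powr q + B * (\<alpha> / \<delta>)"
    using robin_Lambda_error[OF assms] by (elim exE conjE) (rule that)
  have little: "(\<lambda>\<alpha>. robin_Lambda p \<Omega> \<sigma> \<alpha> - (1 - p) * \<alpha> powr q) \<in> o[at_top](\<lambda>\<alpha>. \<alpha> powr q)"
  proof (rule landau_o.smallI)
    fix c :: real assume c: "c > 0"
    \<comment> \<open>half of \<open>c\<close> is for the flatness error, the other half for the term \<open>B \<alpha> / \<delta>\<close>, which is of lower order\<close>
    define \<epsilon> where "\<epsilon> = min (1/4) (c / (2 * A))"
    have \<epsilon>: "0 < \<epsilon>" "\<epsilon> \<le> 1/4" "A * \<epsilon> \<le> c / 2"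
    proof -
      have "A * \<epsilon> \<le> A * (c / (2 * A))" using A by (intro mult_left_mono) (auto simp: \<epsilon>_def)
      then show "A * \<epsilon> \<le> c / 2" using A by simp
    qed (use A c in \<open>auto simp: \<epsilon>_def\<close>)
    obtain \<delta> where \<delta>: "\<delta> > 0" "nearly_flat \<Omega> \<epsilon> \<delta>"
      using C1_domain_nearly_flat[OF assms(1) \<epsilon>(1)] by blast
    have "((\<lambda>\<alpha>::real. \<alpha> powr (1 - q)) \<longlongrightarrow> 0) at_top"
      by (rule tendsto_neg_powr) (use q1 in \<open>auto intro: filterlim_ident\<close>)
    then have "\<forall>\<^sub>F \<alpha>::real in at_top. \<alpha> powr (1 - q) < \<delta> * c / (2 * B)"
      by (rule order_tendstoD(2)) (use \<delta> c B in simp)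
    with eventually_gt_at_top[of 0]
    show "\<forall>\<^sub>F \<alpha> in at_top. norm (robin_Lambda p \<Omega> \<sigma> \<alpha> - (1 - p) * \<alpha> powr q) \<le> c * norm (\<alpha> powr q)"
    proof eventually_elim
      case (elim \<alpha>)
      have "B * (\<alpha> / \<delta>) = B / \<delta> * \<alpha> powr q * \<alpha> powr (1 - q)"
        using elim powr_add[of \<alpha> q "1 - q"] by simp
      also have "\<dots> \<le> B / \<delta> * \<alpha> powr q * (\<delta> * c / (2 * B))" using B \<delta> elim by (intro mult_left_mono) auto
      also have "\<dots> = c * \<alpha> powr q / 2" using B \<delta> by simp
      finally have 1: "B * (\<alpha> / \<delta>) \<le> c * \<alpha> powr q / 2" .
      have 2: "A * \<epsilon> * \<alpha> powr q \<le> c * \<alpha> powr q / 2"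
        using mult_right_mono[OF \<epsilon>(3), of "\<alpha> powr q"] by simp
      have 3: "\<bar>robin_Lambda p \<Omega> \<sigma> \<alpha> - (1 - p) * \<alpha> powr q\<bar> \<le> A * \<epsilon> * \<alpha> powr q + B * (\<alpha> / \<delta>)"
        using err[rule_format, of \<alpha> \<epsilon> \<delta>] elim \<epsilon> \<delta> by simp
      have "\<bar>robin_Lambda p \<Omega> \<sigma> \<alpha> - (1 - p) * \<alpha> powr q\<bar> \<le> c * \<alpha> powr q / 2 + c * \<alpha> powr q / 2"
        using 3 add_mono[OF 2 1] by (rule order_trans)
      then show ?case by simp
    qed
  qed
  have big: "k \<in> {(q + 1) / 2 <..< q} \<and>
       (\<lambda>\<alpha>. robin_Lambda p \<Omega> \<sigma> \<alpha> - (1 - p) * \<alpha> powr q) \<in> O[at_top](\<lambda>\<alpha>. \<alpha> powr k)"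
    if \<theta>: "0 < \<theta>" "\<theta> < 1" and holder: "C1_holder_domain \<theta> \<Omega>" and k: "k = (q + \<theta>) / (1 + \<theta>)" for \<theta> k :: real
  proof
    have "k - (q + 1) / 2 = (q - 1) * (1 - \<theta>) / (2 * (1 + \<theta>))" "q - k = (q - 1) * \<theta> / (1 + \<theta>)"
      using \<theta> by (simp_all add: k field_simps)
    moreover have "(q - 1) * (1 - \<theta>) / (2 * (1 + \<theta>)) > 0" "(q - 1) * \<theta> / (1 + \<theta>) > 0"
      using q1 \<theta> by simp_all
    ultimately have "k - (q + 1) / 2 > 0" "q - k > 0" by (simp_all only:)
    then show "k \<in> {(q + 1) / 2 <..< q}" by simp
    obtain \<delta>0 L where \<delta>0: "\<delta>0 > 0" and L: "L \<ge> 0"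
      and flat: "\<forall>\<delta>. 0 < \<delta> \<and> \<delta> \<le> \<delta>0 \<longrightarrow> nearly_flat \<Omega> (L * \<delta> powr \<theta>) \<delta>"
      using C1_holder_domain_nearly_flat[OF holder \<theta>(1)] by (elim exE conjE) (rule that)
    \<comment> \<open>the exponent for which \<open>\<delta>\<^sup>\<theta> \<alpha>\<^sup>q\<close> and \<open>\<alpha> / \<delta>\<close> have the same order when \<open>\<delta> = \<alpha>\<^sup>-\<^sup>s\<close>\<close>
    define s where "s = (q - 1) / (1 + \<theta>)"
    have s: "s > 0" "q - s * \<theta> = k" "1 + s = k"
    proof -
      show "s > 0" using q1 \<theta> by (simp add: s_def)
      show s3: "1 + s = k" using \<theta> by (simp add: s_def k add_divide_eq_iff)
      have "s * (1 + \<theta>) = q - 1" using \<theta> by (simp add: s_def)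
      then have "q - s * \<theta> = 1 + s" by (simp add: distrib_left)
      then show "q - s * \<theta> = k" using s3 by simp
    qed
    show "(\<lambda>\<alpha>. robin_Lambda p \<Omega> \<sigma> \<alpha> - (1 - p) * \<alpha> powr q) \<in> O[at_top](\<lambda>\<alpha>. \<alpha> powr k)"
    proof (rule landau_o.bigI[of "A * L + B"])
      show "A * L + B > 0" using A B L by (simp add: add_nonneg_pos)
      have "((\<lambda>\<alpha>::real. \<alpha> powr (- s)) \<longlongrightarrow> 0) at_top"
        by (rule tendsto_neg_powr) (use s in \<open>auto intro: filterlim_ident\<close>)
      from order_tendstoD(2)[OF this \<delta>0] have e1: "\<forall>\<^sub>F \<alpha>::real in at_top. \<alpha> powr (- s) < \<delta>0" .
      have "((\<lambda>\<alpha>::real. L * \<alpha> powr (- s * \<theta>)) \<longlongrightarrow> L * 0) at_top"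
        by (intro tendsto_mult tendsto_const tendsto_neg_powr) (use s \<theta> in \<open>auto intro: filterlim_ident\<close>)
      then have "\<forall>\<^sub>F \<alpha>::real in at_top. L * \<alpha> powr (- s * \<theta>) < 1/4"
        by (rule order_tendstoD(2)) simp
      with e1 eventually_gt_at_top[of 0]
      show "\<forall>\<^sub>F \<alpha> in at_top. norm (robin_Lambda p \<Omega> \<sigma> \<alpha> - (1 - p) * \<alpha> powr q) \<le> (A * L + B) * norm (\<alpha> powr k)"
      proof eventually_elim
        case (elim \<alpha>)
        define \<delta> where "\<delta> = \<alpha> powr (- s)"
        have \<delta>: "0 < \<delta>" "\<delta> \<le> \<delta>0" using elim by (simp_all add: \<delta>_def)
        have \<delta>\<theta>: "\<delta> powr \<theta> = \<alpha> powr (- s * \<theta>)" by (simp add: \<delta>_def powr_powr)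
        have "\<bar>robin_Lambda p \<Omega> \<sigma> \<alpha> - (1 - p) * \<alpha> powr q\<bar> \<le> A * (L * \<delta> powr \<theta>) * \<alpha> powr q + B * (\<alpha> / \<delta>)"
        proof (rule err[rule_format], intro conjI)
          show "nearly_flat \<Omega> (L * \<delta> powr \<theta>) \<delta>" using flat \<delta> by blast
          show "L * \<delta> powr \<theta> \<le> 1/4" unfolding \<delta>\<theta> using elim by simp
        qed (use L \<delta> elim in simp_all)
        moreover have "\<alpha> powr (- s * \<theta>) * \<alpha> powr q = \<alpha> powr k"
          unfolding powr_add[symmetric] using s(2) by simp
        then have "A * (L * \<delta> powr \<theta>) * \<alpha> powr q = A * L * \<alpha> powr k"
          unfolding \<delta>\<theta> by (simp only: mult.assoc)
        moreover have "\<alpha> / \<delta> = \<alpha> powr k"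
        proof -
          have "\<alpha> powr k = \<alpha> * \<alpha> powr s" using elim powr_add[of \<alpha> 1 s] unfolding s(3) by simp
          then show ?thesis by (simp add: \<delta>_def powr_minus_divide)
        qed
        ultimately have "\<bar>robin_Lambda p \<Omega> \<sigma> \<alpha> - (1 - p) * \<alpha> powr q\<bar> \<le> A * L * \<alpha> powr k + B * \<alpha> powr k"
          by (simp only:)
        then show ?case by (simp add: distrib_right)
      qed
    qed
  qed
  show ?thesis
  proof (rule conjI[OF little], intro allI impI)
    fix \<theta> k :: real
    assume "0 < \<theta> \<and> \<theta> < 1 \<and> C1_holder_domain \<theta> \<Omega> \<and> k = (q + \<theta>) / (1 + \<theta>)"
    then show "k \<in> {(q + 1) / 2 <..< q} \<and>
       (\<lambda>\<alpha>. robin_Lambda p \<Omega> \<sigma> \<alpha> - (1 - p) * \<alpha> powr q) \<in> O[at_top](\<lambda>\<alpha>. \<alpha> powr k)"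
      by (elim conjE) (rule big)
  qed
qed

end
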